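(* Let $n,k\in\mathbb{N}$, $\epsilon\ge0$, and let $U:\mathbb{R}^{nk}\to\mathbb{R}$ be the mean-field potential $$U(x)=\sum_{i=1}^n\Big(V(x^i)+\frac{\epsilon}{n}\sum_{\ell=1,\ell\ne i}^nW(x^i-x^\ell)\Big),\quad x=(x^1,\dots,x^n),\ x^i\in\mathbb{R}^k,$$ where $V,W\in C^3(\mathbb{R}^k)$ satisfy: $V$ has a local minimum at $0$ and $V(0)=0$; $L=\sup\|D^2V\|<\infty$, $\tilde L=\sup\|D^2W\|<\infty$, $L_H=\sup\|D^3V\|<\infty$, $\tilde L_H=\sup\|D^3W\|<\infty$; and there are $\mathcal R\in[0,\infty)$, $K\in(0,\infty)$ with $(a-b)\cdot(\nabla V(a)-\nabla V(b))\ge K|a-b|^2$ for all $a,b\in\mathbb{R}^k$ with $|a-b|\ge\mathcal R$. Let $T>0$ and $h_1\ge0$ satisfy $$L(T+h_1)^2\le\tfrac35\min\Big(\tfrac{3K}{10L},\tfrac14,\tfrac{3K}{256\cdot5\cdot2^6L\mathcal R^2(L+K)}\Big),\qquad h_1\le\frac{KT}{525L+235K},$$ $$\epsilon\tilde L<\min\Big(\tfrac K6,\ \tfrac12\big(\tfrac{K}{36\cdot149}\big)^2\big(T+8\mathcal R\sqrt{\tfrac{L+K}{K}}\big)^2\exp\big(-40\tfrac{\mathcal R}{T}\sqrt{\tfrac{L+K}{K}}\big)\Big),$$ and let $h\in(0,h_1]$ satisfy $T/h\in\mathbb{N}$ and $(L+4\epsilon\tilde L)(T^2+Th)\le1/6$.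 Let $\tilde\pi$ be the unadjusted Hamiltonian Monte Carlo transition kernel for $U$ with duration $T$ and step size $h$, and $\tilde\mu$ its unique invariant probability measure. Set $$M=\exp\Big(\tfrac52\big(1+\tfrac{4\mathcal R}{T}\sqrt{\tfrac{L+K}{K}}\big)\Big),\qquad c=\tfrac{KT^2}{156}\exp\Big(-10\tfrac{\mathcal R}{T}\sqrt{\tfrac{L+K}{K}}\Big).$$ Then for any $m\in\mathbb{N}_0$ and any probability measure $\nu$ on $\mathbb{R}^{nk}$, $$\mathrm{TV}(\tilde\mu,\nu\tilde\pi^{m+1})\ \le\ \tfrac32\left(T^{-2}+34\,k\,(L_H+8\epsilon\tilde L_H)^2\,T^4\right)^{1/2}M\,W^1_{\ell_1}(\tilde\mu,\nu)\,e^{-cm}.$$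
   Context: $|\cdot|$ is the Euclidean norm and $\|\cdot\|$ the operator norm of a multilinear form. If $\mathcal R=0$, a fraction with $\mathcal R^2$ in the denominator is read as $+\infty$. Velocity Verlet for $U$ on $\mathbb{R}^d$, $d=nk$: for $h>0$ let $\lfloor t\rfloor_h=\max\{s\in h\mathbb{Z}:s\le t\}$ and $\lceil t\rceil_h=\min\{s\in h\mathbb{Z}:s\ge t\}$. For $(x,v)\in\mathbb{R}^{2d}$, $(\tilde q_t(x,v),\tilde v_t(x,v))_{t\ge0}$ is the continuous, piecewise differentiable solution of $$\tfrac{d}{dt}\tilde q_t=\tilde v_{\lfloor t\rfloor_h}-(t-\lfloor t\rfloor_h)\nabla U(\tilde q_{\lfloor t\rfloor_h}),\qquad \tfrac{d}{dt}\tilde v_t=-\tfrac12\left(\nabla U(\tilde q_{\lfloor t\rfloor_h})+\nabla U(\tilde q_{\lceil t\rceil_h})\right)$$ with $(\tilde q_0,\tilde v_0)=(x,v)$. The unadjusted HMC (uHMC) kernel with duration $T$ and step size $h$ is $\tilde\pi(x,A)=P[\tilde q_T(x,\xi)\in A]$ with $\xi\sim\mathcal N(0,I_d)$. For a probability measure $\nu$, $\nu\tilde\pi(A)=\int\nu(dx)\tilde\pi(x,A)$, and $\tilde\pi^m$ is the $m$-fold composition ($\tilde\pi^0$ is the identity). $\mathrm{TV}(\nu,\eta)=\sup_A|\nu(A)-\eta(A)|$ over Borel sets $A$. $W^1_{\ell_1}(\nu,\eta)=\inf E[\ell_1(X,Y)]$ over all couplings $(X,Y)$ of $\nu,\eta$,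 with $\ell_1(x,y)=\sum_{i=1}^n|x^i-y^i|$. Known from earlier work (Bou-Rabee and Schuh 2020), under the stated conditions on $V,W,T,\epsilon,h_1$ and for $h\in[0,h_1]$: $W^1_{\ell_1}(\nu\tilde\pi^m,\eta\tilde\pi^m)\le Me^{-cm}W^1_{\ell_1}(\nu,\eta)$ for all probability measures $\nu,\eta$ on $\mathbb{R}^{nk}$ and all $m\ge0$, with $M=\exp\big(\tfrac52(1+\tfrac{4\mathcal R}{T}\sqrt{\tfrac{L+K}{K}})\big)$ and $c=\tfrac{KT^2}{156}\exp\big(-10\tfrac{\mathcal R}{T}\sqrt{\tfrac{L+K}{K}}\big)$; in particular $\tilde\pi$ has a unique invariant probability measure. *)

theory Defs
  imports "HOL-Probability.Probability"
begin

text \<open>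
  The Frechet derivative as a bounded linear map. Iterating it gives
  $D^2 f$ and $D^3 f$ with values in nested spaces of bounded linear maps, whose norm is the
  operator norm of the corresponding multilinear form. The value is only meaningful at points of
  differentiability.
\<close>

definition Dblinfun ::
    "('a::real_normed_vector \<Rightarrow> 'b::real_normed_vector) \<Rightarrow> 'a \<Rightarrow> 'a \<Rightarrow>\<^sub>L 'b" where
  "Dblinfun f x = Blinfun (frechet_derivative f (at x))"

abbreviation D2 ::
    "('a::real_normed_vector \<Rightarrow> real) \<Rightarrow> 'a \<Rightarrow> 'a \<Rightarrow>\<^sub>L 'a \<Rightarrow>\<^sub>L real" where
  "D2 f \<equiv> Dblinfun (Dblinfun f)"

abbreviation D3 ::
    "('a::real_normed_vector \<Rightarrow> real) \<Rightarrow> 'a \<Rightarrow> 'a \<Rightarrow>\<^sub>L 'a \<Rightarrow>\<^sub>L 'a \<Rightarrow>\<^sub>L real" where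
  "D3 f \<equiv> Dblinfun (D2 f)"

definition C3 :: "('a::real_normed_vector \<Rightarrow> real) \<Rightarrow> bool" where
  "C3 f \<longleftrightarrow> (\<forall>x. f differentiable (at x)) \<and> (\<forall>x. Dblinfun f differentiable (at x)) \<and>
     (\<forall>x. D2 f differentiable (at x)) \<and> continuous_on UNIV (D3 f)"

definition grad :: "('a::real_inner \<Rightarrow> real) \<Rightarrow> 'a \<Rightarrow> 'a" where
  "grad f x = (THE g. GDERIV f x :> g)"

definition mean_field_potential ::
    "(real ^ 'k \<Rightarrow> real) \<Rightarrow> (real ^ 'k \<Rightarrow> real) \<Rightarrow> real \<Rightarrow> real ^ 'k ^ 'n \<Rightarrow> real" where
  "mean_field_potential V W \<epsilon> x =
     (\<Sum>i\<in>UNIV. V (x $ i) + \<epsilon> / real CARD('n) * (\<Sum>l\<in>UNIV - {i}. W (x $ i - x $ l)))"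

definition hgrid :: "real \<Rightarrow> real set" where
  "hgrid h = range (\<lambda>j::int. h * of_int j)"

definition floor_grid :: "real \<Rightarrow> real \<Rightarrow> real" where
  "floor_grid h t = (GREATEST s. s \<in> hgrid h \<and> s \<le> t)"

definition ceiling_grid :: "real \<Rightarrow> real \<Rightarrow> real" where
  "ceiling_grid h t = (LEAST s. s \<in> hgrid h \<and> s \<ge> t)"

lemma floor_grid_eq:
  assumes "h > 0"
  shows "floor_grid h t = h * of_int \<lfloor>t / h\<rfloor>"
  unfolding floor_grid_def
proof (rule Greatest_equality)
  show "h * of_int \<lfloor>t / h\<rfloor> \<in> hgrid h \<and> h * of_int \<lfloor>t / h\<rfloor> \<le> t"
    using assms mult_left_mono[OF of_int_floor_le[of "t / h"], of h] by (auto simp: hgrid_def)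
next
  fix s assume "s \<in> hgrid h \<and> s \<le> t"
  then obtain j :: int where j: "s = h * of_int j" "s \<le> t"
    by (auto simp: hgrid_def)
  then have "of_int j \<le> t / h"
    using assms by (simp add: field_simps)
  then show "s \<le> h * of_int \<lfloor>t / h\<rfloor>"
    using j assms by (simp add: le_floor_iff)
qed

lemma ceiling_grid_eq:
  assumes "h > 0"
  shows "ceiling_grid h t = h * of_int \<lceil>t / h\<rceil>"
  unfolding ceiling_grid_def
proof (rule Least_equality)
  show "h * of_int \<lceil>t / h\<rceil> \<in> hgrid h \<and> h * of_int \<lceil>t / h\<rceil> \<ge> t"
    using assms mult_left_mono[OF le_of_int_ceiling[of "t / h"], of h] by (auto simp: hgrid_def)
next
  fix s assume "s \<in> hgrid h \<and> s \<ge> t"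
  then obtain j :: int where j: "s = h * of_int j" "s \<ge> t"
    by (auto simp: hgrid_def)
  then have "t / h \<le> of_int j"
    using assms by (simp add: field_simps)
  then show "h * of_int \<lceil>t / h\<rceil> \<le> s"
    using j assms by (simp add: ceiling_le_iff)
qed

text \<open>
  Piecewise differentiability: the equations are required off the grid \<open>h\<int>\<close>, where the right-hand
  sides may jump; together with continuity this determines \<open>(q, w)\<close> on \<open>[0, \<infinity>)\<close>.
\<close>

definition verlet_solution ::
    "('a::euclidean_space \<Rightarrow> real) \<Rightarrow> real \<Rightarrow> 'a \<Rightarrow> 'a \<Rightarrow> (real \<Rightarrow> 'a) \<Rightarrow> (real \<Rightarrow> 'a) \<Rightarrow> bool" where
  "verlet_solution U h x v q w \<longleftrightarrow>
     continuous_on {0..} q \<and> continuous_on {0..} w \<and> q 0 = x \<and> w 0 = v \<and>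
     (\<forall>t>0. t \<notin> hgrid h \<longrightarrow>
        (q has_vector_derivative
           (w (floor_grid h t) - (t - floor_grid h t) *\<^sub>R grad U (q (floor_grid h t)))) (at t) \<and>
        (w has_vector_derivative
           (- ((1/2) *\<^sub>R (grad U (q (floor_grid h t)) + grad U (q (ceiling_grid h t)))))) (at t))"

definition verlet_position ::
    "('a::euclidean_space \<Rightarrow> real) \<Rightarrow> real \<Rightarrow> real \<Rightarrow> 'a \<Rightarrow> 'a \<Rightarrow> 'a" where
  "verlet_position U h t x v = (THE y. \<exists>q w. verlet_solution U h x v q w \<and> q t = y)"

definition std_gaussian :: "'a::euclidean_space measure" where
  "std_gaussian =
     density lborel (\<lambda>v. ennreal (exp (- (norm v)\<^sup>2 / 2) / sqrt (2 * pi) ^ DIM('a)))"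

definition uhmc_kernel ::
    "('a::euclidean_space \<Rightarrow> real) \<Rightarrow> real \<Rightarrow> real \<Rightarrow> 'a \<Rightarrow> 'a measure" where
  "uhmc_kernel U T h x = distr std_gaussian borel (\<lambda>\<xi>. verlet_position U h T x \<xi>)"

text \<open>For a probability measure \<open>\<nu>\<close>, the measure \<open>\<nu>\<kappa>\<close> is \<open>bind \<nu> \<kappa>\<close>.\<close>

primrec kernel_pow ::
    "('a::topological_space \<Rightarrow> 'a measure) \<Rightarrow> nat \<Rightarrow> 'a \<Rightarrow> 'a measure" where
  "kernel_pow \<kappa> 0 = (\<lambda>x. return borel x)"
| "kernel_pow \<kappa> (Suc m) = (\<lambda>x. bind (kernel_pow \<kappa> m x) \<kappa>)"

definition borel_prob :: "'a::topological_space measure \<Rightarrow> bool" where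
  "borel_prob \<nu> \<longleftrightarrow> prob_space \<nu> \<and> sets \<nu> = sets borel"

definition invariant_prob ::
    "('a::topological_space \<Rightarrow> 'a measure) \<Rightarrow> 'a measure \<Rightarrow> bool" where
  "invariant_prob \<kappa> \<mu> \<longleftrightarrow> borel_prob \<mu> \<and> bind \<mu> \<kappa> = \<mu>"

definition TV :: "'a::topological_space measure \<Rightarrow> 'a measure \<Rightarrow> real" where
  "TV \<nu> \<eta> = (SUP A\<in>sets borel. \<bar>measure \<nu> A - measure \<eta> A\<bar>)"

definition couplings ::
    "'a::topological_space measure \<Rightarrow> 'a measure \<Rightarrow> ('a \<times> 'a) measure set" where
  "couplings \<nu> \<eta> = {\<gamma>. prob_space \<gamma> \<and> sets \<gamma> = sets (borel \<Otimes>\<^sub>M borel) \<and>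
     distr \<gamma> borel fst = \<nu> \<and> distr \<gamma> borel snd = \<eta>}"

definition ell1 :: "real ^ 'k ^ 'n \<Rightarrow> real ^ 'k ^ 'n \<Rightarrow> real" where
  "ell1 x y = (\<Sum>i\<in>UNIV. norm (x $ i - y $ i))"

text \<open>Extended-valued, since the measures need not have finite first moments.\<close>

definition W1_ell1 ::
    "(real ^ 'k ^ 'n) measure \<Rightarrow> (real ^ 'k ^ 'n) measure \<Rightarrow> ennreal" where
  "W1_ell1 \<nu> \<eta> =
     (INF \<gamma>\<in>couplings \<nu> \<eta>. \<integral>\<^sup>+ p. ennreal (ell1 (fst p) (snd p)) \<partial>\<gamma>)"

end

theory Submission
  imports Defs
begin

text \<open>
  The argument is dual: instead of coupling measures, it follows the Lipschitz constant of
  \<open>x \<mapsto> \<integral> g d\<pi>\<^sup>m(x, \<cdot>)\<close> for bounded measurable \<open>g\<close>, and integrates only at the end against a coupling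
  of the two initial laws.

  One step regularizes: if \<open>q\<^sub>T(x, v)\<close> denotes the Verlet position, then \<open>v \<mapsto> q\<^sub>T(y, v)\<close> is a
  diffeomorphism, and \<open>\<Phi>\<close> defined by \<open>q\<^sub>T(y, \<Phi> v) = q\<^sub>T(x, v)\<close> transports one velocity law into
  another. The relative entropy of the transported Gaussian is bounded by the squared displacement
  \<open>|\<Phi> v - v|\<^sup>2\<close> and the squared Frobenius norm of \<open>D\<Phi>\<^sup>-\<^sup>1 - I\<close>, hence so is the total variation.

  The other \<open>m\<close> steps contract the distance \<open>\<Sum>\<^sub>i f |x\<^sup>i - y\<^sup>i|\<close> with
  \<open>f r = T (1 - exp (- r / T)) + r / M\<close>. By path coupling, \<open>x\<close> and \<open>y\<close> may be assumed to
  differ in one particle only. At large distance equal velocities contract because of the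
  convexity of \<open>V\<close> at distance at least \<open>R\<close>; at small distance the velocities are shifted
  towards each other where the Gaussian densities overlap and reflected otherwise. The
  interaction is so weak that it enters only as a perturbation.
\<close>

subsection \<open>The Verlet recursion\<close>

text \<open>The contraction has to come out with the constants \<open>M\<close> and
  \<open>c\<close>, so the distance is built from them:
  \<open>lam * r \<le> f r \<le> (1 + lam) * r\<close> with \<open>lam = 1 / M\<close> turns into
  the factors \<open>M\<close> and \<open>3/2\<close> of the estimate. The two parts of
  \<open>f\<close> work at different ranges. The concave part rises by no more than
  \<open>T * exp (- r / T)\<close> beyond \<open>r\<close>, so a failure of the shift at small
  distance is affordable; the linear part keeps the gain of equal velocities where the concave part
  has saturated. Acting on test functions avoids gluing couplings measurably along the path from
  \<open>x\<close> to \<open>y\<close> and along the steps of the chain. It also puts the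
  regularizing step last in time: the kernel acts on \<open>g\<close> once, and the other
  \<open>m\<close> steps see only the resulting Lipschitz constant. No bound may grow with the
  number of particles; hence distances are sums of particle norms, and Frobenius norms are estimated
  block by block, which costs only the square root of the dimension of one particle.\<close>

fun verlet :: "('a::real_vector \<Rightarrow> 'a) \<Rightarrow> real \<Rightarrow> 'a \<Rightarrow> 'a \<Rightarrow> nat \<Rightarrow> 'a \<times> 'a" where
  "verlet F h x v 0 = (x, v)"
| "verlet F h x v (Suc j) =
     (let (q, w) = verlet F h x v j; q' = q + h *\<^sub>R w - (h\<^sup>2 / 2) *\<^sub>R F q
      in (q', w - (h / 2) *\<^sub>R (F q + F q')))"

abbreviation vpos :: "('a::real_vector \<Rightarrow> 'a) \<Rightarrow> real \<Rightarrow> 'a \<Rightarrow> 'a \<Rightarrow> nat \<Rightarrow> 'a" where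
  "vpos F h x v j \<equiv> fst (verlet F h x v j)"

abbreviation vvel :: "('a::real_vector \<Rightarrow> 'a) \<Rightarrow> real \<Rightarrow> 'a \<Rightarrow> 'a \<Rightarrow> nat \<Rightarrow> 'a" where
  "vvel F h x v j \<equiv> snd (verlet F h x v j)"

lemma vpos_Suc: "vpos F h x v (Suc j) =
    vpos F h x v j + h *\<^sub>R vvel F h x v j - (h\<^sup>2 / 2) *\<^sub>R F (vpos F h x v j)"
  by (simp add: Let_def split_beta)

lemma vvel_Suc: "vvel F h x v (Suc j) =
    vvel F h x v j - (h / 2) *\<^sub>R (F (vpos F h x v j) + F (vpos F h x v (Suc j)))"
  by (simp add: Let_def split_beta)

declare verlet.simps(2) [simp del]

text \<open>The weight of the force at grid point \<open>i\<close> in the position at grid point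
  \<open>j\<close>, the discrete form of \<open>(t - s) ds\<close> in the twice integrated equation
  of motion; the initial force counts half, as in the trapezoidal rule.\<close>

definition wt :: "real \<Rightarrow> nat \<Rightarrow> nat \<Rightarrow> real" where
  "wt h j i = h\<^sup>2 * (if i = 0 then real j / 2 else real j - real i)"

lemma wt_nonneg: "i < j \<Longrightarrow> 0 \<le> wt h j i"
  by (auto simp: wt_def)

lemma wt_Suc: "wt h (Suc j) i = wt h j i + h\<^sup>2 * (if i = 0 then 1/2 else 1)"
  by (auto simp: wt_def algebra_simps)

text \<open>The trapezoidal rule is exact for the linear function \<open>t - s\<close>, so the total
  weight has its continuous value; deviations from free flight are bounded below by this mass times
  a bound on the force.\<close>

lemma sum_wt: "(\<Sum>i<j. wt h j i) = (real j * h)\<^sup>2 / 2"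
proof (induction j)
  case (Suc j)
  have "(\<Sum>i<Suc j. wt h (Suc j) i)
      = (\<Sum>i<j. wt h j i) + h\<^sup>2 * (\<Sum>i<j. if i = 0 then 1/2 else 1) + wt h (Suc j) j"
    by (simp add: wt_Suc sum.distrib sum_distrib_left)
  also have "(\<Sum>i<j. if i = 0 then 1/2 else 1 :: real) = (if j = 0 then 0 else real j - 1/2)"
    by (induction j) auto
  finally show ?case
    using Suc by (auto simp: wt_def power2_eq_square algebra_simps)
qed simp

lemma vvel_closed:
  "vvel F h x v j = v - h *\<^sub>R ((\<Sum>i<j. (if i = 0 then 1/2 else 1) *\<^sub>R F (vpos F h x v i))
      + (if j = 0 then 0 else 1/2) *\<^sub>R F (vpos F h x v j))"
proof (induction j)
  case (Suc j)
  have half: "(h / 2) *\<^sub>R a + (h / 2) *\<^sub>R a = h *\<^sub>R a" for a :: 'a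
    by (simp flip: scaleR_add_left)
  show ?case
    unfolding vvel_Suc Suc using half[of "F (vpos F h x v j)"]
    by (cases "j = 0") (auto simp: scaleR_add_right algebra_simps)
qed simp

lemma vpos_closed:
  "vpos F h x v j = x + (real j * h) *\<^sub>R v - (\<Sum>i<j. wt h j i *\<^sub>R F (vpos F h x v i))"
proof (induction j)
  case (Suc j)
  let ?g = "\<lambda>i. F (vpos F h x v i)"
  have "(\<Sum>i<Suc j. wt h (Suc j) i *\<^sub>R ?g i)
      = (\<Sum>i<j. wt h j i *\<^sub>R ?g i) + h\<^sup>2 *\<^sub>R (\<Sum>i<j. (if i = 0 then 1/2 else 1) *\<^sub>R ?g i)
        + wt h (Suc j) j *\<^sub>R ?g j"
    by (simp add: wt_Suc scaleR_left.add sum.distrib scaleR_sum_right)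
  moreover have "wt h (Suc j) j = h\<^sup>2 * (if j = 0 then 0 else 1/2) + h\<^sup>2 / 2"
    by (auto simp: wt_def)
  ultimately show ?case
    unfolding vpos_Suc Suc vvel_closed
    by (simp add: algebra_simps power2_eq_square)
qed simp

text \<open>Subtracting free flight leaves only forces at earlier grid points, so stability can be
  proved by strong induction.\<close>

lemma vpos_diff_closed:
  "vpos F h x v j - vpos F h y u j - ((x - y) + (real j * h) *\<^sub>R (v - u))
   = - (\<Sum>i<j. wt h j i *\<^sub>R (F (vpos F h x v i) - F (vpos F h y u i)))"
  by (subst (1 2) vpos_closed) (simp add: sum_subtractf algebra_simps)

section \<open>Solving the Verlet equations between grid points\<close>

lemma scaleR_const_vector_derivative:
  fixes c :: "'a::real_normed_vector"
  assumes "(f has_field_derivative f') (at t)"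
  shows "((\<lambda>t. f t *\<^sub>R c) has_vector_derivative f' *\<^sub>R c) (at t)"
  using has_vector_derivative_scaleR[OF assms has_vector_derivative_const[of c]] by simp

lemma quadratic_vector_derivative:
  fixes a b c :: "'a::real_normed_vector"
  shows "((\<lambda>t. a + (t - s) *\<^sub>R b - ((t - s)\<^sup>2 / 2) *\<^sub>R c) has_vector_derivative b - (t - s) *\<^sub>R c) (at t)"
proof -
  have "((\<lambda>t. t - s) has_field_derivative 1) (at t)" "((\<lambda>t. (t - s)\<^sup>2 / 2) has_field_derivative t - s) (at t)"
    by (auto intro!: derivative_eq_intros)
  from this[THEN scaleR_const_vector_derivative]
  have "((\<lambda>t. a + (t - s) *\<^sub>R b - ((t - s)\<^sup>2 / 2) *\<^sub>R c)
      has_vector_derivative (0 + 1 *\<^sub>R b) - (t - s) *\<^sub>R c) (at t)"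
    by (intro has_vector_derivative_diff has_vector_derivative_add has_vector_derivative_const)
  then show ?thesis by simp
qed

lemma affine_vector_derivative:
  fixes a c :: "'a::real_normed_vector"
  shows "((\<lambda>t. a - ((t - s) / 2) *\<^sub>R c) has_vector_derivative - ((1/2) *\<^sub>R c)) (at t)"
proof -
  have "((\<lambda>t. (t - s) / 2) has_field_derivative 1/2) (at t)"
    by (auto intro!: derivative_eq_intros)
  from this[THEN scaleR_const_vector_derivative]
  have "((\<lambda>t. a - ((t - s) / 2) *\<^sub>R c) has_vector_derivative 0 - (1/2) *\<^sub>R c) (at t)"
    by (intro has_vector_derivative_diff has_vector_derivative_const)
  then show ?thesis by simp
qed

text \<open>The derivatives are prescribed only inside a cell, which is all that the mean value
  inequality asks for.\<close>

lemma same_derivative_eq_end: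
  fixes q :: "real \<Rightarrow> 'a::euclidean_space"
  assumes "a < b" "continuous_on {a..b} q" "continuous_on {a..b} p" "q a = p a"
    and "\<And>t. a < t \<Longrightarrow> t < b \<Longrightarrow> (q has_vector_derivative f t) (at t)"
    and "\<And>t. a < t \<Longrightarrow> t < b \<Longrightarrow> (p has_vector_derivative f t) (at t)"
  shows "q b = p b"
proof -
  have "\<exists>c\<in>{a<..<b}. norm ((q b - p b) - (q a - p a)) \<le> norm ((\<lambda>s. 0 :: 'a) (b - a))"
  proof (rule mvt_general[of a b "\<lambda>t. q t - p t" "\<lambda>t s. 0 :: 'a"])
    show "continuous_on {a..b} (\<lambda>t. q t - p t)"
      using assms by (intro continuous_intros)
    fix t assume "a < t" "t < b"
    then have "((\<lambda>t. q t - p t) has_vector_derivative f t - f t) (at t)"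
      using assms by (intro has_vector_derivative_diff) auto
    then show "((\<lambda>t. q t - p t) has_derivative (\<lambda>s. 0)) (at t)"
      by (simp add: has_vector_derivative_def)
  qed fact
  then show ?thesis using assms by auto
qed

context
  fixes U :: "'a::euclidean_space \<Rightarrow> real" and h :: real and x v :: 'a
  assumes h: "h > 0"
begin

lemma floor_grid_interior:
  assumes "real j * h < t" "t < real (Suc j) * h"
  shows "floor_grid h t = real j * h" "ceiling_grid h t = real (Suc j) * h" "t \<notin> hgrid h"
proof -
  have "\<lfloor>t / h\<rfloor> = int j"
    using assms h by (intro floor_unique) (auto simp: field_simps)
  then show f: "floor_grid h t = real j * h"
    by (simp add: floor_grid_eq[OF h])
  have "\<lceil>t / h\<rceil> = int (Suc j)"
    using assms h by (intro ceiling_unique) (auto simp: field_simps)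
  then show "ceiling_grid h t = real (Suc j) * h"
    by (simp add: ceiling_grid_eq[OF h] algebra_simps)
  show "t \<notin> hgrid h"
  proof
    assume "t \<in> hgrid h"
    then obtain i :: int where i: "t = h * of_int i" by (auto simp: hgrid_def)
    then have "\<lfloor>t / h\<rfloor> = i" using h by simp
    with \<open>\<lfloor>t / h\<rfloor> = int j\<close> i assms show False by (simp add: algebra_simps)
  qed
qed

lemma off_grid_cell:
  assumes "t > 0" "t \<notin> hgrid h"
  obtains j where "real j * h < t" "t < real (Suc j) * h"
proof -
  define j where "j = nat \<lfloor>t / h\<rfloor>"
  have fl: "\<lfloor>t / h\<rfloor> \<ge> 0" using assms h by simp
  then have j: "real j = of_int \<lfloor>t / h\<rfloor>" by (simp add: j_def)
  have "real j \<le> t / h" "t / h < real j + 1"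
    unfolding j by linarith+
  then have "real j * h \<le> t" "t < real (Suc j) * h"
    using h by (simp_all add: field_simps)
  moreover have "t \<noteq> real j * h"
    using assms by (auto simp: hgrid_def j image_iff mult.commute)
  ultimately show ?thesis using that[of j] by linarith
qed

text \<open>Inside a cell the force in the first equation is frozen, so the position is a quadratic
  polynomial in time. Its value at the right end fixes the second force and with it the slope of the
  velocity; therefore positions come before velocities.\<close>

lemma verlet_solution_at_grid:
  assumes "verlet_solution U h x v q w"
  shows "q (real j * h) = vpos (grad U) h x v j \<and> w (real j * h) = vvel (grad U) h x v j"
proof (induction j)
  case 0
  then show ?case using assms by (simp add: verlet_solution_def)
next
  case (Suc j)
  let ?a = "real j * h" and ?b = "real (Suc j) * h"
  let ?qj = "vpos (grad U) h x v j" and ?wj = "vvel (grad U) h x v j"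
  have ab: "?a < ?b" "0 \<le> ?a" using h by auto
  have qc: "continuous_on {?a..?b} q" and wc: "continuous_on {?a..?b} w"
    using assms ab by (auto simp: verlet_solution_def intro!: continuous_on_subset[of "{0..}"])
  have dq: "(q has_vector_derivative ?wj - (t - ?a) *\<^sub>R grad U ?qj) (at t)"
   and dw: "(w has_vector_derivative - ((1/2) *\<^sub>R (grad U ?qj + grad U (q ?b)))) (at t)"
    if "?a < t" "t < ?b" for t
  proof -
    have "t > 0" using that ab by linarith
    then show "(q has_vector_derivative ?wj - (t - ?a) *\<^sub>R grad U ?qj) (at t)"
      "(w has_vector_derivative - ((1/2) *\<^sub>R (grad U ?qj + grad U (q ?b)))) (at t)"
      using assms floor_grid_interior[OF that] Suc by (auto simp: verlet_solution_def simp del: of_nat_Suc)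
  qed
  have q: "q ?b = ?qj + (?b - ?a) *\<^sub>R ?wj - ((?b - ?a)\<^sup>2 / 2) *\<^sub>R grad U ?qj"
  proof (rule same_derivative_eq_end[OF ab(1) qc, where
        p = "\<lambda>t. ?qj + (t - ?a) *\<^sub>R ?wj - ((t - ?a)\<^sup>2 / 2) *\<^sub>R grad U ?qj"])
    show "((\<lambda>t. ?qj + (t - ?a) *\<^sub>R ?wj - ((t - ?a)\<^sup>2 / 2) *\<^sub>R grad U ?qj)
        has_vector_derivative ?wj - (t - ?a) *\<^sub>R grad U ?qj) (at t)" for t
      by (rule quadratic_vector_derivative)
    show "continuous_on {?a..?b} (\<lambda>t. ?qj + (t - ?a) *\<^sub>R ?wj - ((t - ?a)\<^sup>2 / 2) *\<^sub>R grad U ?qj)"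
      by (intro continuous_intros) simp
    show "q ?a = ?qj + (?a - ?a) *\<^sub>R ?wj - ((?a - ?a)\<^sup>2 / 2) *\<^sub>R grad U ?qj"
      using Suc by simp
  qed (rule dq)
  have w: "w ?b = ?wj - ((?b - ?a) / 2) *\<^sub>R (grad U ?qj + grad U (q ?b))"
  proof (rule same_derivative_eq_end[OF ab(1) wc, where
        p = "\<lambda>t. ?wj - ((t - ?a) / 2) *\<^sub>R (grad U ?qj + grad U (q ?b))"])
    show "((\<lambda>t. ?wj - ((t - ?a) / 2) *\<^sub>R (grad U ?qj + grad U (q ?b)))
        has_vector_derivative - ((1/2) *\<^sub>R (grad U ?qj + grad U (q ?b)))) (at t)" for t
      by (rule affine_vector_derivative)
    show "continuous_on {?a..?b} (\<lambda>t. ?wj - ((t - ?a) / 2) *\<^sub>R (grad U ?qj + grad U (q ?b)))"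
      by (intro continuous_intros) simp
    show "w ?a = ?wj - ((?a - ?a) / 2) *\<^sub>R (grad U ?qj + grad U (q ?b))"
      using Suc by simp
  qed (rule dw)
  have hb: "?b - ?a = h" by (simp add: algebra_simps)
  show ?case
    using q w unfolding hb by (simp add: vpos_Suc vvel_Suc)
qed

lemma verlet_solution_exists: "\<exists>q w. verlet_solution U h x v q w"
proof -
  let ?q = "vpos (grad U) h x v" and ?w = "vvel (grad U) h x v"
  define pq where "pq j t = ?q j + (t - real j * h) *\<^sub>R ?w j
      - ((t - real j * h)\<^sup>2 / 2) *\<^sub>R grad U (?q j)" for j t
  define pw where "pw j t = ?w j - ((t - real j * h) / 2) *\<^sub>R (grad U (?q j) + grad U (?q (Suc j)))" for j t
  define q where "q t = pq (nat \<lfloor>t / h\<rfloor>) t" for t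
  define w where "w t = pw (nat \<lfloor>t / h\<rfloor>) t" for t
  have hb: "real (Suc j) * h - real j * h = h" for j by (simp add: algebra_simps)
  \<comment> \<open>At a grid point the floor selects the polynomials of the next cell. They agree
    there with those of the cell just ended, so \<open>cell\<close> holds on closed cells.\<close>
  have glue: "pq (Suc j) (real (Suc j) * h) = pq j (real (Suc j) * h)"
    "pw (Suc j) (real (Suc j) * h) = pw j (real (Suc j) * h)" for j
    unfolding pq_def pw_def hb by (simp_all add: vpos_Suc vvel_Suc)
  have cell: "q t = pq j t" "w t = pw j t" if "real j * h \<le> t" "t \<le> real (Suc j) * h" for j t
  proof -
    have "q t = pq j t \<and> w t = pw j t"
    proof (cases "t = real (Suc j) * h")
      case True
      have "nat \<lfloor>t / h\<rfloor> = Suc j" using h True by simp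
      then show ?thesis using glue[of j] True by (simp add: q_def w_def)
    next
      case False
      have "\<lfloor>t / h\<rfloor> = int j"
        using that False h by (intro floor_unique) (auto simp: field_simps)
      then show ?thesis by (simp add: q_def w_def)
    qed
    then show "q t = pq j t" "w t = pw j t" by auto
  qed
  have cp: "continuous_on A (pq j)" "continuous_on A (pw j)" for A j
    unfolding pq_def pw_def by (auto intro!: continuous_intros)
  have "continuous_on {0..real j * h} q \<and> continuous_on {0..real j * h} w" for j
  proof (induction j)
    case (Suc j)
    have split: "{0..real (Suc j) * h} = {0..real j * h} \<union> {real j * h..real (Suc j) * h}"
    proof -
      have "0 \<le> real j * h" "real j * h \<le> real (Suc j) * h" using h by auto
      then show ?thesis by (simp only: ivl_disj_un_two_touch)
    qed
    have "continuous_on {real j * h..real (Suc j) * h} q"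
      by (rule continuous_on_eq[OF cp(1)[of _ j]]) (simp only: cell[of j] atLeastAtMost_iff)
    moreover have "continuous_on {real j * h..real (Suc j) * h} w"
      by (rule continuous_on_eq[OF cp(2)[of _ j]]) (simp only: cell[of j] atLeastAtMost_iff)
    ultimately show ?case
      unfolding split using Suc by (auto intro!: continuous_on_closed_Un)
  qed simp
  then have c: "continuous_on {0..} q" "continuous_on {0..} w"
  proof -
    have "continuous (at t within {0..}) q \<and> continuous (at t within {0..}) w"
      if "t \<ge> 0" for t
    proof -
      obtain j where j: "t / h < real j" using reals_Archimedean2 by blast
      then have tj: "t < real j * h" using h by (simp add: field_simps)
      have "at t within {0..} = at t within {0..real j * h}"
        using tj by (intro at_within_nhd[of _ "{..<real j * h}"]) auto
      then show ?thesis
        using \<open>continuous_on {0..real j * h} q \<and> continuous_on {0..real j * h} w\<close> that tj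
        by (auto simp: continuous_on_eq_continuous_within)
    qed
    then show "continuous_on {0..} q" "continuous_on {0..} w"
      by (auto simp: continuous_on_eq_continuous_within)
  qed
  have grid: "q (real j * h) = ?q j" "w (real j * h) = ?w j" for j
    using h by (auto simp: q_def w_def pq_def pw_def)
  have "verlet_solution U h x v q w"
    unfolding verlet_solution_def
  proof (intro conjI allI impI)
    show "q 0 = x" "w 0 = v" using grid[of 0] by auto
    fix t assume t: "t > 0" "t \<notin> hgrid h"
    then obtain j where j: "real j * h < t" "t < real (Suc j) * h"
      by (rule off_grid_cell)
    have "(pq j has_vector_derivative ?w j - (t - real j * h) *\<^sub>R grad U (?q j)) (at t)"
      unfolding pq_def by (rule quadratic_vector_derivative)
    then have "(q has_vector_derivative ?w j - (t - real j * h) *\<^sub>R grad U (?q j)) (at t)"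
      using j by (elim has_vector_derivative_transform_within_open[of _ _ _ "{real j * h<..<real (Suc j) * h}"])
        (auto simp: cell[of j] simp del: of_nat_Suc)
    then show "(q has_vector_derivative w (floor_grid h t) - (t - floor_grid h t) *\<^sub>R grad U (q (floor_grid h t))) (at t)"
      by (simp add: floor_grid_interior[OF j] grid del: of_nat_Suc)
    have "(pw j has_vector_derivative - ((1/2) *\<^sub>R (grad U (?q j) + grad U (?q (Suc j))))) (at t)"
      unfolding pw_def by (rule affine_vector_derivative)
    then have "(w has_vector_derivative - ((1/2) *\<^sub>R (grad U (?q j) + grad U (?q (Suc j))))) (at t)"
      using j by (elim has_vector_derivative_transform_within_open[of _ _ _ "{real j * h<..<real (Suc j) * h}"])
        (auto simp: cell[of j] simp del: of_nat_Suc)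
    then show "(w has_vector_derivative - ((1/2) *\<^sub>R (grad U (q (floor_grid h t)) + grad U (q (ceiling_grid h t))))) (at t)"
      by (simp add: floor_grid_interior[OF j] grid del: of_nat_Suc)
  qed (use c in auto)
  then show ?thesis by blast
qed

lemma verlet_position_eq: "verlet_position U h (real j * h) x v = vpos (grad U) h x v j"
  unfolding verlet_position_def
proof (rule the_equality)
  show "\<exists>q w. verlet_solution U h x v q w \<and> q (real j * h) = vpos (grad U) h x v j"
    using verlet_solution_exists verlet_solution_at_grid by blast
qed (use verlet_solution_at_grid in blast)

end

subsection \<open>Stability of the recursion\<close>

text \<open>A discrete Gronwall bound. The kernel has mass at most
  \<open>(N * h)\<^sup>2 / 2\<close>, so the hypothesis on \<Lambda> leaves a feedback factor
  \<open>1/12\<close>, and \<open>12/11 = 1 / (1 - 1/12)\<close> reproduces itself in the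
  induction.\<close>

lemma volterra_bound:
  fixes a :: "nat \<Rightarrow> real"
  assumes step: "\<And>j. j \<le> N \<Longrightarrow> a j \<le> D + \<Lambda> * (\<Sum>i<j. wt h j i * a i)"
    and "0 \<le> \<Lambda>" "\<Lambda> * (real N * h)\<^sup>2 \<le> 1/6" "0 \<le> D" "0 \<le> h"
    and "j \<le> N"
  shows "a j \<le> 12/11 * D"
  using \<open>j \<le> N\<close>
proof (induction j rule: less_induct)
  case (less j)
  have "(\<Sum>i<j. wt h j i * a i) \<le> (\<Sum>i<j. wt h j i * (12/11 * D))"
    using less by (intro sum_mono mult_left_mono) (auto intro: wt_nonneg)
  also have "\<dots> = (real j * h)\<^sup>2 / 2 * (12/11 * D)"
    by (simp only: sum_wt flip: sum_distrib_right)
  also have "\<dots> \<le> (real N * h)\<^sup>2 / 2 * (12/11 * D)"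
    using less.prems assms by (intro mult_right_mono divide_right_mono power_mono) auto
  finally have "\<Lambda> * (\<Sum>i<j. wt h j i * a i) \<le> \<Lambda> * ((real N * h)\<^sup>2 / 2 * (12/11 * D))"
    using assms by (intro mult_left_mono) auto
  also have "\<dots> = (\<Lambda> * (real N * h)\<^sup>2) * (6/11 * D)" by simp
  also have "\<dots> \<le> 1/6 * (6/11 * D)" using assms by (intro mult_right_mono) auto
  finally show ?case using step[OF less.prems] by linarith
qed

text \<open>Three sizes obey the same kind of stability estimate: the Euclidean norm, the sum of the
  particle norms, and the sum over all particles but one, which is not definite.\<close>

definition seminorm :: "('a::real_vector \<Rightarrow> real) \<Rightarrow> bool" where
  "seminorm p \<longleftrightarrow> (\<forall>a b. p (a + b) \<le> p a + p b) \<and> (\<forall>c a. p (c *\<^sub>R a) = \<bar>c\<bar> * p a)"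

lemma seminorm_norm: "seminorm (norm :: 'a::real_normed_vector \<Rightarrow> real)"
  by (simp add: seminorm_def norm_triangle_ineq)

lemma
  assumes "seminorm p"
  shows seminorm_add: "p (a + b) \<le> p a + p b" and seminorm_scale: "p (c *\<^sub>R a) = \<bar>c\<bar> * p a"
    and seminorm_zero: "p 0 = 0" and seminorm_minus: "p (- a) = p a" and seminorm_ge_0: "0 \<le> p a"
proof -
  show 1: "p (a + b) \<le> p a + p b" "p (c *\<^sub>R a) = \<bar>c\<bar> * p a" for a b c
    using assms by (auto simp: seminorm_def)
  show 0: "p 0 = 0" using 1(2)[of 0 0] by simp
  show m: "p (- a) = p a" for a using 1(2)[of "-1" a] by simp
  show "0 \<le> p a" using 1(1)[of a "- a"] 0 m by simp
qed

lemma seminorm_sum_le: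
  assumes "seminorm p"
  shows "p (\<Sum>i\<in>A. f i) \<le> (\<Sum>i\<in>A. p (f i))"
proof (induction A rule: infinite_finite_induct)
  case (insert x A)
  then show ?case using seminorm_add[OF assms, of "f x" "sum f A"] by auto
qed (simp_all add: seminorm_zero[OF assms])

lemma seminorm_wt_sum_le:
  assumes "seminorm p" "\<And>i. i < j \<Longrightarrow> p (g i) \<le> B"
  shows "p (\<Sum>i<j. wt h j i *\<^sub>R g i) \<le> (real j * h)\<^sup>2 / 2 * B"
proof -
  have "p (\<Sum>i<j. wt h j i *\<^sub>R g i) \<le> (\<Sum>i<j. p (wt h j i *\<^sub>R g i))"
    by (rule seminorm_sum_le[OF assms(1)])
  also have "\<dots> \<le> (\<Sum>i<j. wt h j i * B)"
    using assms by (intro sum_mono) (auto simp: seminorm_scale wt_nonneg intro!: mult_left_mono)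
  also have "\<dots> = (real j * h)\<^sup>2 / 2 * B"
    by (simp only: sum_wt flip: sum_distrib_right)
  finally show ?thesis .
qed

lemma seminorm_wt_sum_le':
  assumes "seminorm p" "\<And>i. i < j \<Longrightarrow> p (g i) \<le> \<Lambda> * a i"
  shows "p (\<Sum>i<j. wt h j i *\<^sub>R g i) \<le> \<Lambda> * (\<Sum>i<j. wt h j i * a i)"
proof -
  have "p (\<Sum>i<j. wt h j i *\<^sub>R g i) \<le> (\<Sum>i<j. p (wt h j i *\<^sub>R g i))"
    by (rule seminorm_sum_le[OF assms(1)])
  also have "\<dots> \<le> (\<Sum>i<j. wt h j i * (\<Lambda> * a i))"
    using assms by (intro sum_mono) (auto simp: seminorm_scale wt_nonneg intro!: mult_left_mono)
  also have "\<dots> = \<Lambda> * (\<Sum>i<j. wt h j i * a i)"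
    by (simp add: sum_distrib_left algebra_simps)
  finally show ?thesis .
qed

text \<open>\<open>D\<close> bounds the separation in free flight. The first bound controls the
  difference of the forces, and the second integrates that difference.\<close>

lemma vpos_diff_bounds:
  assumes p: "seminorm p" and lip: "\<And>a b. p (F a - F b) \<le> \<Lambda> * p (a - b)"
    and \<Lambda>: "0 \<le> \<Lambda>" "\<Lambda> * (real N * h)\<^sup>2 \<le> 1/6" and h: "0 \<le> h"
    and D: "\<And>j. j \<le> N \<Longrightarrow> p ((x - y) + (real j * h) *\<^sub>R (v - u)) \<le> D" and j: "j \<le> N"
  shows "p (vpos F h x v j - vpos F h y u j) \<le> 12/11 * D"
    and "p (vpos F h x v j - vpos F h y u j - ((x - y) + (real j * h) *\<^sub>R (v - u)))
           \<le> (real j * h)\<^sup>2 / 2 * (\<Lambda> * (12/11 * D))"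
proof -
  let ?z = "\<lambda>j. vpos F h x v j - vpos F h y u j"
  let ?l = "\<lambda>j. (x - y) + (real j * h) *\<^sub>R (v - u)"
  have D0: "0 \<le> D" using D[of 0] seminorm_ge_0[OF p] order_trans by blast
  have "p (?z j) \<le> D + \<Lambda> * (\<Sum>i<j. wt h j i * p (?z i))" if "j \<le> N" for j
  proof -
    have "p (?z j) = p (?l j + - (\<Sum>i<j. wt h j i *\<^sub>R (F (vpos F h x v i) - F (vpos F h y u i))))"
      by (simp flip: vpos_diff_closed)
    also have "\<dots> \<le> p (?l j) + p (\<Sum>i<j. wt h j i *\<^sub>R (F (vpos F h x v i) - F (vpos F h y u i)))"
      by (rule order_trans[OF seminorm_add[OF p]]) (simp only: seminorm_minus[OF p] order_refl)
    also have "\<dots> \<le> D + \<Lambda> * (\<Sum>i<j. wt h j i * p (?z i))"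
      using D[OF that] by (intro add_mono seminorm_wt_sum_le'[OF p] lip) auto
    finally show ?thesis .
  qed
  then have z: "p (?z j) \<le> 12/11 * D" if "j \<le> N" for j
    using volterra_bound[of N "\<lambda>j. p (?z j)" D \<Lambda> h] that \<Lambda> D0 h by blast
  show "p (?z j) \<le> 12/11 * D" by (rule z[OF j])
  show "p (?z j - ?l j) \<le> (real j * h)\<^sup>2 / 2 * (\<Lambda> * (12/11 * D))"
    unfolding vpos_diff_closed seminorm_minus[OF p]
  proof (rule seminorm_wt_sum_le[OF p])
    fix i assume "i < j"
    then have "\<Lambda> * p (?z i) \<le> \<Lambda> * (12/11 * D)" using z[of i] j \<Lambda> by (intro mult_left_mono) auto
    then show "p (F (vpos F h x v i) - F (vpos F h y u i)) \<le> \<Lambda> * (12/11 * D)"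
      using lip order_trans by blast
  qed
qed

subsection \<open>The standard Gaussian density\<close>

definition gauss :: "'a::euclidean_space \<Rightarrow> real" where
  "gauss v = exp (- (norm v)\<^sup>2 / 2) / sqrt (2 * pi) ^ DIM('a)"

lemma gauss_pos: "gauss v > 0"
  by (simp add: gauss_def)

lemma gauss_nonneg [simp]: "0 \<le> gauss v"
  using gauss_pos[of v] by simp

lemma borel_measurable_gauss [measurable]: "gauss \<in> borel_measurable borel"
  unfolding gauss_def by measurable

lemma power2_norm_euclidean: "(norm (v::'a::euclidean_space))\<^sup>2 = (\<Sum>b\<in>Basis. (v \<bullet> b)\<^sup>2)"
  unfolding power2_norm_eq_inner by (subst euclidean_inner) (simp add: power2_eq_square)

lemma integrable_exp_neg_power2_norm:
  assumes "\<alpha> > 0"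
  shows "integrable lborel (\<lambda>v::'a::euclidean_space. exp (- \<alpha> * (norm v)\<^sup>2))"
proof (rule integrableI_bounded)
  define \<sigma> where "\<sigma> = 1 / sqrt (2 * \<alpha>)"
  have \<sigma>: "\<sigma> > 0" "2 * \<sigma>\<^sup>2 = 1 / \<alpha>" using assms by (auto simp: \<sigma>_def power_divide)
  have dens: "exp (- \<alpha> * x\<^sup>2) = sqrt (2 * pi * \<sigma>\<^sup>2) * normal_density 0 \<sigma> x" for x
  proof -
    have "sqrt (2 * pi * \<sigma>\<^sup>2) > 0" using \<sigma> by simp
    moreover have "- x\<^sup>2 / (2 * \<sigma>\<^sup>2) = - \<alpha> * x\<^sup>2" unfolding \<sigma>(2) by simp
    ultimately show ?thesis using \<sigma>(1) by (simp add: normal_density_def)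
  qed
  have 1: "integrable lborel (\<lambda>x::real. exp (- \<alpha> * x\<^sup>2))"
    unfolding dens using \<sigma> by (intro integrable_mult_right integrable_normal_density) auto
  have "(\<integral>\<^sup>+v. ennreal (norm (exp (- \<alpha> * (norm (v::'a))\<^sup>2))) \<partial>lborel)
      = (\<integral>\<^sup>+v. (\<Prod>b\<in>Basis. ennreal (exp (- \<alpha> * ((v::'a) \<bullet> b)\<^sup>2))) \<partial>lborel)"
    by (simp add: power2_norm_euclidean sum_distrib_left exp_sum prod_ennreal sum_negf[symmetric] abs_of_nonneg prod_nonneg)
  also have "\<dots> = (\<Prod>b\<in>(Basis::'a set). \<integral>\<^sup>+x. ennreal (exp (- \<alpha> * x\<^sup>2)) \<partial>lborel)"
    by (rule nn_integral_lborel_prod) auto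
  also have "\<dots> < \<infinity>"
    using 1 by (auto simp: integrable_iff_bounded power_less_top_ennreal)
  finally show "(\<integral>\<^sup>+v. ennreal (norm (exp (- \<alpha> * (norm (v::'a))\<^sup>2))) \<partial>lborel) < \<infinity>" .
qed auto

lemma gauss_eq_prod: "gauss (v::'a::euclidean_space) = (\<Prod>b\<in>Basis. std_normal_density (v \<bullet> b))"
proof -
  have "(\<Prod>b\<in>Basis. std_normal_density (v \<bullet> b))
      = (\<Prod>b\<in>(Basis::'a set). 1 / sqrt (2 * pi)) * (\<Prod>b\<in>Basis. exp (- (v \<bullet> b)\<^sup>2 / 2))"
    by (simp only: std_normal_density_def prod.distrib)
  also have "\<dots> = gauss v"
    by (simp add: gauss_def power_one_over exp_sum[symmetric] power2_norm_euclidean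
        sum_negf[symmetric] sum_divide_distrib)
  finally show ?thesis by simp
qed

lemma nn_integral_gauss: "(\<integral>\<^sup>+v. ennreal (gauss (v::'a::euclidean_space)) \<partial>lborel) = 1"
proof -
  have "(\<integral>\<^sup>+v. ennreal (gauss (v::'a)) \<partial>lborel)
      = (\<integral>\<^sup>+v. (\<Prod>b\<in>Basis. ennreal (std_normal_density ((v::'a) \<bullet> b))) \<partial>lborel)"
    by (simp add: gauss_eq_prod prod_ennreal)
  also have "\<dots> = (\<Prod>b\<in>(Basis::'a set). \<integral>\<^sup>+x. ennreal (std_normal_density x) \<partial>lborel)"
    by (rule nn_integral_lborel_prod) auto
  also have "(\<integral>\<^sup>+x. ennreal (std_normal_density x) \<partial>lborel) = 1"
    by (subst nn_integral_eq_integral) (auto intro: integrable_normal_density)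
  finally show ?thesis by simp
qed

lemma integrable_gauss: "integrable lborel (gauss :: 'a::euclidean_space \<Rightarrow> real)"
  by (rule integrableI_bounded) (auto simp: nn_integral_gauss)

lemma integral_gauss: "(LINT v|lborel. gauss (v::'a::euclidean_space)) = 1"
  by (rule integral_eq_nn_integral[THEN trans]) (auto simp: nn_integral_gauss)

lemma std_gaussian_eq: "std_gaussian = density lborel (\<lambda>v. ennreal (gauss v))"
  by (simp add: std_gaussian_def gauss_def)

lemma prob_space_std_gaussian: "prob_space (std_gaussian :: 'a::euclidean_space measure)"
  by (rule prob_spaceI) (simp add: std_gaussian_eq emeasure_density nn_integral_gauss)

lemma sets_std_gaussian [simp, measurable_cong]: "sets std_gaussian = sets borel"
  by (simp add: std_gaussian_def)

lemma space_std_gaussian [simp]: "space std_gaussian = UNIV"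
  by (simp add: std_gaussian_def)

lemma integral_std_gaussian:
  fixes g :: "'a::euclidean_space \<Rightarrow> real"
  assumes [measurable]: "g \<in> borel_measurable borel"
  shows "integral\<^sup>L std_gaussian g = (LINT v|lborel. gauss v * g v)"
  unfolding std_gaussian_eq by (subst integral_real_density) auto

text \<open>A domination uniform in the shift:
  \<open>norm v \<le> norm (v + s *\<^sub>R e) + norm e\<close> leaves
  \<open>exp (- (norm v)\<^sup>2 / 4)\<close> of the Gaussian, and half of that exponent absorbs the
  quadratic factor.\<close>

lemma gauss_growth_shift_bound:
  fixes v e :: "'a::euclidean_space"
  assumes "\<bar>s\<bar> \<le> 1"
  shows "gauss (v + s *\<^sub>R e) * (1 + norm (v + s *\<^sub>R e))\<^sup>2
    \<le> 16 * (1 + norm e)\<^sup>2 * exp ((norm e)\<^sup>2 / 2) * exp (- (1/8) * (norm v)\<^sup>2)"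
proof -
  have se: "norm (s *\<^sub>R e) \<le> norm e"
    using assms by (simp add: mult_left_le_one_le)
  have "norm v \<le> norm (v + s *\<^sub>R e) + norm e"
    using norm_triangle_ineq4[of "v + s *\<^sub>R e" "s *\<^sub>R e"] se by simp
  then have "(norm v)\<^sup>2 \<le> (norm (v + s *\<^sub>R e) + norm e)\<^sup>2" by (intro power_mono) auto
  also have "\<dots> \<le> 2 * (norm (v + s *\<^sub>R e))\<^sup>2 + 2 * (norm e)\<^sup>2"
    using sum_squares_bound[of "norm (v + s *\<^sub>R e)" "norm e"] by (simp add: power2_sum)
  finally have "- (norm (v + s *\<^sub>R e))\<^sup>2 / 2 \<le> (norm e)\<^sup>2 / 2 - (norm v)\<^sup>2 / 4" by simp
  then have A: "exp (- (norm (v + s *\<^sub>R e))\<^sup>2 / 2) \<le> exp ((norm e)\<^sup>2 / 2) * exp (- (norm v)\<^sup>2 / 4)"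
    by (simp flip: exp_add)
  have "1 \<le> sqrt (2 * pi)" using pi_gt3 by simp
  then have "1 \<le> sqrt (2 * pi) ^ DIM('a)" by (rule one_le_power)
  then have "gauss (v + s *\<^sub>R e) \<le> exp (- (norm (v + s *\<^sub>R e))\<^sup>2 / 2) / 1"
    unfolding gauss_def by (intro divide_left_mono) auto
  with A have A': "gauss (v + s *\<^sub>R e) \<le> exp ((norm e)\<^sup>2 / 2) * exp (- (norm v)\<^sup>2 / 4)" by simp
  have "1 + norm (v + s *\<^sub>R e) \<le> 1 + norm v + norm e"
    using norm_triangle_ineq[of v "s *\<^sub>R e"] se by simp
  also have "\<dots> \<le> (1 + norm e) * (1 + norm v)" by (simp add: algebra_simps)
  finally have "(1 + norm (v + s *\<^sub>R e))\<^sup>2 \<le> ((1 + norm e) * (1 + norm v))\<^sup>2"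
    by (intro power_mono) auto
  also have "\<dots> = (1 + norm e)\<^sup>2 * (1 + norm v)\<^sup>2" by (simp add: power_mult_distrib)
  also have "(1 + norm v)\<^sup>2 \<le> 2 + 2 * (norm v)\<^sup>2"
    using sum_squares_bound[of 1 "norm v"] by (simp add: power2_sum)
  also have "\<dots> \<le> 16 * (1 + (norm v)\<^sup>2 / 8)" by simp
  also have "\<dots> \<le> 16 * exp ((norm v)\<^sup>2 / 8)"
    by (rule mult_left_mono[OF exp_ge_add_one_self]) simp
  finally have B: "(1 + norm (v + s *\<^sub>R e))\<^sup>2 \<le> (1 + norm e)\<^sup>2 * (16 * exp ((norm v)\<^sup>2 / 8))"
    by (simp add: mult_left_mono)
  have "gauss (v + s *\<^sub>R e) * (1 + norm (v + s *\<^sub>R e))\<^sup>2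
      \<le> (exp ((norm e)\<^sup>2 / 2) * exp (- (norm v)\<^sup>2 / 4)) * ((1 + norm e)\<^sup>2 * (16 * exp ((norm v)\<^sup>2 / 8)))"
    by (rule mult_mono[OF A' B]) auto
  also have "\<dots> = 16 * (1 + norm e)\<^sup>2 * exp ((norm e)\<^sup>2 / 2) * (exp (- (norm v)\<^sup>2 / 4) * exp ((norm v)\<^sup>2 / 8))"
    by (simp add: algebra_simps)
  also have "exp (- (norm v)\<^sup>2 / 4) * exp ((norm v)\<^sup>2 / 8) = exp (- (1/8) * (norm v)\<^sup>2)"
    by (simp flip: exp_add)
  finally show ?thesis .
qed

lemma integrable_gauss_growth:
  fixes g :: "'a::euclidean_space \<Rightarrow> real"
  assumes [measurable]: "g \<in> borel_measurable borel"
    and g: "\<And>v. \<bar>g v\<bar> \<le> C * (1 + norm v)\<^sup>2"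
  shows "integrable lborel (\<lambda>v. gauss v * g v)"
proof (rule Bochner_Integration.integrable_bound)
  show "integrable lborel (\<lambda>v::'a. C * (16 * exp (- (1/8) * (norm v)\<^sup>2)))"
    using integrable_exp_neg_power2_norm[of "1/8", where 'a='a]
    by (intro integrable_mult_right) auto
  have C: "0 \<le> C" using g[of 0] by (simp add: order_trans[OF abs_ge_zero])
  show "AE v in lborel. norm (gauss v * g v) \<le> norm (C * (16 * exp (- (1/8) * (norm v)\<^sup>2)))"
  proof (rule AE_I2)
    fix v :: 'a
    have "norm (gauss v * g v) \<le> gauss v * (C * (1 + norm v)\<^sup>2)"
      using g[of v] by (simp add: abs_mult mult_left_mono)
    also have "\<dots> \<le> C * (16 * exp (- (1/8) * (norm v)\<^sup>2))"
      using gauss_growth_shift_bound[of 0 v 0] C mult_left_mono[of "gauss v * (1 + norm v)\<^sup>2" _ C]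
      by (simp add: mult.left_commute)
    finally show "norm (gauss v * g v) \<le> norm (C * (16 * exp (- (1/8) * (norm v)\<^sup>2)))"
      using C by simp
  qed
qed measurable

section \<open>Directional derivatives and Gaussian integration by parts\<close>

lemma borel_measurable_if_has_derivative:
  fixes f :: "'a::euclidean_space \<Rightarrow> 'b::euclidean_space"
  assumes "\<And>v. (f has_derivative f' v) (at v)"
  shows "f \<in> borel_measurable borel"
proof (intro borel_measurable_continuous_onI continuous_at_imp_continuous_on ballI)
  show "isCont f v" for v using has_derivative_continuous[OF assms] by simp
qed

lemma filterlim_inverse_Suc_at_0: "filterlim (\<lambda>n. inverse (real (Suc n))) (at 0) sequentially"
  by (rule filterlim_atI) (use LIMSEQ_inverse_real_of_nat in auto)

lemma directional_derivative_real:
  fixes f :: "'a::real_normed_vector \<Rightarrow> real"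
  assumes "(f has_derivative f') (at v)"
  shows "((\<lambda>t. f (v + t *\<^sub>R e)) has_real_derivative f' e) (at 0)"
proof -
  have lin: "linear f'" using assms by (rule has_derivative_linear)
  have 1: "((\<lambda>t::real. v + t *\<^sub>R e) has_derivative (\<lambda>t. t *\<^sub>R e)) (at 0)"
    by (auto intro!: derivative_eq_intros)
  have "((\<lambda>t. f (v + t *\<^sub>R e)) has_derivative (\<lambda>t. f' (t *\<^sub>R e))) (at 0)"
    using has_derivative_compose[OF 1, of f f'] assms by simp
  then show ?thesis
    by (simp add: has_field_derivative_def linear_cmul[OF lin] mult.commute[of _ "f' e"] mult_commute_abs)
qed

lemma directional_derivative_LIMSEQ:
  fixes f :: "'a::real_normed_vector \<Rightarrow> real"
  assumes "((\<lambda>t. f (v + t *\<^sub>R e)) has_real_derivative d) (at 0)"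
  shows "(\<lambda>n. (f (v + inverse (real (Suc n)) *\<^sub>R e) - f v) * real (Suc n)) \<longlonglongrightarrow> d"
proof -
  have "((\<lambda>t. (f (v + t *\<^sub>R e) - f v) / t) \<longlongrightarrow> d) (at 0)"
    using assms by (simp add: has_field_derivative_iff)
  from filterlim_compose[OF this filterlim_inverse_Suc_at_0] show ?thesis
    by (simp add: divide_inverse)
qed

text \<open>The derivative may be discontinuous; it is measurable as a pointwise limit of difference
  quotients.\<close>

lemma borel_measurable_directional_derivative:
  fixes f :: "'a::euclidean_space \<Rightarrow> 'b::euclidean_space"
  assumes "\<And>v. (f has_derivative f' v) (at v)"
  shows "(\<lambda>v. f' v e) \<in> borel_measurable borel"
proof -
  have [measurable]: "f \<in> borel_measurable borel"
    using assms by (rule borel_measurable_if_has_derivative)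
  have "(\<lambda>v. f' v e \<bullet> c) \<in> borel_measurable borel" for c
  proof (rule borel_measurable_LIMSEQ_metric)
    fix v
    have "((\<lambda>v. f v \<bullet> c) has_derivative (\<lambda>w. f' v w \<bullet> c)) (at v)"
      by (rule has_derivative_inner_left[OF assms])
    then show "(\<lambda>n. (f (v + inverse (real (Suc n)) *\<^sub>R e) \<bullet> c - f v \<bullet> c) * real (Suc n)) \<longlonglongrightarrow> f' v e \<bullet> c"
      by (rule directional_derivative_LIMSEQ[OF directional_derivative_real])
  qed measurable
  then show ?thesis by (subst borel_measurable_euclidean_space) auto
qed

lemma lborel_integral_shift:
  fixes f :: "'a::euclidean_space \<Rightarrow> real"
  assumes f: "integrable lborel f"
  shows "integrable lborel (\<lambda>v. f (v + c))" and "(LINT v|lborel. f (v + c)) = integral\<^sup>L lborel f"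
proof -
  have [measurable]: "f \<in> borel_measurable borel" using f by auto
  have eq: "distr lborel borel ((+) c) = (lborel :: 'a measure)" by (rule lborel_distr_plus)
  show "integrable lborel (\<lambda>v. f (v + c))"
    using f by (subst (asm) eq[symmetric]) (simp add: integrable_distr_eq add.commute)
  show "(LINT v|lborel. f (v + c)) = integral\<^sup>L lborel f"
    by (subst (2) eq[symmetric]) (simp add: integral_distr add.commute)
qed

text \<open>Translation invariance of Lebesgue measure annihilates the difference quotients.\<close>

lemma integral_directional_derivative_zero:
  fixes u u' :: "'a::euclidean_space \<Rightarrow> real"
  assumes int: "integrable lborel u" and [measurable]: "u' \<in> borel_measurable borel"
    and deriv: "\<And>v. ((\<lambda>t. u (v + t *\<^sub>R e)) has_real_derivative u' v) (at 0)"
    and bound: "\<And>v s. \<bar>s\<bar> \<le> 1 \<Longrightarrow> \<bar>u' (v + s *\<^sub>R e)\<bar> \<le> D v" and D: "integrable lborel D"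
  shows "integrable lborel u'" and "integral\<^sup>L lborel u' = 0"
proof -
  define d where "d n v = (u (v + inverse (real (Suc n)) *\<^sub>R e) - u v) * real (Suc n)" for n v
  have [measurable]: "u \<in> borel_measurable borel" using int by auto
  have d0: "integral\<^sup>L lborel (d n) = 0" for n
    unfolding d_def using lborel_integral_shift[OF int] int by simp
  have derivt: "((\<lambda>t. u (v + t *\<^sub>R e)) has_real_derivative u' (v + t *\<^sub>R e)) (at t)" for v t
    using DERIV_shift[of "\<lambda>t. u (v + t *\<^sub>R e)" "u' (v + t *\<^sub>R e)" 0 t] deriv[of "v + t *\<^sub>R e"]
    by (simp add: algebra_simps)
  \<comment> \<open>The mean value theorem writes the quotient as \<open>u'\<close> at an
    intermediate point of the segment; this is where the bound uniform in \<open>s\<close>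
    enters.\<close>
  have dle: "\<bar>d n v\<bar> \<le> D v" for n v
  proof -
    let ?t = "inverse (real (Suc n))"
    have "\<exists>z>0. z < ?t \<and> u (v + ?t *\<^sub>R e) - u (v + 0 *\<^sub>R e) = (?t - 0) * u' (v + z *\<^sub>R e)"
      using derivt by (intro MVT2) auto
    then obtain z where z: "0 < z" "z < ?t" "u (v + ?t *\<^sub>R e) - u v = ?t * u' (v + z *\<^sub>R e)" by auto
    have "?t \<le> 1" by (simp add: field_simps)
    then have "\<bar>u' (v + z *\<^sub>R e)\<bar> \<le> D v" using z by (intro bound) auto
    moreover have "d n v = u' (v + z *\<^sub>R e)" unfolding d_def z(3) by simp
    ultimately show ?thesis by metis
  qed
  have lim: "(\<lambda>n. d n v) \<longlonglongrightarrow> u' v" for v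
    unfolding d_def by (rule directional_derivative_LIMSEQ[OF deriv])
  have dm: "d n \<in> borel_measurable lborel" for n unfolding d_def by measurable
  note dc = integral_dominated_convergence[of u' lborel d D] integrable_dominated_convergence[of u' lborel d D]
  show "integrable lborel u'"
    using dc(2) D dm lim dle by auto
  have "(\<lambda>n. integral\<^sup>L lborel (d n)) \<longlonglongrightarrow> integral\<^sup>L lborel u'"
    using dc(1) D dm lim dle by auto
  then show "integral\<^sup>L lborel u' = 0"
    by (simp add: d0 LIMSEQ_const_iff)
qed

lemma gauss_has_derivative:
  "(gauss has_derivative (\<lambda>e. - (v \<bullet> e) * gauss v)) (at (v::'a::euclidean_space))"
proof -
  have "((\<lambda>v::'a. exp (- (v \<bullet> v) / 2) / sqrt (2 * pi) ^ DIM('a)) has_derivative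
      (\<lambda>e. - (v \<bullet> e) * (exp (- (v \<bullet> v) / 2) / sqrt (2 * pi) ^ DIM('a)))) (at v)"
    by (auto intro!: derivative_eq_intros simp: inner_commute field_simps)
  moreover have "gauss = (\<lambda>v::'a. exp (- (v \<bullet> v) / 2) / sqrt (2 * pi) ^ DIM('a))"
    by (simp add: gauss_def power2_norm_eq_inner fun_eq_iff)
  ultimately show ?thesis by metis
qed

text \<open>Stein's identity: \<open>?u'\<close> is the derivative of \<open>gauss v * b v\<close>
  along \<open>e\<close>, so its integral vanishes. Linear growth of \<open>b\<close> keeps every
  integrand below a Gaussian times a quadratic.\<close>

lemma gauss_integration_by_parts:
  fixes b :: "'a::euclidean_space \<Rightarrow> real"
  assumes b: "\<And>v. (b has_derivative B v) (at v)"
    and bb: "\<And>v. \<bar>b v\<bar> \<le> C * (1 + norm v)" and BB: "\<And>v. \<bar>B v e\<bar> \<le> C"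
  shows "integrable lborel (\<lambda>v. gauss v * B v e)"
    and "integrable lborel (\<lambda>v. gauss v * ((v \<bullet> e) * b v))"
    and "(LINT v|lborel. gauss v * B v e) = (LINT v|lborel. gauss v * ((v \<bullet> e) * b v))"
proof -
  have [measurable]: "b \<in> borel_measurable borel"
    using b by (rule borel_measurable_if_has_derivative)
  have [measurable]: "(\<lambda>v. B v e) \<in> borel_measurable borel"
    using b by (rule borel_measurable_directional_derivative)
  have C: "0 \<le> C" using BB[of 0] by linarith
  have one: "1 \<le> (1 + norm v)\<^sup>2" "1 + norm v \<le> (1 + norm v)\<^sup>2" for v :: 'a
    by (auto simp: power2_eq_square algebra_simps)
  have g1: "\<bar>B v e\<bar> \<le> C * (1 + norm v)\<^sup>2" for v
    using BB[of v] one(1)[of v] C mult_left_mono[of 1 "(1 + norm v)\<^sup>2" C] by simp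
  have g2: "\<bar>(v \<bullet> e) * b v\<bar> \<le> norm e * C * (1 + norm v)\<^sup>2" for v
  proof -
    have "\<bar>v \<bullet> e\<bar> \<le> norm e * (1 + norm v)"
      using Cauchy_Schwarz_ineq2[of v e] by (simp add: algebra_simps add_increasing)
    then have "\<bar>v \<bullet> e\<bar> * \<bar>b v\<bar> \<le> (norm e * (1 + norm v)) * (C * (1 + norm v))"
      using bb by (intro mult_mono) auto
    then show ?thesis by (simp add: abs_mult power2_eq_square algebra_simps)
  qed
  have g3: "\<bar>b v\<bar> \<le> C * (1 + norm v)\<^sup>2" for v
    using bb[of v] mult_left_mono[OF one(2)[of v] C] by linarith
  show i1: "integrable lborel (\<lambda>v. gauss v * B v e)"
    by (rule integrable_gauss_growth[OF _ g1]) measurable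
  show i2: "integrable lborel (\<lambda>v. gauss v * ((v \<bullet> e) * b v))"
    by (rule integrable_gauss_growth[OF _ g2]) measurable
  let ?u' = "\<lambda>v. gauss v * B v e - gauss v * ((v \<bullet> e) * b v)"
  have "integral\<^sup>L lborel ?u' = 0"
  proof (rule integral_directional_derivative_zero(2)[where u = "\<lambda>v. gauss v * b v" and e = e])
    show "integrable lborel (\<lambda>v. gauss v * b v)"
      by (rule integrable_gauss_growth[OF _ g3]) measurable
    show "((\<lambda>t. gauss (v + t *\<^sub>R e) * b (v + t *\<^sub>R e)) has_real_derivative ?u' v) (at 0)" for v
    proof -
      have "((\<lambda>v. gauss v * b v) has_derivative (\<lambda>w. gauss v * B v w + (- (v \<bullet> w) * gauss v) * b v)) (at v)"
        by (rule has_derivative_mult[OF gauss_has_derivative b])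
      from directional_derivative_real[OF this, of e] show ?thesis
        by (simp add: algebra_simps)
    qed
    show "\<bar>?u' (v + s *\<^sub>R e)\<bar> \<le> (C + norm e * C) * (16 * (1 + norm e)\<^sup>2 * exp ((norm e)\<^sup>2 / 2) * exp (- (1/8) * (norm v)\<^sup>2))"
      if s: "\<bar>s\<bar> \<le> 1" for v s
    proof -
      let ?w = "v + s *\<^sub>R e"
      have "\<bar>?u' ?w\<bar> = gauss ?w * \<bar>B ?w e - (?w \<bullet> e) * b ?w\<bar>"
        by (simp add: abs_mult flip: right_diff_distrib)
      also have "\<dots> \<le> gauss ?w * ((C + norm e * C) * (1 + norm ?w)\<^sup>2)"
        using g1[of ?w] g2[of ?w] by (intro mult_left_mono) (auto simp: algebra_simps)
      also have "\<dots> = (C + norm e * C) * (gauss ?w * (1 + norm ?w)\<^sup>2)" by simp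
      also have "\<dots> \<le> (C + norm e * C) * (16 * (1 + norm e)\<^sup>2 * exp ((norm e)\<^sup>2 / 2) * exp (- (1/8) * (norm v)\<^sup>2))"
        using C by (intro mult_left_mono gauss_growth_shift_bound[OF s]) auto
      finally show ?thesis .
    qed
    show "integrable lborel (\<lambda>v::'a. (C + norm e * C) * (16 * (1 + norm e)\<^sup>2 * exp ((norm e)\<^sup>2 / 2) * exp (- (1/8) * (norm v)\<^sup>2)))"
      by (intro integrable_mult_right integrable_exp_neg_power2_norm) simp
  qed measurable
  then show "(LINT v|lborel. gauss v * B v e) = (LINT v|lborel. gauss v * ((v \<bullet> e) * b v))"
    using i1 i2 by simp
qed

text \<open>Integration by parts for \<open>b v = v \<bullet> e\<close>, whose derivative along
  \<open>e\<close> is the constant \<open>e \<bullet> e\<close>.\<close>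

lemma gauss_second_moment:
  fixes e :: "'a::euclidean_space"
  shows "integrable lborel (\<lambda>v. gauss v * (v \<bullet> e)\<^sup>2)"
    and "(LINT v|lborel. gauss v * (v \<bullet> e)\<^sup>2) = (norm e)\<^sup>2"
proof -
  have 1: "((\<lambda>v. v \<bullet> e) has_derivative (\<lambda>w. w \<bullet> e)) (at v)" for v
    by (auto intro!: derivative_eq_intros)
  have 2: "\<bar>v \<bullet> e\<bar> \<le> (norm e + (norm e)\<^sup>2) * (1 + norm v)" for v
    using Cauchy_Schwarz_ineq2[of v e] by (simp add: algebra_simps add_increasing add_increasing2)
  have 3: "\<bar>e \<bullet> e\<bar> \<le> norm e + (norm e)\<^sup>2" by (simp add: power2_norm_eq_inner)
  note ibp = gauss_integration_by_parts[where b = "\<lambda>v. v \<bullet> e" and B = "\<lambda>v w. w \<bullet> e" and e = e, OF 1 2 3]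
  show "integrable lborel (\<lambda>v. gauss v * (v \<bullet> e)\<^sup>2)"
    using ibp(2) by (simp add: power2_eq_square)
  show "(LINT v|lborel. gauss v * (v \<bullet> e)\<^sup>2) = (norm e)\<^sup>2"
    using ibp(3) by (simp add: power2_eq_square integral_gauss flip: power2_norm_eq_inner)
qed

text \<open>The inequality \<open>\<bar>t\<bar> \<le> 1/2 + t\<^sup>2 / 2\<close> reduces this to
  the second moment.\<close>

lemma gauss_first_abs_moment:
  fixes e :: "'a::euclidean_space"
  assumes "norm e = 1"
  shows "integrable lborel (\<lambda>v. gauss v * \<bar>v \<bullet> e\<bar>)"
    and "(LINT v|lborel. gauss v * \<bar>v \<bullet> e\<bar>) \<le> 1"
proof -
  show i: "integrable lborel (\<lambda>v. gauss v * \<bar>v \<bullet> e\<bar>)"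
  proof (rule integrable_gauss_growth[where C = 1])
    fix v show "\<bar>\<bar>v \<bullet> e\<bar>\<bar> \<le> 1 * (1 + norm v)\<^sup>2"
    proof -
      have "norm v \<le> 1 + (norm v)\<^sup>2 + 2 * norm v" by (simp add: add_increasing)
      moreover have "\<bar>v \<bullet> e\<bar> \<le> norm v"
        using Cauchy_Schwarz_ineq2[of v e] assms by simp
      ultimately have "\<bar>v \<bullet> e\<bar> \<le> 1 + (norm v)\<^sup>2 + 2 * norm v" by (rule order_trans[rotated])
      then show ?thesis by (simp add: power2_sum)
    qed
  qed measurable
  have "(LINT v|lborel. gauss v * \<bar>v \<bullet> e\<bar>) \<le> (LINT v|lborel. (1/2) * gauss v + (1/2) * (gauss v * (v \<bullet> e)\<^sup>2))"
  proof (rule integral_mono[OF i])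
    show "integrable lborel (\<lambda>v. (1/2) * gauss v + (1/2) * (gauss v * (v \<bullet> e)\<^sup>2))"
      by (intro Bochner_Integration.integrable_add integrable_mult_right integrable_gauss gauss_second_moment)
    fix v
    have "\<bar>v \<bullet> e\<bar> \<le> 1/2 + 1/2 * (v \<bullet> e)\<^sup>2"
      using sum_squares_bound[of 1 "\<bar>v \<bullet> e\<bar>"] by simp
    from mult_left_mono[OF this gauss_nonneg[of v]]
    show "gauss v * \<bar>v \<bullet> e\<bar> \<le> (1/2) * gauss v + (1/2) * (gauss v * (v \<bullet> e)\<^sup>2)"
      by (simp add: algebra_simps)
  qed
  also have "\<dots> = 1"
    using assms by (simp add: integrable_gauss gauss_second_moment integral_gauss)
  finally show "(LINT v|lborel. gauss v * \<bar>v \<bullet> e\<bar>) \<le> 1" .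
qed

subsection \<open>Change of variables in a Euclidean space\<close>

text \<open>
  The change of variables theorem of the library lives on \<open>real ^ 'n\<close> with a well-ordered index
  type; the standard basis of a Euclidean space, ordered arbitrarily, is such a type.
\<close>

typedef (overloaded) 'a basis_index = "Basis :: 'a::euclidean_space set"
  using nonempty_Basis by blast

instance basis_index :: (euclidean_space) finite
proof
  have "(UNIV :: 'a basis_index set) = Abs_basis_index ` Basis"
    by (metis Rep_basis_index Rep_basis_index_inverse UNIV_eq_I image_eqI)
  then show "finite (UNIV :: 'a basis_index set)" by (metis finite_Basis finite_imageI)
qed

instantiation basis_index :: (euclidean_space) linorder
begin

definition rank_basis_index :: "'a basis_index \<Rightarrow> nat" where
  "rank_basis_index = (SOME f. inj f)"

definition less_eq_basis_index :: "'a basis_index \<Rightarrow> 'a basis_index \<Rightarrow> bool" where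
  "less_eq_basis_index i j \<longleftrightarrow> rank_basis_index i \<le> rank_basis_index j"

definition less_basis_index :: "'a basis_index \<Rightarrow> 'a basis_index \<Rightarrow> bool" where
  "less_basis_index i j \<longleftrightarrow> rank_basis_index i < rank_basis_index j"

lemma inj_rank_basis_index: "inj (rank_basis_index :: 'a basis_index \<Rightarrow> nat)"
proof -
  have "\<exists>f :: 'a basis_index \<Rightarrow> nat. inj f"
    using finite_imp_inj_to_nat_seg[OF finite[of "UNIV :: 'a basis_index set"]] by blast
  then show ?thesis unfolding rank_basis_index_def by (rule someI_ex)
qed

instance
  by standard (auto simp: less_eq_basis_index_def less_basis_index_def
      dest: injD[OF inj_rank_basis_index])

end

instance basis_index :: (euclidean_space) wellorder
proof
  fix P :: "'a basis_index \<Rightarrow> bool" and a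
  assume step: "\<And>x. (\<And>y. y < x \<Longrightarrow> P y) \<Longrightarrow> P x"
  show "P a"
    by (induction "rank_basis_index a" arbitrary: a rule: less_induct)
       (auto intro: step simp: less_basis_index_def)
qed

definition coords :: "'a::euclidean_space \<Rightarrow> real ^ 'a basis_index" where
  "coords x = (\<chi> i. x \<bullet> Rep_basis_index i)"

definition uncoords :: "real ^ 'a basis_index \<Rightarrow> 'a::euclidean_space" where
  "uncoords y = (\<Sum>i\<in>UNIV. (y $ i) *\<^sub>R Rep_basis_index i)"

lemma bij_betw_Rep_basis_index: "bij_betw Rep_basis_index UNIV Basis"
  unfolding bij_betw_def
  using type_definition.Rep_range[OF type_definition_basis_index]
  by (auto intro: injI simp: Rep_basis_index_inject)

lemma inner_Rep_basis_index: "Rep_basis_index i \<bullet> Rep_basis_index j = (if i = j then 1 else 0)"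
  using Rep_basis_index[of i] Rep_basis_index[of j]
  by (auto simp: inner_Basis Rep_basis_index_inject)

lemma uncoords_inner: "uncoords y \<bullet> Rep_basis_index i = y $ i"
  by (simp add: uncoords_def inner_sum_left inner_Rep_basis_index if_distrib cong: if_cong)

lemma coords_uncoords [simp]: "coords (uncoords y) = y"
  by (simp add: coords_def uncoords_inner vec_eq_iff)

lemma uncoords_coords [simp]: "uncoords (coords x) = x"
proof -
  have "uncoords (coords x) = (\<Sum>b\<in>Basis. (x \<bullet> b) *\<^sub>R b)"
    unfolding uncoords_def coords_def
    using sum.reindex_bij_betw[OF bij_betw_Rep_basis_index, of "\<lambda>b. (x \<bullet> b) *\<^sub>R b"] by simp
  then show ?thesis by (simp add: euclidean_representation)
qed

lemma bounded_linear_coords: "bounded_linear coords"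
  by (rule linear_conv_bounded_linear[THEN iffD1], rule linearI)
     (auto simp: coords_def vec_eq_iff inner_add_left)

lemma bounded_linear_uncoords: "bounded_linear uncoords"
  by (rule linear_conv_bounded_linear[THEN iffD1], rule linearI)
     (auto simp: uncoords_def scaleR_add_left sum.distrib scaleR_sum_right)

lemma measurable_uncoords [measurable]: "uncoords \<in> borel_measurable borel"
  by (intro borel_measurable_continuous_onI linear_continuous_on bounded_linear_uncoords)

text \<open>Preimages of boxes are boxes with the same side lengths, and boxes determine Lebesgue
  measure.\<close>

lemma lborel_distr_uncoords: "distr lborel borel uncoords = (lborel :: 'a::euclidean_space measure)"
proof (rule lborel_eqI[symmetric])
  fix l u :: 'a
  assume le: "\<And>b. b \<in> Basis \<Longrightarrow> l \<bullet> b \<le> u \<bullet> b"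
  have mem: "uncoords y \<in> box l u \<longleftrightarrow> y \<in> box (coords l) (coords u)" for y
  proof -
    have "uncoords y \<in> box l u \<longleftrightarrow> (\<forall>i. l \<bullet> Rep_basis_index i < y $ i \<and> y $ i < u \<bullet> Rep_basis_index i)"
      unfolding mem_box uncoords_inner[symmetric]
      by (metis Rep_basis_index Rep_basis_index_cases)
    then show ?thesis by (simp add: mem_box_cart coords_def)
  qed
  have "emeasure (distr lborel borel uncoords) (box l u) = emeasure lborel (box (coords l) (coords u))"
    by (simp add: emeasure_distr) (intro arg_cong2[where f = emeasure] refl, use mem in auto)
  also have "\<dots> = (\<Prod>b\<in>Basis. (coords u - coords l) \<bullet> b)"
    using le[OF Rep_basis_index]
    by (subst emeasure_lborel_box) (auto simp: Basis_vec_def inner_axis coords_def)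
  also have "\<dots> = (\<Prod>i\<in>UNIV. (u - l) \<bullet> Rep_basis_index i)"
  proof -
    have B: "(Basis :: (real ^ 'a basis_index) set) = (\<lambda>i. axis i 1) ` UNIV"
      by (auto simp: Basis_vec_def)
    have inj: "inj (\<lambda>i. axis i (1::real) :: real ^ 'a basis_index)"
      by (auto simp: inj_def axis_eq_axis)
    have "(\<Prod>b\<in>Basis. (coords u - coords l) \<bullet> b) = (\<Prod>i\<in>UNIV. (coords u - coords l) \<bullet> axis i 1)"
      unfolding B by (subst prod.reindex[OF inj]) simp
    then show ?thesis by (simp add: inner_axis coords_def inner_diff_left)
  qed
  also have "\<dots> = (\<Prod>b\<in>Basis. (u - l) \<bullet> b)"
    using prod.reindex_bij_betw[OF bij_betw_Rep_basis_index, of "\<lambda>b. (u - l) \<bullet> b"] by simp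
  finally show "emeasure (distr lborel borel uncoords) (box l u) = (\<Prod>b\<in>Basis. (u - l) \<bullet> b)" .
qed simp

text \<open>The absolute determinant with respect to an orthonormal basis; its value does not depend
  on how the basis is ordered.\<close>

definition jac :: "('a::euclidean_space \<Rightarrow> 'a) \<Rightarrow> real" where
  "jac A = \<bar>det (matrix (\<lambda>y. coords (A (uncoords y))))\<bar>"

lemma jac_nonneg [simp]: "0 \<le> jac A"
  by (simp add: jac_def)

lemma borel_measurable_jac:
  fixes \<Phi> :: "'a::euclidean_space \<Rightarrow> 'a"
  assumes "\<And>v. (\<Phi> has_derivative \<Phi>' v) (at v)"
  shows "(\<lambda>v. jac (\<Phi>' v)) \<in> borel_measurable borel"
proof -
  have [measurable]: "(\<lambda>v. \<Phi>' v e) \<in> borel_measurable borel" for e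
    using assms by (rule borel_measurable_directional_derivative)
  show ?thesis
    unfolding jac_def det_def matrix_def coords_def by simp
qed

lemma integrable_lborel_iff_absolutely_integrable:
  fixes f :: "'a::euclidean_space \<Rightarrow> real"
  assumes "f \<in> borel_measurable borel"
  shows "integrable lborel f \<longleftrightarrow> f absolutely_integrable_on UNIV"
  using assms by (simp add: set_integrable_def integrable_completion)

lemma change_of_variables_euclidean:
  fixes \<Phi> :: "'a::euclidean_space \<Rightarrow> 'a" and f :: "'a \<Rightarrow> real"
  assumes deriv: "\<And>v. (\<Phi> has_derivative \<Phi>' v) (at v)" and bij: "bij \<Phi>" and f: "integrable lborel f"
  shows "integrable lborel (\<lambda>v. jac (\<Phi>' v) * f (\<Phi> v))"
    and "(LINT v|lborel. jac (\<Phi>' v) * f (\<Phi> v)) = integral\<^sup>L lborel f"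
proof -
  have [measurable]: "f \<in> borel_measurable borel" using f by auto
  have [measurable]: "\<Phi> \<in> borel_measurable borel"
    using deriv by (rule borel_measurable_if_has_derivative)
  have [measurable]: "(\<lambda>v. jac (\<Phi>' v)) \<in> borel_measurable borel"
    using deriv by (rule borel_measurable_jac)
  define G where "G y = coords (\<Phi> (uncoords y))" for y
  define G' where "G' y = (\<lambda>w. coords (\<Phi>' (uncoords y) (uncoords w)))" for y
  define F where "F y = f (uncoords y)" for y
  let ?rhs = "\<lambda>v. jac (\<Phi>' v) * f (\<Phi> v)"
  have [measurable]: "F \<in> borel_measurable borel" unfolding F_def by measurable
  have derG: "(G has_derivative G' y) (at y within UNIV)" for y
  proof -
    have "((\<lambda>y. \<Phi> (uncoords y)) has_derivative (\<lambda>w. \<Phi>' (uncoords y) (uncoords w))) (at y)"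
      using has_derivative_compose[OF bounded_linear.has_derivative[OF bounded_linear_uncoords has_derivative_ident] , of \<Phi> "\<Phi>' (uncoords y)" y UNIV]
        deriv[of "uncoords y"] by simp
    from bounded_linear.has_derivative[OF bounded_linear_coords this]
    show ?thesis by (simp add: G_def[abs_def] G'_def)
  qed
  have G: "G = coords \<circ> \<Phi> \<circ> uncoords" by (auto simp: G_def)
  have "bij coords" "bij uncoords"
    by (rule o_bij[of uncoords]; force) (rule o_bij[of coords]; force)
  then have bijG: "bij G" unfolding G using bij by (intro bij_comp)
  have intF: "integrable lborel F" "integral\<^sup>L lborel F = integral\<^sup>L lborel f"
  proof -
    show "integrable lborel F"
      using f unfolding F_def by (subst (asm) lborel_distr_uncoords[symmetric]) (simp add: integrable_distr_eq)
    show "integral\<^sup>L lborel F = integral\<^sup>L lborel f"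
      unfolding F_def by (subst (2) lborel_distr_uncoords[symmetric]) (simp add: integral_distr)
  qed
  have pull: "\<bar>det (matrix (G' y))\<bar> * F (G y) = ?rhs (uncoords y)" for y
    by (simp add: jac_def G'_def F_def G_def)
  have FA: "F absolutely_integrable_on UNIV"
    using intF(1) by (simp add: integrable_lborel_iff_absolutely_integrable)
  have img: "G ` UNIV = UNIV" using bijG by (simp add: bij_def)
  \<comment> \<open>The scalar integrand is wrapped into \<open>real^1\<close>, because the theorem
    on the change of variables is stated for vector values.\<close>
  have "(\<lambda>x. \<bar>det (matrix (G' x))\<bar> *\<^sub>R (vec (F (G x)) :: real^1)) absolutely_integrable_on UNIV \<and>
      integral UNIV (\<lambda>x. \<bar>det (matrix (G' x))\<bar> *\<^sub>R (vec (F (G x)) :: real^1)) = vec (integral UNIV F)"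
    using has_absolute_integral_change_of_variables[of UNIV G G' "\<lambda>y. vec (F y) :: real^1" "vec (integral UNIV F)"]
      derG bijG FA
    by (simp add: img bij_def absolutely_integrable_on_1_iff integral_on_1_eq)
  then have 1: "(\<lambda>y. ?rhs (uncoords y)) absolutely_integrable_on UNIV"
    and 2: "integral UNIV (\<lambda>y. ?rhs (uncoords y)) = integral UNIV F"
    by (auto simp: absolutely_integrable_on_1_iff integral_on_1_eq vec_eq_iff pull)
  have i: "integrable lborel (\<lambda>y. ?rhs (uncoords y))"
    using 1 by (subst integrable_lborel_iff_absolutely_integrable) measurable
  show "integrable lborel ?rhs"
    using i by (subst lborel_distr_uncoords[symmetric]) (simp add: integrable_distr_eq)
  have "integral\<^sup>L lborel ?rhs = (LINT y|lborel. ?rhs (uncoords y))"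
    by (subst lborel_distr_uncoords[symmetric]) (simp add: integral_distr)
  also have "\<dots> = integral\<^sup>L lborel F"
    using 2 integral_lborel[OF i] integral_lborel[OF intF(1)] by simp
  finally show "integral\<^sup>L lborel ?rhs = integral\<^sup>L lborel f" using intF by simp
qed

section \<open>Gaussian moments of linear maps and a lower bound for the Jacobian\<close>

definition frob :: "('a::euclidean_space \<Rightarrow> 'b::euclidean_space) \<Rightarrow> real" where
  "frob A = L2_set (\<lambda>b. norm (A b)) Basis"

definition trace_lin :: "('a::euclidean_space \<Rightarrow> 'a) \<Rightarrow> real" where
  "trace_lin A = (\<Sum>b\<in>Basis. A b \<bullet> b)"

lemma frob_power2: "(frob A)\<^sup>2 = (\<Sum>b\<in>Basis. (norm (A b))\<^sup>2)"
  by (simp add: frob_def L2_set_def sum_nonneg)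

lemma frob_nonneg [simp]: "0 \<le> frob A"
  by (simp add: frob_def)

text \<open>Coordinate \<open>b\<close> of \<open>B v\<close> is the inner product of
  \<open>v\<close> with \<open>adjoint B b\<close>, so the second moments add up to the squared
  Frobenius norm of the adjoint, which is that of \<open>B\<close>.\<close>

lemma gauss_integral_power2_norm_linear:
  fixes B :: "'a::euclidean_space \<Rightarrow> 'a"
  assumes B: "linear B"
  shows "integrable lborel (\<lambda>v. gauss v * (norm (B v))\<^sup>2)"
    and "(LINT v|lborel. gauss v * (norm (B v))\<^sup>2) = (frob B)\<^sup>2"
proof -
  have eq: "gauss v * (norm (B v))\<^sup>2 = (\<Sum>b\<in>Basis. gauss v * (v \<bullet> adjoint B b)\<^sup>2)" for v
    by (simp add: power2_norm_euclidean[of "B v"] sum_distrib_left adjoint_works[OF B])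
  show "integrable lborel (\<lambda>v. gauss v * (norm (B v))\<^sup>2)"
    unfolding eq by (intro Bochner_Integration.integrable_sum gauss_second_moment)
  have "(LINT v|lborel. gauss v * (norm (B v))\<^sup>2) = (\<Sum>b\<in>Basis. (norm (adjoint B b))\<^sup>2)"
    unfolding eq by (simp add: gauss_second_moment)
  also have "\<dots> = (\<Sum>b\<in>Basis. \<Sum>b'\<in>Basis. (b' \<bullet> adjoint B b)\<^sup>2)"
    by (simp add: power2_norm_euclidean inner_commute)
  also have "\<dots> = (\<Sum>b\<in>Basis. \<Sum>b'\<in>Basis. (B b' \<bullet> b)\<^sup>2)"
    by (simp add: adjoint_works[OF B])
  also have "\<dots> = (frob B)\<^sup>2"
    by (subst sum.swap) (simp add: frob_power2 power2_norm_euclidean)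
  finally show "(LINT v|lborel. gauss v * (norm (B v))\<^sup>2) = (frob B)\<^sup>2" .
qed

lemma frob_id_power2: "(frob (\<lambda>v::'a::euclidean_space. v))\<^sup>2 = DIM('a)"
  by (simp add: frob_power2)

text \<open>
  Writing the Jacobian of \<open>A\<close> as a Gaussian expectation of an exponential and applying Jensen's
  inequality replaces Hadamard's determinant inequality.
\<close>

lemma jac_ge_exp:
  fixes A B :: "'a::euclidean_space \<Rightarrow> 'a"
  assumes A: "linear A" and B: "linear B" and AB: "\<And>v. A (B v) = v" and BA: "\<And>v. B (A v) = v"
  shows "exp (- ((frob B)\<^sup>2 - real DIM('a)) / 2) \<le> jac A"
proof -
  have blA: "bounded_linear A" and blB: "bounded_linear B"
    using A B by (auto simp: linear_conv_bounded_linear)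
  have bA: "bij A" "bij B" using AB BA by (auto intro!: o_bij simp: fun_eq_iff)
  have derB: "(B has_derivative B) (at v)" "(A has_derivative A) (at v)" for v
    using blA blB by (auto intro: bounded_linear_imp_has_derivative)
  have [measurable]: "B \<in> borel_measurable borel"
    using blB by (intro borel_measurable_continuous_onI linear_continuous_on)
  have i0: "integrable lborel (\<lambda>v. gauss (B v))"
  proof -
    have "integrable lborel (\<lambda>v. jac B * gauss (B v))"
      by (rule change_of_variables_euclidean(1)[OF derB(1) bA(2) integrable_gauss])
    moreover have "jac B \<noteq> 0"
    proof
      assume "jac B = 0"
      then have "integral\<^sup>L lborel (gauss :: 'a \<Rightarrow> real) = 0"
        using change_of_variables_euclidean(2)[OF derB(1) bA(2) integrable_gauss] by simp
      then show False by (simp add: integral_gauss)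
    qed
    ultimately show ?thesis by simp
  qed
  \<comment> \<open>Substituting by \<open>A\<close> turns \<open>gauss (B v)\<close> into a
    constant multiple of \<open>gauss\<close>; the constant is the Jacobian.\<close>
  have "(LINT v|lborel. jac A * gauss (B (A v))) = (LINT v|lborel. gauss (B v))"
    by (rule change_of_variables_euclidean(2)[OF derB(2) bA(1) i0])
  then have jac: "jac A = (LINT v|lborel. gauss (B v))"
    by (simp add: BA integral_gauss)
  \<comment> \<open>The Gaussian mean of
    \<open>((norm v)\<^sup>2 - (norm (B v))\<^sup>2) / 2\<close>. The tangent of \<open>exp\<close>
    at this point therefore integrates to \<open>exp t0\<close>.\<close>
  define t0 where "t0 = - ((frob B)\<^sup>2 - real DIM('a)) / 2"
  have ratio: "gauss v * (exp t0 * (1 + (((norm v)\<^sup>2 - (norm (B v))\<^sup>2) / 2 - t0))) \<le> gauss (B v)" for v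
  proof -
    have "exp t0 * (1 + (((norm v)\<^sup>2 - (norm (B v))\<^sup>2) / 2 - t0))
        \<le> exp t0 * exp (((norm v)\<^sup>2 - (norm (B v))\<^sup>2) / 2 - t0)"
      by (intro mult_left_mono exp_ge_add_one_self) auto
    also have "\<dots> = exp (((norm v)\<^sup>2 - (norm (B v))\<^sup>2) / 2)" by (simp flip: exp_add)
    finally have "gauss v * (exp t0 * (1 + (((norm v)\<^sup>2 - (norm (B v))\<^sup>2) / 2 - t0)))
        \<le> gauss v * exp (((norm v)\<^sup>2 - (norm (B v))\<^sup>2) / 2)"
      by (intro mult_left_mono) auto
    also have "\<dots> = gauss (B v)"
    proof -
      have "exp (- (norm v)\<^sup>2 / 2) * exp (((norm v)\<^sup>2 - (norm (B v))\<^sup>2) / 2) = exp (- (norm (B v))\<^sup>2 / 2)"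
        unfolding exp_add[symmetric] by (rule arg_cong[where f = exp]) (simp add: field_simps)
      then show ?thesis by (simp add: gauss_def)
    qed
    finally show ?thesis .
  qed
  note m1 = gauss_integral_power2_norm_linear[OF B]
  note m2 = gauss_integral_power2_norm_linear[of "\<lambda>v::'a. v", OF linear_id[unfolded id_def]]
  have eq: "gauss v * (exp t0 * (1 + (((norm v)\<^sup>2 - (norm (B v))\<^sup>2) / 2 - t0)))
      = exp t0 * ((1 - t0) * gauss v + 1/2 * (gauss v * (norm v)\<^sup>2) - 1/2 * (gauss v * (norm (B v))\<^sup>2))" for v
    by (simp add: field_simps)
  have int: "integrable lborel (\<lambda>v. gauss v * (exp t0 * (1 + (((norm v)\<^sup>2 - (norm (B v))\<^sup>2) / 2 - t0))))"
    unfolding eq using m1(1) m2(1) integrable_gauss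
    by (intro integrable_mult_right Bochner_Integration.integrable_add Bochner_Integration.integrable_diff) auto
  have "(LINT v|lborel. gauss v * (exp t0 * (1 + (((norm v)\<^sup>2 - (norm (B v))\<^sup>2) / 2 - t0))))
      = exp t0 * ((1 - t0) + 1/2 * (frob (\<lambda>v::'a. v))\<^sup>2 - 1/2 * (frob B)\<^sup>2)"
    unfolding eq using m1 m2 integrable_gauss[where 'a='a] by (simp add: integral_gauss)
  also have "\<dots> = exp t0" by (simp add: frob_id_power2 t0_def field_simps)
  finally have "exp t0 \<le> (LINT v|lborel. gauss (B v))"
    using integral_mono[OF int i0 ratio] by simp
  then show ?thesis by (simp add: jac t0_def)
qed

lemma gauss_norm_cong:
  fixes v w :: "'a::euclidean_space"
  shows "norm v = norm w \<Longrightarrow> gauss v = gauss w"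
  by (simp add: gauss_def)

text \<open>The Gaussian is invariant under an isometry, so inserting it into the change of
  variables shows that the Jacobian is 1.\<close>

lemma lborel_integral_isometry:
  fixes S :: "'a::euclidean_space \<Rightarrow> 'a" and f :: "'a \<Rightarrow> real"
  assumes S: "linear S" and "bij S" and norm: "\<And>v. norm (S v) = norm v" and f: "integrable lborel f"
  shows "integrable lborel (\<lambda>v. f (S v))" and "(LINT v|lborel. f (S v)) = integral\<^sup>L lborel f"
proof -
  have der: "(S has_derivative S) (at v)" for v
    using S by (simp add: bounded_linear_imp_has_derivative linear_conv_bounded_linear)
  note cv = change_of_variables_euclidean[OF der \<open>bij S\<close>]
  have "jac S = 1"
    using cv(2)[OF integrable_gauss] gauss_norm_cong[OF norm] by (simp add: integral_gauss)
  then show "integrable lborel (\<lambda>v. f (S v))" "(LINT v|lborel. f (S v)) = integral\<^sup>L lborel f"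
    using cv[OF f] by auto
qed

subsection \<open>Frobenius norms of linear maps\<close>

lemma frob_add_le: "frob (\<lambda>v. A v + B v) \<le> frob A + frob B"
proof -
  have "frob (\<lambda>v. A v + B v) \<le> L2_set (\<lambda>b. norm (A b) + norm (B b)) Basis"
    unfolding frob_def by (intro L2_set_mono norm_triangle_ineq) auto
  also have "\<dots> \<le> frob A + frob B" unfolding frob_def by (rule L2_set_triangle_ineq)
  finally show ?thesis .
qed

lemma frob_scale: "frob (\<lambda>v. c *\<^sub>R A v) = \<bar>c\<bar> * frob A"
  by (simp add: frob_def L2_set_def power_mult_distrib real_sqrt_mult flip: sum_distrib_left)

lemma frob_minus: "frob (\<lambda>v. - A v) = frob A"
  by (simp add: frob_def)

lemma frob_sum_le: "frob (\<lambda>v. \<Sum>i\<in>I. A i v) \<le> (\<Sum>i\<in>I. frob (A i))"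
proof (induction I rule: infinite_finite_induct)
  case (insert i I)
  then show ?case using frob_add_le[of "A i" "\<lambda>v. \<Sum>i\<in>I. A i v"] by auto
qed (simp_all add: frob_def L2_set_def)

lemma frob_comp_left_le:
  assumes "\<And>w. norm (C w) \<le> c * norm w" "0 \<le> c"
  shows "frob (\<lambda>v. C (A v)) \<le> c * frob A"
proof -
  have "frob (\<lambda>v. C (A v)) \<le> L2_set (\<lambda>b. c * norm (A b)) Basis"
    unfolding frob_def using assms by (intro L2_set_mono) auto
  also have "\<dots> = c * frob A" unfolding frob_def using assms by (simp add: L2_set_left_distrib L2_set_right_distrib)
  finally show ?thesis .
qed

lemma frob_adjoint:
  assumes "linear A"
  shows "frob (adjoint A) = frob A"
proof -
  have "(frob (adjoint A))\<^sup>2 = (\<Sum>b\<in>Basis. \<Sum>b'\<in>Basis. (b' \<bullet> adjoint A b)\<^sup>2)"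
    by (simp add: frob_power2 power2_norm_euclidean inner_commute)
  also have "\<dots> = (frob A)\<^sup>2"
    by (subst sum.swap) (simp add: adjoint_works[OF assms] frob_power2 power2_norm_euclidean)
  finally show ?thesis by simp
qed

lemma norm_adjoint_le:
  fixes C :: "'a::euclidean_space \<Rightarrow> 'b::euclidean_space"
  assumes "linear C" "\<And>w. norm (C w) \<le> c * norm w" "0 \<le> c"
  shows "norm (adjoint C w) \<le> c * norm w"
proof -
  let ?w = "adjoint C w"
  have "norm ?w * norm ?w = C ?w \<bullet> w"
    by (simp add: adjoint_works[OF assms(1), symmetric] flip: power2_norm_eq_inner power2_eq_square)
  also have "\<dots> \<le> (c * norm ?w) * norm w"
    using norm_cauchy_schwarz[of "C ?w" w] mult_right_mono[OF assms(2)[of ?w] norm_ge_zero[of w]]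
    by linarith
  finally have "norm ?w * norm ?w \<le> (c * norm w) * norm ?w" by (simp add: algebra_simps)
  then show ?thesis
    using assms(3) by (cases "norm ?w = 0") (auto simp: mult_le_cancel_right)
qed

text \<open>A left factor acts on each column separately; passing to adjoints turns the right factor
  into a left one.\<close>

lemma frob_comp_right_le:
  fixes A :: "'b::euclidean_space \<Rightarrow> 'c::euclidean_space" and C :: "'a::euclidean_space \<Rightarrow> 'b"
  assumes A: "linear A" and C: "linear C" "\<And>w. norm (C w) \<le> c * norm w" "0 \<le> c"
  shows "frob (\<lambda>v. A (C v)) \<le> c * frob A"
proof -
  have lin: "linear (\<lambda>v. A (C v))" using linear_compose[OF C(1) A] by (simp add: o_def)
  have "adjoint (\<lambda>v. A (C v)) = (\<lambda>w. adjoint C (adjoint A w))"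
    by (rule adjoint_unique) (simp add: adjoint_works[OF A] adjoint_works[OF C(1)])
  then have "frob (\<lambda>v. A (C v)) = frob (\<lambda>w. adjoint C (adjoint A w))"
    using frob_adjoint[OF lin] by simp
  also have "\<dots> \<le> c * frob (adjoint A)"
    using norm_adjoint_le[OF C] C(3) by (rule frob_comp_left_le)
  finally show ?thesis by (simp add: frob_adjoint[OF A])
qed

lemma frob_le_opnorm:
  fixes A :: "'a::euclidean_space \<Rightarrow> 'b::euclidean_space"
  assumes "\<And>w. norm (A w) \<le> c * norm w" "0 \<le> c"
  shows "frob A \<le> sqrt (real DIM('a)) * c"
proof -
  have "frob A \<le> L2_set (\<lambda>b. c) (Basis :: 'a set)"
    unfolding frob_def
  proof (rule L2_set_mono)
    fix b :: 'a assume "b \<in> Basis"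
    then show "norm (A b) \<le> c" using assms(1)[of b] by simp
  qed simp
  also have "\<dots> = sqrt (real DIM('a)) * c"
    using assms(2) by (simp add: L2_set_def real_sqrt_mult)
  finally show ?thesis .
qed

text \<open>Cauchy-Schwarz for the inner product of linear maps that belongs to the Frobenius
  norm.\<close>

lemma trace_lin_comp_le:
  fixes A B :: "'a::euclidean_space \<Rightarrow> 'a"
  assumes "linear A"
  shows "trace_lin (\<lambda>v. A (B v)) \<le> frob A * frob B"
proof -
  have "trace_lin (\<lambda>v. A (B v)) = (\<Sum>b\<in>Basis. B b \<bullet> adjoint A b)"
    by (simp add: trace_lin_def adjoint_works[OF assms])
  also have "\<dots> \<le> (\<Sum>b\<in>Basis. \<bar>norm (adjoint A b)\<bar> * \<bar>norm (B b)\<bar>)"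
    by (intro sum_mono) (metis abs_norm_cancel mult.commute norm_cauchy_schwarz)
  also have "\<dots> \<le> frob (adjoint A) * frob B"
    unfolding frob_def by (rule L2_set_mult_ineq)
  finally show ?thesis by (simp add: frob_adjoint[OF assms])
qed

subsection \<open>Gradients and Hessians\<close>

definition riesz :: "('a::euclidean_space \<Rightarrow>\<^sub>L real) \<Rightarrow> 'a" where
  "riesz f = (\<Sum>b\<in>Basis. blinfun_apply f b *\<^sub>R b)"

lemma riesz_inner: "u \<bullet> riesz f = blinfun_apply f u"
proof -
  have "blinfun_apply f u = blinfun_apply f (\<Sum>b\<in>Basis. (u \<bullet> b) *\<^sub>R b)"
    by (simp add: euclidean_representation)
  also have "\<dots> = (\<Sum>b\<in>Basis. (u \<bullet> b) * blinfun_apply f b)"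
    by (simp add: blinfun.sum_right blinfun.scaleR_right)
  finally show ?thesis by (simp add: riesz_def inner_sum_right mult.commute)
qed

lemma norm_riesz_le: "norm (riesz f) \<le> norm f"
proof -
  have "norm (riesz f) * norm (riesz f) = blinfun_apply f (riesz f)"
    by (simp flip: riesz_inner power2_norm_eq_inner power2_eq_square)
  also have "\<dots> \<le> norm f * norm (riesz f)"
    using norm_blinfun[of f "riesz f"] by simp
  finally show ?thesis by (cases "norm (riesz f) = 0") (auto simp: mult_le_cancel_right)
qed

lemma bounded_linear_riesz: "bounded_linear riesz"
  by (rule bounded_linear_intro[where K = 1])
     (auto simp: riesz_def blinfun.add_left blinfun.scaleR_left scaleR_add_left sum.distrib
       scaleR_sum_right norm_riesz_le[unfolded riesz_def])

lemma Dblinfun_has_derivative: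
  assumes "f differentiable (at x)"
  shows "(f has_derivative blinfun_apply (Dblinfun f x)) (at x)"
proof -
  have d: "(f has_derivative frechet_derivative f (at x)) (at x)"
    using assms by (simp add: frechet_derivative_works)
  then have "blinfun_apply (Dblinfun f x) = frechet_derivative f (at x)"
    unfolding Dblinfun_def by (intro bounded_linear_Blinfun_apply has_derivative_bounded_linear)
  with d show ?thesis by simp
qed

lemma grad_unique:
  assumes "GDERIV f x :> g"
  shows "grad f x = g"
  unfolding grad_def
proof (rule the_equality)
  show "GDERIV f x :> g" by (rule assms)
  fix g' assume "GDERIV f x :> g'"
  then have "(\<lambda>h. h \<bullet> g') = (\<lambda>h. h \<bullet> g)"
    using assms unfolding gderiv_def by (rule has_derivative_unique)
  then have "(g' - g) \<bullet> (g' - g) = 0"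
    by (metis inner_diff_right cancel_comm_monoid_add_class.diff_cancel)
  then show "g' = g" by simp
qed

definition hess :: "('a::euclidean_space \<Rightarrow> real) \<Rightarrow> 'a \<Rightarrow> 'a \<Rightarrow> 'a" where
  "hess f x u = riesz (blinfun_apply (D2 f x) u)"

lemma lipschitz_if_derivative_bounded:
  fixes f :: "'a::real_normed_vector \<Rightarrow> 'b::real_normed_vector"
  assumes "\<And>x. (f has_derivative f' x) (at x)" and "\<And>x u. norm (f' x u) \<le> B * norm u" "0 \<le> B"
  shows "norm (f x - f y) \<le> B * norm (x - y)"
proof (rule differentiable_bound[of UNIV f f'])
  show "onorm (f' x) \<le> B" for x
    using assms(2,3) by (intro onorm_bound) auto
qed (use assms in auto)

text \<open>The supremum of an unbounded set of reals is an unspecified value, so each constant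
  comes with \<open>bdd_above\<close>.\<close>

locale C3_bounded =
  fixes f :: "'a::euclidean_space \<Rightarrow> real" and L LH :: real
  assumes C3: "C3 f"
    and bdd2: "bdd_above (range (\<lambda>x. norm (D2 f x)))" and L: "L = (SUP x. norm (D2 f x))"
    and bdd3: "bdd_above (range (\<lambda>x. norm (D3 f x)))" and LH: "LH = (SUP x. norm (D3 f x))"
begin

lemma norm_D2_le: "norm (D2 f x) \<le> L"
  unfolding L by (rule cSUP_upper[OF UNIV_I bdd2])

lemma norm_D3_le: "norm (D3 f x) \<le> LH"
  unfolding LH by (rule cSUP_upper[OF UNIV_I bdd3])

lemma L_nonneg: "0 \<le> L" and LH_nonneg: "0 \<le> LH"
  using norm_D2_le norm_D3_le order_trans[OF norm_ge_zero] by blast+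

lemma GDERIV_riesz: "GDERIV f x :> riesz (Dblinfun f x)"
  using C3 Dblinfun_has_derivative[of f x] by (simp add: gderiv_def riesz_inner C3_def)

lemma grad_eq: "grad f x = riesz (Dblinfun f x)"
  by (rule grad_unique[OF GDERIV_riesz])

lemma GDERIV_grad: "GDERIV f x :> grad f x"
  unfolding grad_eq by (rule GDERIV_riesz)

lemma has_derivative_inner_grad: "(f has_derivative (\<lambda>u. u \<bullet> grad f x)) (at x)"
  using GDERIV_grad by (simp add: gderiv_def)

lemma grad_has_derivative: "(grad f has_derivative hess f x) (at x)"
proof -
  have "((\<lambda>x. riesz (Dblinfun f x)) has_derivative (\<lambda>u. riesz (blinfun_apply (D2 f x) u))) (at x)"
    using C3 by (intro bounded_linear.has_derivative[OF bounded_linear_riesz] Dblinfun_has_derivative)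
      (simp add: C3_def)
  then show ?thesis by (simp add: grad_eq[abs_def] hess_def[abs_def])
qed

lemma norm_hess_le: "norm (hess f x u) \<le> L * norm u"
proof -
  have "norm (hess f x u) \<le> norm (blinfun_apply (D2 f x) u)"
    unfolding hess_def by (rule norm_riesz_le)
  also have "\<dots> \<le> norm (D2 f x) * norm u" by (rule norm_blinfun)
  also have "\<dots> \<le> L * norm u" by (intro mult_right_mono norm_D2_le) simp
  finally show ?thesis .
qed

lemma grad_lipschitz: "norm (grad f x - grad f y) \<le> L * norm (x - y)"
  by (rule lipschitz_if_derivative_bounded[OF grad_has_derivative norm_hess_le L_nonneg])

lemma D2_lipschitz: "norm (D2 f x - D2 f y) \<le> LH * norm (x - y)"
proof (rule lipschitz_if_derivative_bounded)
  show "(D2 f has_derivative blinfun_apply (D3 f x)) (at x)" for x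
    using C3 by (intro Dblinfun_has_derivative) (simp add: C3_def)
  show "norm (blinfun_apply (D3 f x) u) \<le> LH * norm u" for x u
    using norm_blinfun[of "D3 f x" u] mult_right_mono[OF norm_D3_le norm_ge_zero[of u]] order_trans by blast
qed (rule LH_nonneg)

lemma norm_hess_diff_le: "norm (hess f x u - hess f y u) \<le> LH * norm (x - y) * norm u"
proof -
  have "hess f x u - hess f y u = riesz (blinfun_apply (D2 f x - D2 f y) u)"
    by (simp add: hess_def blinfun.diff_left linear_diff[OF bounded_linear.linear[OF bounded_linear_riesz]])
  also have "norm \<dots> \<le> norm (blinfun_apply (D2 f x - D2 f y) u)" by (rule norm_riesz_le)
  also have "\<dots> \<le> norm (D2 f x - D2 f y) * norm u" by (rule norm_blinfun)
  also have "\<dots> \<le> LH * norm (x - y) * norm u" by (intro mult_right_mono D2_lipschitz) simp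
  finally show ?thesis .
qed

end

subsection \<open>The mean-field force\<close>

text \<open>\<open>W\<close> need not be even, so particle \<open>l\<close> acts on particle
  \<open>i\<close> through both orders of the difference. The summand for \<open>l = i\<close> is
  zero.\<close>

definition mf_force :: "(real ^ 'k \<Rightarrow> real ^ 'k) \<Rightarrow> (real ^ 'k \<Rightarrow> real ^ 'k) \<Rightarrow> real \<Rightarrow>
    real ^ 'k ^ 'n \<Rightarrow> real ^ 'k ^ 'n" where
  "mf_force dV dW \<epsilon> x = (\<chi> i. dV (x $ i) + (\<epsilon> / real CARD('n)) *\<^sub>R
      (\<Sum>l\<in>UNIV. dW (x $ i - x $ l) - dW (x $ l - x $ i)))"

text \<open>The minus sign of the second term in the force cancels against that of
  \<open>x $ l - x $ i\<close>, so both derivatives are applied to the same vector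
  \<open>u $ i - u $ l\<close>.\<close>

definition mf_hess :: "(real ^ 'k \<Rightarrow> real ^ 'k \<Rightarrow> real ^ 'k) \<Rightarrow> (real ^ 'k \<Rightarrow> real ^ 'k \<Rightarrow> real ^ 'k) \<Rightarrow> real \<Rightarrow>
    real ^ 'k ^ 'n \<Rightarrow> real ^ 'k ^ 'n \<Rightarrow> real ^ 'k ^ 'n" where
  "mf_hess HV HW \<epsilon> x u = (\<chi> i. HV (x $ i) (u $ i) + (\<epsilon> / real CARD('n)) *\<^sub>R
      (\<Sum>l\<in>UNIV. HW (x $ i - x $ l) (u $ i - u $ l) + HW (x $ l - x $ i) (u $ i - u $ l)))"

definition norm1 :: "real ^ 'k ^ 'n \<Rightarrow> real" where
  "norm1 u = (\<Sum>i\<in>UNIV. norm (u $ i))"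

lemma ell1_eq_norm1: "ell1 x y = norm1 (x - y)"
  by (simp add: ell1_def norm1_def)

lemma seminorm_norm1: "seminorm norm1"
  by (auto simp: seminorm_def norm1_def norm_triangle_ineq sum_distrib_left
      simp flip: sum.distrib intro!: sum_mono)

lemma norm_le_norm1: "norm u \<le> norm1 u"
  unfolding norm_vec_def norm1_def by (rule L2_set_le_sum) auto

lemma norm_nth_le_norm1: "norm (u $ i) \<le> norm1 u"
  unfolding norm1_def by (rule member_le_sum) auto

lemma norm1_nonneg [simp]: "0 \<le> norm1 u"
  by (simp add: norm1_def sum_nonneg)

lemma norm1_le_sqrt_norm: "norm1 (u :: real ^ 'k ^ 'n) \<le> sqrt (real CARD('n)) * norm u"
proof -
  have "L2_set (\<lambda>_. 1) (UNIV :: 'n set) = sqrt (real CARD('n))" by (simp add: L2_set_def)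
  then show ?thesis
    using L2_set_mult_ineq[of "\<lambda>_. 1" "\<lambda>i. norm (u $ i)" "UNIV :: 'n set"]
    by (simp add: norm1_def norm_vec_def[of u])
qed

lemma norm1_axis [simp]: "norm1 (axis i a) = norm a"
  by (simp add: norm1_def axis_def if_distrib[of norm] sum.delta cong: if_cong)

lemma norm_axis_vec [simp]: "norm (axis i a :: real ^ 'k ^ 'n) = norm a"
proof -
  have "(\<Sum>j\<in>UNIV. (norm (if j = i then a else 0))\<^sup>2) = (\<Sum>j\<in>UNIV. if j = i then (norm a)\<^sup>2 else 0)"
    by (intro sum.cong) auto
  then show ?thesis unfolding norm_vec_def[of "axis i a"] by (simp add: L2_set_def axis_def)
qed

lemma vec_lambda_eq_sum_axis: "(\<chi> i. f i) = (\<Sum>i\<in>UNIV. axis i (f i))"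
  by (simp add: vec_eq_iff sum_component axis_def if_distrib sum.delta cong: if_cong)

lemma bounded_linear_axis: "bounded_linear (axis i :: real ^ 'k \<Rightarrow> real ^ 'k ^ 'n)"
proof (rule bounded_linear_intro[where K = 1])
  show "norm (axis i x :: real ^ 'k ^ 'n) \<le> norm x * 1" for x by simp
qed (auto simp: axis_def vec_eq_iff)

text \<open>The second term is the same number in every component, so over all \<open>n\<close>
  particles it has Euclidean norm \<open>sqrt n * norm1 u / n\<close> up to the factor
  \<open>b\<close>. Cauchy-Schwarz bounds this by \<open>norm u\<close>, which keeps the constants
  free of the number of particles.\<close>

lemma norm_le_if_components_mean_field:
  fixes w u :: "real ^ 'k ^ 'n"
  assumes "\<And>i. norm (w $ i) \<le> a * norm (u $ i) + b * (norm1 u / real CARD('n))" "0 \<le> a" "0 \<le> b"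
  shows "norm w \<le> (a + b) * norm u"
proof -
  let ?n = "real CARD('n)"
  have n: "?n > 0" by simp
  have "norm w \<le> L2_set (\<lambda>i. a * norm (u $ i) + b * (norm1 u / ?n)) UNIV"
    unfolding norm_vec_def[of w] using assms(1) by (intro L2_set_mono) auto
  also have "\<dots> \<le> L2_set (\<lambda>i. a * norm (u $ i)) UNIV + L2_set (\<lambda>i::'n. b * (norm1 u / ?n)) UNIV"
    by (rule L2_set_triangle_ineq)
  also have "L2_set (\<lambda>i. a * norm (u $ i)) UNIV = a * norm u"
    using assms(2) by (simp add: norm_vec_def[of u] L2_set_right_distrib)
  also have "L2_set (\<lambda>i::'n. b * (norm1 u / ?n)) UNIV = b * (sqrt ?n * norm1 u / ?n)"
    using assms(3) by (simp add: L2_set_def real_sqrt_mult)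
  finally have 1: "norm w \<le> a * norm u + b * (sqrt ?n * norm1 u / ?n)" .
  have "sqrt ?n * norm1 u / ?n \<le> sqrt ?n * (sqrt ?n * norm u) / ?n"
    by (intro divide_right_mono mult_left_mono norm1_le_sqrt_norm) auto
  also have "\<dots> = norm u" by (simp add: mult.assoc[symmetric])
  finally have "b * (sqrt ?n * norm1 u / ?n) \<le> b * norm u"
    using assms(3) by (rule mult_left_mono)
  with 1 show ?thesis by (simp add: algebra_simps)
qed

locale mean_field =
  fixes dV dW :: "real ^ 'k \<Rightarrow> real ^ 'k" and HV HW :: "real ^ 'k \<Rightarrow> real ^ 'k \<Rightarrow> real ^ 'k"
    and \<epsilon> L Lt LH LHt :: real
  assumes eps: "0 \<le> \<epsilon>" and Lnn: "0 \<le> L" "0 \<le> Lt" "0 \<le> LH" "0 \<le> LHt"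
    and dV: "\<And>x. (dV has_derivative HV x) (at x)" and dW: "\<And>x. (dW has_derivative HW x) (at x)"
    and HV_le: "\<And>x u. norm (HV x u) \<le> L * norm u" and HW_le: "\<And>x u. norm (HW x u) \<le> Lt * norm u"
    and HV_lip: "\<And>x y u. norm (HV x u - HV y u) \<le> LH * norm (x - y) * norm u"
    and HW_lip: "\<And>x y u. norm (HW x u - HW y u) \<le> LHt * norm (x - y) * norm u"
begin

abbreviation F :: "real ^ 'k ^ 'n \<Rightarrow> real ^ 'k ^ 'n" where
  "F \<equiv> mf_force dV dW \<epsilon>"

abbreviation HF :: "real ^ 'k ^ 'n \<Rightarrow> real ^ 'k ^ 'n \<Rightarrow> real ^ 'k ^ 'n" where
  "HF \<equiv> mf_hess HV HW \<epsilon>"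

text \<open>The Lipschitz constant of the total force, in the Euclidean norm and in
  \<open>norm1\<close> alike.\<close>

definition \<Lambda> :: real where "\<Lambda> = L + 4 * \<epsilon> * Lt"

lemma Lam_nonneg: "0 \<le> \<Lambda>"
  using eps Lnn by (simp add: \<Lambda>_def)

lemma dV_lip: "norm (dV x - dV y) \<le> L * norm (x - y)"
  by (rule lipschitz_if_derivative_bounded[OF dV HV_le Lnn(1)])

lemma dW_lip: "norm (dW x - dW y) \<le> Lt * norm (x - y)"
  by (rule lipschitz_if_derivative_bounded[OF dW HW_le Lnn(2)])

lemma linear_HV: "linear (HV x)" and linear_HW: "linear (HW x)"
  using dV dW has_derivative_linear by blast+

lemma mean_field_sum_le:
  fixes a :: "'n::finite \<Rightarrow> real ^ 'k" and z :: "real ^ 'k ^ 'n"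
  assumes "\<And>l. norm (a l) \<le> 2 * Lt * (norm (z $ i) + norm (z $ l))"
  shows "norm ((\<epsilon> / real CARD('n)) *\<^sub>R (\<Sum>l\<in>UNIV. a l))
     \<le> 2 * \<epsilon> * Lt * norm (z $ i) + 2 * \<epsilon> * Lt * (norm1 z / real CARD('n))"
proof -
  let ?n = "real CARD('n)"
  have "norm (\<Sum>l\<in>UNIV. a l) \<le> (\<Sum>l\<in>UNIV. 2 * Lt * (norm (z $ i) + norm (z $ l)))"
    using assms by (intro sum_norm_le)
  also have "\<dots> = 2 * Lt * (?n * norm (z $ i) + norm1 z)"
    by (simp add: norm1_def sum.distrib flip: sum_distrib_left)
  finally have "norm ((\<epsilon> / ?n) *\<^sub>R (\<Sum>l\<in>UNIV. a l)) \<le> \<epsilon> / ?n * (2 * Lt * (?n * norm (z $ i) + norm1 z))"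
    using eps by (simp add: mult_left_mono divide_right_mono)
  also have "\<dots> = 2 * \<epsilon> * Lt * norm (z $ i) + 2 * \<epsilon> * Lt * (norm1 z / ?n)"
    by (simp add: field_simps)
  finally show ?thesis .
qed

lemma interaction_diff_le:
  fixes x y :: "real ^ 'k ^ 'n"
  shows "norm ((F x - F y) $ i - (dV (x $ i) - dV (y $ i)))
     \<le> 2 * \<epsilon> * Lt * norm ((x - y) $ i) + 2 * \<epsilon> * Lt * (norm1 (x - y) / real CARD('n))"
proof -
  let ?a = "\<lambda>l. (dW (x $ i - x $ l) - dW (y $ i - y $ l)) - (dW (x $ l - x $ i) - dW (y $ l - y $ i))"
  have eq: "(F x - F y) $ i - (dV (x $ i) - dV (y $ i)) = (\<epsilon> / real CARD('n)) *\<^sub>R (\<Sum>l\<in>UNIV. ?a l)"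
    by (simp add: mf_force_def sum_subtractf scaleR_diff_right)
  show ?thesis
    unfolding eq
  proof (rule mean_field_sum_le)
    fix l
    have "norm ((x $ i - x $ l) - (y $ i - y $ l)) \<le> norm ((x - y) $ i) + norm ((x - y) $ l)"
      "norm ((x $ l - x $ i) - (y $ l - y $ i)) \<le> norm ((x - y) $ i) + norm ((x - y) $ l)"
      using norm_triangle_ineq4[of "(x - y) $ i" "(x - y) $ l"] norm_triangle_ineq4[of "(x - y) $ l" "(x - y) $ i"]
      by (auto simp: algebra_simps)
    then have "norm (dW (x $ i - x $ l) - dW (y $ i - y $ l)) \<le> Lt * (norm ((x - y) $ i) + norm ((x - y) $ l))"
      "norm (dW (x $ l - x $ i) - dW (y $ l - y $ i)) \<le> Lt * (norm ((x - y) $ i) + norm ((x - y) $ l))"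
      using order_trans[OF dW_lip mult_left_mono[OF _ Lnn(2)]] by blast+
    then show "norm (?a l) \<le> 2 * Lt * (norm ((x - y) $ i) + norm ((x - y) $ l))"
      using norm_triangle_ineq4[of "dW (x $ i - x $ l) - dW (y $ i - y $ l)" "dW (x $ l - x $ i) - dW (y $ l - y $ i)"]
      by linarith
  qed
qed

lemma F_component_le:
  fixes x y :: "real ^ 'k ^ 'n"
  shows "norm ((F x - F y) $ i)
     \<le> (L + 2 * \<epsilon> * Lt) * norm ((x - y) $ i) + 2 * \<epsilon> * Lt * (norm1 (x - y) / real CARD('n))"
  using interaction_diff_le[of x y i] dV_lip[of "x $ i" "y $ i"]
    norm_triangle_sub[of "(F x - F y) $ i" "dV (x $ i) - dV (y $ i)"]
  by (simp add: algebra_simps)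

lemma interaction_diff_le_norm1:
  fixes x y :: "real ^ 'k ^ 'n"
  shows "norm ((F x - F y) $ i - (dV (x $ i) - dV (y $ i))) \<le> 4 * \<epsilon> * Lt * norm1 (x - y)"
proof -
  have "norm1 (x - y) / real CARD('n) \<le> norm1 (x - y)"
    using mult_left_mono[of 1 "real CARD('n)" "norm1 (x - y)"] by (simp add: divide_le_eq)
  then have "2 * \<epsilon> * Lt * norm ((x - y) $ i) + 2 * \<epsilon> * Lt * (norm1 (x - y) / real CARD('n))
      \<le> 2 * \<epsilon> * Lt * norm1 (x - y) + 2 * \<epsilon> * Lt * norm1 (x - y)"
    using eps Lnn by (intro add_mono mult_left_mono norm_nth_le_norm1) auto
  also have "\<dots> = 4 * \<epsilon> * Lt * norm1 (x - y)" by simp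
  finally show ?thesis using interaction_diff_le[of x y i] by linarith
qed

text \<open>For \<open>A = UNIV\<close> this gives the Lipschitz constant in \<open>norm1\<close>.
  For the complement of one particle it shows that displacing this particle affects the force on the
  others only through the interaction, with the factor \<open>4 * \<epsilon> * Lt\<close>.\<close>

lemma F_norm1_off_le:
  fixes x y :: "real ^ 'k ^ 'n"
  shows "(\<Sum>l\<in>A. norm ((F x - F y) $ l)) \<le> L * (\<Sum>l\<in>A. norm ((x - y) $ l)) + 4 * \<epsilon> * Lt * norm1 (x - y)"
proof -
  let ?e = "2 * \<epsilon> * Lt" and ?n = "real CARD('n)"
  have e: "0 \<le> ?e" using eps Lnn by simp
  have sub: "(\<Sum>l\<in>A. norm ((x - y) $ l)) \<le> norm1 (x - y)"
    unfolding norm1_def by (rule sum_mono2) auto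
  have card: "real (card A) \<le> ?n" by (simp add: card_mono)
  have "(\<Sum>l\<in>A. norm ((F x - F y) $ l)) \<le> (\<Sum>l\<in>A. (L + ?e) * norm ((x - y) $ l) + ?e * (norm1 (x - y) / ?n))"
    by (intro sum_mono F_component_le)
  also have "\<dots> = L * (\<Sum>l\<in>A. norm ((x - y) $ l)) + ?e * (\<Sum>l\<in>A. norm ((x - y) $ l))
      + real (card A) * (?e * (norm1 (x - y) / ?n))"
    by (simp add: sum.distrib sum_distrib_left algebra_simps)
  also have "\<dots> \<le> L * (\<Sum>l\<in>A. norm ((x - y) $ l)) + ?e * norm1 (x - y) + ?n * (?e * (norm1 (x - y) / ?n))"
    using e card by (intro add_mono mult_left_mono[OF sub] mult_right_mono order_refl) auto
  also have "\<dots> = L * (\<Sum>l\<in>A. norm ((x - y) $ l)) + 4 * \<epsilon> * Lt * norm1 (x - y)" by simp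
  finally show ?thesis .
qed

lemma F_norm1_lip: "norm1 (F x - F y) \<le> \<Lambda> * norm1 (x - y)"
  using F_norm1_off_le[of x y UNIV] by (simp add: norm1_def \<Lambda>_def algebra_simps)

lemma F_lip: "norm (F x - F y) \<le> \<Lambda> * norm (x - y)"
proof -
  have "norm (F x - F y) \<le> ((L + 2 * \<epsilon> * Lt) + 2 * \<epsilon> * Lt) * norm (x - y)"
    using eps Lnn by (intro norm_le_if_components_mean_field F_component_le) auto
  then show ?thesis by (simp add: \<Lambda>_def algebra_simps)
qed

lemma HF_le:
  fixes x u :: "real ^ 'k ^ 'n"
  shows "norm (HF x u) \<le> \<Lambda> * norm u"
proof -
  have "norm (HF x u $ i) \<le> (L + 2 * \<epsilon> * Lt) * norm (u $ i) + 2 * \<epsilon> * Lt * (norm1 u / real CARD('n))"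
    for i
  proof -
    let ?a = "\<lambda>l. HW (x $ i - x $ l) (u $ i - u $ l) + HW (x $ l - x $ i) (u $ i - u $ l)"
    have "norm ((\<epsilon> / real CARD('n)) *\<^sub>R (\<Sum>l\<in>UNIV. ?a l))
       \<le> 2 * \<epsilon> * Lt * norm (u $ i) + 2 * \<epsilon> * Lt * (norm1 u / real CARD('n))"
    proof (rule mean_field_sum_le)
      fix l
      have "Lt * norm (u $ i - u $ l) \<le> Lt * (norm (u $ i) + norm (u $ l))"
        using Lnn by (intro mult_left_mono norm_triangle_ineq4)
      then show "norm (?a l) \<le> 2 * Lt * (norm (u $ i) + norm (u $ l))"
        using norm_triangle_ineq[of "HW (x $ i - x $ l) (u $ i - u $ l)" "HW (x $ l - x $ i) (u $ i - u $ l)"]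
          HW_le[of "x $ i - x $ l" "u $ i - u $ l"] HW_le[of "x $ l - x $ i" "u $ i - u $ l"]
        by linarith
    qed
    then show ?thesis
      using norm_triangle_ineq[of "HV (x $ i) (u $ i)" "(\<epsilon> / real CARD('n)) *\<^sub>R (\<Sum>l\<in>UNIV. ?a l)"]
        HV_le[of "x $ i" "u $ i"]
      by (simp add: mf_hess_def algebra_simps)
  qed
  then have "norm (HF x u) \<le> ((L + 2 * \<epsilon> * Lt) + 2 * \<epsilon> * Lt) * norm u"
    using eps Lnn by (intro norm_le_if_components_mean_field) auto
  then show ?thesis by (simp add: \<Lambda>_def algebra_simps)
qed

lemma F_has_derivative: "(F has_derivative HF x) (at (x :: real ^ 'k ^ 'n))"
proof -
  have nth: "((\<lambda>x::real ^ 'k ^ 'n. x $ i) has_derivative (\<lambda>u. u $ i)) (at x)" for i x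
    by (rule bounded_linear_imp_has_derivative[OF bounded_linear_vec_nth])
  have V: "((\<lambda>x::real ^ 'k ^ 'n. dV (x $ i)) has_derivative (\<lambda>u. HV (x $ i) (u $ i))) (at x)" for i
    using has_derivative_compose[OF nth, of dV "HV (x $ i)"] dV by simp
  have W: "((\<lambda>x::real ^ 'k ^ 'n. dW (x $ i - x $ l)) has_derivative (\<lambda>u. HW (x $ i - x $ l) (u $ i - u $ l))) (at x)" for i l
    using has_derivative_compose[OF has_derivative_diff[OF nth nth], of dW "HW (x $ i - x $ l)"] dW by simp
  have "HW (x $ l - x $ i) (u $ l - u $ i) = - HW (x $ l - x $ i) (u $ i - u $ l)" for u i l
    using linear_neg[OF linear_HW, of _ "u $ i - u $ l"] by (metis minus_diff_eq)
  then have W': "((\<lambda>x::real ^ 'k ^ 'n. dW (x $ i - x $ l) - dW (x $ l - x $ i)) has_derivative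
      (\<lambda>u. HW (x $ i - x $ l) (u $ i - u $ l) + HW (x $ l - x $ i) (u $ i - u $ l))) (at x)" for i l
    using has_derivative_diff[OF W W, of i l l i] by simp
  have "((\<lambda>x. \<Sum>i\<in>UNIV. axis i (dV (x $ i) + (\<epsilon> / real CARD('n)) *\<^sub>R
      (\<Sum>l\<in>UNIV. dW (x $ i - x $ l) - dW (x $ l - x $ i)))) has_derivative
      (\<lambda>u. \<Sum>i\<in>UNIV. axis i (HV (x $ i) (u $ i) + (\<epsilon> / real CARD('n)) *\<^sub>R
      (\<Sum>l\<in>UNIV. HW (x $ i - x $ l) (u $ i - u $ l) + HW (x $ l - x $ i) (u $ i - u $ l))))) (at x)"
    by (intro has_derivative_sum bounded_linear.has_derivative[OF bounded_linear_axis]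
        has_derivative_add V has_derivative_scaleR_right W')
  then show ?thesis
    unfolding mf_force_def[abs_def] mf_hess_def[abs_def] vec_lambda_eq_sum_axis .
qed

lemma linear_HF: "linear (HF x)"
  using F_has_derivative has_derivative_linear by blast

lemma frob_block_le:
  fixes A :: "real ^ 'k \<Rightarrow> real ^ 'k"
  assumes A: "linear A" "\<And>w. norm (A w) \<le> \<alpha> * norm w" "0 \<le> \<alpha>"
    and P: "linear P" "\<And>u :: real ^ 'k ^ 'n. norm (P u) \<le> c * norm u" "0 \<le> c"
  shows "frob (\<lambda>u. axis i (A (P u)) :: real ^ 'k ^ 'n) \<le> c * (sqrt (real CARD('k)) * \<alpha>)"
proof -
  have "frob (\<lambda>u. axis i (A (P u)) :: real ^ 'k ^ 'n) = frob (\<lambda>u. A (P u))"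
    by (simp add: frob_def)
  also have "\<dots> \<le> c * frob A" by (rule frob_comp_right_le[OF A(1) P])
  also have "\<dots> \<le> c * (sqrt (real CARD('k)) * \<alpha>)"
    using frob_le_opnorm[OF A(2,3)] P(3) by (intro mult_left_mono) auto
  finally show ?thesis .
qed

text \<open>The difference is split into blocks that act on one particle or one pair; each costs the
  square root of \<open>CARD('k)\<close> and not of the full dimension. The \<open>8\<close>
  collects two derivatives of the interaction force per pair, the norm 2 of the map to
  \<open>u $ i - u $ l\<close>, and a double sum over pairs that equals
  \<open>2 * CARD('n) * norm1 (x - y)\<close>.\<close>

lemma frob_HF_diff_le:
  fixes x y :: "real ^ 'k ^ 'n"
  shows "frob (\<lambda>u. HF x u - HF y u) \<le> sqrt (real CARD('k)) * (LH + 8 * \<epsilon> * LHt) * norm1 (x - y)"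
proof -
  let ?k = "sqrt (real CARD('k))" and ?n = "real CARD('n)"
  define AV where "AV i w = HV (x $ i) w - HV (y $ i) w" for i w
  define AW where "AW i l w = HW (x $ i - x $ l) w - HW (y $ i - y $ l) w" for i l w
  have lin: "linear (AV i)" "linear (AW i l)" for i l
    unfolding AV_def[abs_def] AW_def[abs_def]
    by (intro linear_compose_sub linear_HV linear_HW)+
  have AV_le: "norm (AV i w) \<le> (LH * norm ((x - y) $ i)) * norm w" for i w
    using HV_lip[of "x $ i" w "y $ i"] by (simp add: AV_def)
  have AW_le: "norm (AW i l w) \<le> (LHt * (norm ((x - y) $ i) + norm ((x - y) $ l))) * norm w" for i l w
  proof -
    have "norm ((x $ i - x $ l) - (y $ i - y $ l)) \<le> norm ((x - y) $ i) + norm ((x - y) $ l)"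
      using norm_triangle_ineq4[of "(x - y) $ i" "(x - y) $ l"] by (simp add: algebra_simps)
    then show ?thesis
      using HW_lip[of "x $ i - x $ l" w "y $ i - y $ l"] Lnn
      unfolding AW_def by (elim order_trans) (intro mult_right_mono mult_left_mono, auto)
  qed
  have nth: "linear (\<lambda>u::real ^ 'k ^ 'n. u $ i)" for i
    by (rule bounded_linear.linear[OF bounded_linear_vec_nth])
  have nth_le: "norm (u $ i) \<le> 1 * norm u" for i and u :: "real ^ 'k ^ 'n"
    by (simp add: Finite_Cartesian_Product.norm_nth_le)
  have nth2: "linear (\<lambda>u::real ^ 'k ^ 'n. u $ i - u $ l)" for i l
    by (intro linear_compose_sub nth)
  have nth2_le: "norm (u $ i - u $ l) \<le> 2 * norm u" for i l and u :: "real ^ 'k ^ 'n"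
    using nth_le[of u i] nth_le[of u l] norm_triangle_ineq4[of "u $ i" "u $ l"] by linarith
  let ?DV = "\<lambda>u :: real ^ 'k ^ 'n. \<Sum>i\<in>UNIV. axis i (AV i (u $ i)) :: real ^ 'k ^ 'n"
  let ?DW1 = "\<lambda>i l (u :: real ^ 'k ^ 'n). axis i (AW i l (u $ i - u $ l)) + axis i (AW l i (u $ i - u $ l)) :: real ^ 'k ^ 'n"
  let ?DW = "\<lambda>u. \<Sum>i\<in>UNIV. \<Sum>l\<in>UNIV. ?DW1 i l u"
  have eq: "(\<lambda>u. HF x u - HF y u) = (\<lambda>u. ?DV u + (\<epsilon> / ?n) *\<^sub>R ?DW u)"
  proof
    fix u
    have "HF x u - HF y u = (\<chi> i. AV i (u $ i) + (\<epsilon> / ?n) *\<^sub>R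
        (\<Sum>l\<in>UNIV. AW i l (u $ i - u $ l) + AW l i (u $ i - u $ l)))"
      by (simp add: mf_hess_def AV_def AW_def vec_eq_iff sum_subtractf sum.distrib algebra_simps)
    also have "\<dots> = ?DV u + (\<epsilon> / ?n) *\<^sub>R ?DW u"
      unfolding vec_lambda_eq_sum_axis
      by (simp add: linear_add[OF bounded_linear.linear[OF bounded_linear_axis]]
          linear_cmul[OF bounded_linear.linear[OF bounded_linear_axis]]
          linear_sum[OF bounded_linear.linear[OF bounded_linear_axis]] sum.distrib scaleR_sum_right scaleR_add_right)
    finally show "HF x u - HF y u = ?DV u + (\<epsilon> / ?n) *\<^sub>R ?DW u" .
  qed
  have fV: "frob (\<lambda>u::real ^ 'k ^ 'n. axis i (AV i (u $ i)) :: real ^ 'k ^ 'n) \<le> ?k * (LH * norm ((x - y) $ i))" for i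
    using frob_block_le[OF lin(1) AV_le _ nth nth_le, of i i] Lnn by simp
  have fW: "frob (\<lambda>u::real ^ 'k ^ 'n. axis i (AW j l (u $ i - u $ m)) :: real ^ 'k ^ 'n)
      \<le> 2 * (?k * (LHt * (norm ((x - y) $ j) + norm ((x - y) $ l))))" for i j l m
    using frob_block_le[OF lin(2) AW_le _ nth2 nth2_le, of j l i i m] Lnn by simp
  have "frob (\<lambda>u. HF x u - HF y u) \<le> frob ?DV
      + frob (\<lambda>u. (\<epsilon> / ?n) *\<^sub>R ?DW u)"
    unfolding eq by (rule frob_add_le)
  also have "\<dots> \<le> ?k * LH * norm1 (x - y) + (\<epsilon> / ?n) * (8 * ?k * LHt * (?n * norm1 (x - y)))"
  proof (rule add_mono)
    have "frob ?DV
        \<le> (\<Sum>i\<in>UNIV. ?k * (LH * norm ((x - y) $ i)))"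
      by (rule order_trans[OF frob_sum_le sum_mono]) (rule fV)
    then show "frob ?DV
        \<le> ?k * LH * norm1 (x - y)"
      by (simp add: norm1_def sum_distrib_left algebra_simps)
    have "frob ?DW
        \<le> (\<Sum>i\<in>UNIV. \<Sum>l\<in>(UNIV :: 'n set). 4 * (?k * (LHt * (norm ((x - y) $ i) + norm ((x - y) $ l)))))"
    proof (rule order_trans[OF frob_sum_le sum_mono], rule order_trans[OF frob_sum_le sum_mono])
      fix i l :: 'n
      show "frob (?DW1 i l)
        \<le> 4 * (?k * (LHt * (norm ((x - y) $ i) + norm ((x - y) $ l))))"
        using frob_add_le[of "\<lambda>u::real ^ 'k ^ 'n. axis i (AW i l (u $ i - u $ l)) :: real ^ 'k ^ 'n" "\<lambda>u. axis i (AW l i (u $ i - u $ l))"]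
          fW[of i i l l] fW[of i l i l] by (simp add: algebra_simps)
    qed
    also have "\<dots> = 4 * ?k * LHt * (\<Sum>i\<in>UNIV. \<Sum>l\<in>(UNIV :: 'n set). norm ((x - y) $ i) + norm ((x - y) $ l))"
      by (simp add: sum_distrib_left algebra_simps)
    also have "(\<Sum>i\<in>UNIV. \<Sum>l\<in>(UNIV :: 'n set). norm ((x - y) $ i) + norm ((x - y) $ l)) = 2 * (?n * norm1 (x - y))"
      by (simp add: sum.distrib norm1_def sum_distrib_left)
    finally have "frob ?DW
        \<le> 8 * ?k * LHt * (?n * norm1 (x - y))" by simp
    from mult_left_mono[OF this, of "\<epsilon> / ?n"]
    show "frob (\<lambda>u. (\<epsilon> / ?n) *\<^sub>R ?DW u)
      \<le> (\<epsilon> / ?n) * (8 * ?k * LHt * (?n * norm1 (x - y)))"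
      unfolding frob_scale using eps by simp
  qed
  also have "\<dots> = ?k * (LH + 8 * \<epsilon> * LHt) * norm1 (x - y)" by (simp add: field_simps)
  finally show ?thesis .
qed

end

lemma grad_mean_field_potential:
  fixes x :: "real ^ 'k ^ 'n"
  assumes V: "\<And>a. (V has_derivative (\<lambda>u. u \<bullet> dV a)) (at a)"
    and W: "\<And>a. (W has_derivative (\<lambda>u. u \<bullet> dW a)) (at a)"
  shows "grad (mean_field_potential V W \<epsilon>) x = mf_force dV dW \<epsilon> x"
proof (rule grad_unique)
  let ?n = "real CARD('n)"
  have nth: "((\<lambda>x::real ^ 'k ^ 'n. x $ i) has_derivative (\<lambda>u. u $ i)) (at x)" for i x
    by (rule bounded_linear_imp_has_derivative[OF bounded_linear_vec_nth])
  have V': "((\<lambda>x::real ^ 'k ^ 'n. V (x $ i)) has_derivative (\<lambda>u. u $ i \<bullet> dV (x $ i))) (at x)" for i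
    by (rule has_derivative_compose[OF nth, of V "\<lambda>u. u \<bullet> dV (x $ i)"]) (rule V)
  have W': "((\<lambda>x::real ^ 'k ^ 'n. W (x $ i - x $ l)) has_derivative (\<lambda>u. (u $ i - u $ l) \<bullet> dW (x $ i - x $ l))) (at x)" for i l
    by (rule has_derivative_compose[OF has_derivative_diff[OF nth nth], of W "\<lambda>u. u \<bullet> dW (x $ i - x $ l)"]) (rule W)
  have "(mean_field_potential V W \<epsilon> has_derivative
      (\<lambda>u. \<Sum>i\<in>UNIV. u $ i \<bullet> dV (x $ i) + \<epsilon> / ?n * (\<Sum>l\<in>UNIV - {i}. (u $ i - u $ l) \<bullet> dW (x $ i - x $ l)))) (at x)"
    unfolding mean_field_potential_def[abs_def]
    by (intro has_derivative_sum has_derivative_add V' has_derivative_mult_right W')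
  moreover have "(\<Sum>i\<in>UNIV. u $ i \<bullet> dV (x $ i) + \<epsilon> / ?n * (\<Sum>l\<in>UNIV - {i}. (u $ i - u $ l) \<bullet> dW (x $ i - x $ l)))
      = u \<bullet> mf_force dV dW \<epsilon> x" for u
  proof -
    have diag: "(\<Sum>l\<in>UNIV - {i}. (u $ i - u $ l) \<bullet> dW (x $ i - x $ l)) = (\<Sum>l\<in>UNIV. (u $ i - u $ l) \<bullet> dW (x $ i - x $ l))" for i
      by (rule sum.mono_neutral_left) auto
    \<comment> \<open>Renaming the summation indices moves the reaction on the other particle into
      the coefficient of \<open>u $ i\<close>.\<close>
    have swap: "(\<Sum>i\<in>UNIV. \<Sum>l\<in>UNIV. u $ l \<bullet> dW (x $ i - x $ l)) = (\<Sum>i\<in>UNIV. \<Sum>l\<in>UNIV. u $ i \<bullet> dW (x $ l - x $ i))"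
      by (rule sum.swap)
    have "(\<Sum>i\<in>UNIV. u $ i \<bullet> dV (x $ i) + \<epsilon> / ?n * (\<Sum>l\<in>UNIV - {i}. (u $ i - u $ l) \<bullet> dW (x $ i - x $ l)))
        = (\<Sum>i\<in>UNIV. u $ i \<bullet> dV (x $ i)) + \<epsilon> / ?n * ((\<Sum>i\<in>UNIV. \<Sum>l\<in>UNIV. u $ i \<bullet> dW (x $ i - x $ l))
          - (\<Sum>i\<in>UNIV. \<Sum>l\<in>UNIV. u $ l \<bullet> dW (x $ i - x $ l)))"
      unfolding diag by (simp only: inner_diff_left sum_subtractf sum.distrib sum_distrib_left[symmetric])
    also have "\<dots> = (\<Sum>i\<in>UNIV. u $ i \<bullet> (dV (x $ i) + (\<epsilon> / ?n) *\<^sub>R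
        (\<Sum>l\<in>UNIV. dW (x $ i - x $ l) - dW (x $ l - x $ i))))"
      unfolding swap
      by (simp only: inner_add_right inner_scaleR_right inner_sum_right inner_diff_right
          sum_subtractf sum.distrib sum_distrib_left[symmetric])
    also have "\<dots> = u \<bullet> mf_force dV dW \<epsilon> x"
      by (simp only: inner_vec_def[of u] mf_force_def vec_lambda_beta)
    finally show ?thesis .
  qed
  ultimately show "GDERIV (mean_field_potential V W \<epsilon>) x :> mf_force dV dW \<epsilon> x"
    by (simp add: gderiv_def)
qed

subsection \<open>Total variation under a transport of the Gaussian\<close>

lemma trace_lin_diff: "trace_lin (\<lambda>v. A v - B v) = trace_lin A - trace_lin B"
  by (simp add: trace_lin_def inner_diff_left sum_subtractf)

text \<open>Expands the exponent of \<open>jac_ge_exp\<close> around the identity; the trace is the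
  first-order term that cancels in the entropy.\<close>

lemma frob_id_plus_power2:
  "(frob (\<lambda>v::'a::euclidean_space. v + G v))\<^sup>2 = real DIM('a) + 2 * trace_lin G + (frob G)\<^sup>2"
proof -
  have "(norm (b + G b))\<^sup>2 = 1 + 2 * (G b \<bullet> b) + (norm (G b))\<^sup>2" if "b \<in> Basis" for b :: 'a
    using that by (simp add: power2_norm_eq_inner inner_add_left inner_add_right inner_commute)
  then show ?thesis
    by (simp add: frob_power2 trace_lin_def sum.distrib sum_distrib_left)
qed

text \<open>Integration by parts, summed over the basis; this identity is behind the cancellation of
  the linear terms in the entropy.\<close>

lemma gauss_divergence:
  fixes b :: "'a::euclidean_space \<Rightarrow> 'a"
  assumes b: "\<And>v. (b has_derivative B v) (at v)" and bb: "\<And>v. norm (b v) \<le> C" and BB: "\<And>v u. norm (B v u) \<le> C * norm u"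
  shows "integrable lborel (\<lambda>v. gauss v * trace_lin (B v))"
    and "integrable lborel (\<lambda>v. gauss v * (v \<bullet> b v))"
    and "(LINT v|lborel. gauss v * trace_lin (B v)) = (LINT v|lborel. gauss v * (v \<bullet> b v))"
proof -
  have C: "0 \<le> C" using bb[of 0] norm_ge_zero order_trans by blast
  have ibp: "integrable lborel (\<lambda>v. gauss v * (B v e \<bullet> e))"
      "integrable lborel (\<lambda>v. gauss v * ((v \<bullet> e) * (b v \<bullet> e)))"
      "(LINT v|lborel. gauss v * (B v e \<bullet> e)) = (LINT v|lborel. gauss v * ((v \<bullet> e) * (b v \<bullet> e)))"
    if e: "e \<in> Basis" for e
  proof -
    have 1: "((\<lambda>v. b v \<bullet> e) has_derivative (\<lambda>w. B v w \<bullet> e)) (at v)" for v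
      by (rule has_derivative_inner_left[OF b])
    have 2: "\<bar>b v \<bullet> e\<bar> \<le> C * (1 + norm v)" for v
    proof -
      have "0 \<le> C * norm v" using C by simp
      then show ?thesis
        using Basis_le_norm[OF e, of "b v"] bb[of v] unfolding distrib_left by linarith
    qed
    have 3: "\<bar>B v e \<bullet> e\<bar> \<le> C" for v
      using Basis_le_norm[OF e, of "B v e"] BB[of v e] e by simp
    show "integrable lborel (\<lambda>v. gauss v * (B v e \<bullet> e))"
      "integrable lborel (\<lambda>v. gauss v * ((v \<bullet> e) * (b v \<bullet> e)))"
      "(LINT v|lborel. gauss v * (B v e \<bullet> e)) = (LINT v|lborel. gauss v * ((v \<bullet> e) * (b v \<bullet> e)))"
      using gauss_integration_by_parts[where b = "\<lambda>v. b v \<bullet> e" and B = "\<lambda>v w. B v w \<bullet> e" and e = e, OF 1 2 3]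
      by auto
  qed
  have eq1: "gauss v * trace_lin (B v) = (\<Sum>e\<in>Basis. gauss v * (B v e \<bullet> e))" for v
    by (simp add: trace_lin_def sum_distrib_left)
  have eq2: "gauss v * (v \<bullet> b v) = (\<Sum>e\<in>Basis. gauss v * ((v \<bullet> e) * (b v \<bullet> e)))" for v
    by (subst euclidean_inner) (simp add: sum_distrib_left)
  show "integrable lborel (\<lambda>v. gauss v * trace_lin (B v))"
    unfolding eq1 using ibp by (intro Bochner_Integration.integrable_sum) auto
  show "integrable lborel (\<lambda>v. gauss v * (v \<bullet> b v))"
    unfolding eq2 using ibp by (intro Bochner_Integration.integrable_sum) auto
  show "(LINT v|lborel. gauss v * trace_lin (B v)) = (LINT v|lborel. gauss v * (v \<bullet> b v))"
    unfolding eq1 eq2 using ibp by simp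
qed

text \<open>Cauchy-Schwarz with a free parameter. The bound is linear in \<open>p\<^sup>2\<close>,
  \<open>q\<^sup>2\<close> and \<open>p * q\<close>, so it can be integrated with the roots of two
  densities before \<open>s\<close> is chosen.\<close>

lemma abs_diff_squares_le:
  fixes p q s :: real
  assumes s: "0 < s" and "0 \<le> p" "0 \<le> q"
  shows "\<bar>p\<^sup>2 - q\<^sup>2\<bar> \<le> (s + 1/s) / 2 * (p\<^sup>2 + q\<^sup>2) + (1/s - s) * (p * q)"
proof -
  have "p\<^sup>2 - q\<^sup>2 = (p - q) * (p + q)" by (simp add: power2_eq_square algebra_simps)
  then have "\<bar>p\<^sup>2 - q\<^sup>2\<bar> = \<bar>p - q\<bar> * (p + q)" using assms by (simp add: abs_mult)
  also have "\<dots> \<le> (s * \<bar>p - q\<bar>\<^sup>2 + (p + q)\<^sup>2 / s) / 2"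
  proof -
    have "0 \<le> (s * \<bar>p - q\<bar> - (p + q))\<^sup>2 / s" using s by simp
    also have "\<dots> = s * \<bar>p - q\<bar>\<^sup>2 + (p + q)\<^sup>2 / s - 2 * (\<bar>p - q\<bar> * (p + q))"
      using s by (simp add: power2_eq_square field_simps)
    finally show ?thesis by simp
  qed
  also have "\<dots> = (s + 1/s) / 2 * (p\<^sup>2 + q\<^sup>2) + (1/s - s) * (p * q)"
    unfolding power2_abs power2_diff power2_sum using s by (simp add: field_simps)
  finally show ?thesis .
qed

text \<open>
  The total variation distance is controlled by the Hellinger distance, and that by the relative
  entropy \<open>\<kappa>\<close>. In the entropy the linear terms \<open>v \<bullet> (\<Phi> v - v)\<close> and
  \<open>log (jac (\<Phi>' v))\<close> cancel to first order after integration by parts.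
\<close>

lemma gauss_transport_total_variation:
  fixes \<Phi> :: "'a::euclidean_space \<Rightarrow> 'a" and k :: "'a \<Rightarrow> real"
  assumes deriv: "\<And>v. (\<Phi> has_derivative \<Phi>' v) (at v)" and bij: "bij \<Phi>"
    and B: "\<And>v. linear (B v)" "\<And>v u. B v (\<Phi>' v u) = u" "\<And>v u. \<Phi>' v (B v u) = u"
    and shift: "\<And>v. norm (\<Phi> v - v) \<le> \<beta>" "0 < \<beta>"
    and C: "\<And>v u. norm (\<Phi>' v u) \<le> C * norm u" "0 \<le> C"
    and G: "\<And>v. frob (\<lambda>u. B v u - u) \<le> \<theta>"
    and k[measurable]: "k \<in> borel_measurable borel" and k01: "\<And>v. 0 \<le> k v" "\<And>v. k v \<le> 1"
  shows "\<bar>(LINT v|lborel. gauss v * k (\<Phi> v)) - (LINT v|lborel. gauss v * k v)\<bar>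
     \<le> sqrt (\<beta>\<^sup>2 / 2 + (1/2 + C) * \<theta>\<^sup>2)"
proof -
  define \<kappa> where "\<kappa> = \<beta>\<^sup>2 / 2 + (1/2 + C) * \<theta>\<^sup>2"
  have \<kappa>: "0 < \<kappa>" using shift C by (simp add: \<kappa>_def add_pos_nonneg)
  have \<theta>: "0 \<le> \<theta>" using G[of 0] frob_nonneg order_trans by blast
  \<comment> \<open>The density of the Gaussian pulled back by \<Phi>: integrating
    \<open>\<rho> v * k (\<Phi> v)\<close> gives the Gaussian integral of \<open>k\<close>. So the
    claim compares \<open>gauss\<close> and \<rho> under the same function
    \<open>k (\<Phi> v)\<close>.\<close>
  define \<rho> where "\<rho> v = jac (\<Phi>' v) * gauss (\<Phi> v)" for v
  have [measurable]: "\<Phi> \<in> borel_measurable borel"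
    using deriv by (rule borel_measurable_if_has_derivative)
  have [measurable]: "(\<lambda>v. jac (\<Phi>' v)) \<in> borel_measurable borel"
    using deriv by (rule borel_measurable_jac)
  have \<rho>_meas[measurable]: "\<rho> \<in> borel_measurable borel" unfolding \<rho>_def by measurable
  have \<rho>0: "0 \<le> \<rho> v" for v by (simp add: \<rho>_def)
  have \<rho>: "integrable lborel \<rho>" "integral\<^sup>L lborel \<rho> = 1"
    using change_of_variables_euclidean[OF deriv bij integrable_gauss] by (simp_all add: \<rho>_def[abs_def] integral_gauss)
  have gk: "integrable lborel (\<lambda>v. gauss v * k v)" "integrable lborel (\<lambda>v. gauss v * k (\<Phi> v))"
    by (rule Bochner_Integration.integrable_bound[OF integrable_gauss]; use k01 in \<open>auto simp: mult_left_le\<close>)+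
  have \<rho>k: "integrable lborel (\<lambda>v. \<rho> v * k (\<Phi> v))" "(LINT v|lborel. \<rho> v * k (\<Phi> v)) = (LINT v|lborel. gauss v * k v)"
    using change_of_variables_euclidean[OF deriv bij gk(1)] by (simp_all add: \<rho>_def mult.assoc)

  define b where "b v = \<Phi> v - v" for v
  have derb: "(b has_derivative (\<lambda>u. \<Phi>' v u - u)) (at v)" for v
    unfolding b_def by (intro has_derivative_diff deriv has_derivative_ident)
  have bC: "norm (b v) \<le> \<beta> + C + 1" "norm (\<Phi>' v u - u) \<le> (\<beta> + C + 1) * norm u" for v u
  proof -
    show "norm (b v) \<le> \<beta> + C + 1" using shift(1)[of v] C by (simp add: b_def)
    have "norm (\<Phi>' v u - u) \<le> C * norm u + norm u"
      using norm_triangle_ineq4[of "\<Phi>' v u" u] C(1)[of v u] by linarith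
    also have "\<dots> \<le> (\<beta> + C + 1) * norm u" using shift(2) by (simp add: algebra_simps)
    finally show "norm (\<Phi>' v u - u) \<le> (\<beta> + C + 1) * norm u" .
  qed
  note div = gauss_divergence[OF derb bC]
  \<comment> \<open>A lower bound for the logarithm of \<open>\<rho> v / gauss v\<close>. By
    \<open>div\<close> its first two terms have the same Gaussian mean, so its own mean is exactly
    \<open>- \<kappa>\<close>.\<close>
  define lr where "lr v = trace_lin (\<lambda>u. \<Phi>' v u - u) - v \<bullet> b v - \<kappa>" for v
  have ratio: "gauss v * exp (lr v) \<le> \<rho> v" for v
  proof -
    define G where "G u = B v u - u" for u
    have linG: "linear G" unfolding G_def[abs_def] by (intro linear_compose_sub B linear_ident)
    have lin\<Phi>: "linear (\<Phi>' v)" using deriv has_derivative_linear by blast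
    have fG: "frob G \<le> \<theta>" using assms(10)[of v] by (simp add: G_def[abs_def])
    then have fG2: "(frob G)\<^sup>2 \<le> \<theta>\<^sup>2" by (intro power_mono) auto
    \<comment> \<open>Since \<open>B v = I + G\<close> is inverse to \<open>\<Phi>' v\<close>, the
      defect \<open>G - (I - \<Phi>' v)\<close> is \<open>G G (\<Phi>' v)\<close>: the trace of
      \<open>G\<close> is linear in \<open>\<Phi>' v\<close> up to a quadratic error.\<close>
    have "(\<lambda>u. G u - (u - \<Phi>' v u)) = (\<lambda>u. G (G (\<Phi>' v u)))"
      by (auto simp: G_def B linear_diff[OF B(1)])
    then have "trace_lin G - trace_lin (\<lambda>u. u - \<Phi>' v u) = trace_lin (\<lambda>u. G (G (\<Phi>' v u)))"
      by (metis trace_lin_diff)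
    also have "\<dots> \<le> frob G * frob (\<lambda>u. G (\<Phi>' v u))" by (rule trace_lin_comp_le[OF linG])
    also have "\<dots> \<le> frob G * (C * frob G)"
      using frob_comp_right_le[OF linG lin\<Phi> C(1) C(2)] by (intro mult_left_mono) auto
    also have "\<dots> = C * (frob G)\<^sup>2" by (simp add: power2_eq_square)
    also have "\<dots> \<le> C * \<theta>\<^sup>2" using fG2 C by (intro mult_left_mono)
    finally have tr: "trace_lin G \<le> C * \<theta>\<^sup>2 - trace_lin (\<lambda>u. \<Phi>' v u - u)"
      by (simp add: trace_lin_diff)
    have "B v = (\<lambda>u. u + G u)" by (simp add: G_def)
    then have fB: "(frob (B v))\<^sup>2 = real DIM('a) + 2 * trace_lin G + (frob G)\<^sup>2"
      by (simp add: frob_id_plus_power2)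
    have nb: "(norm (b v))\<^sup>2 \<le> \<beta>\<^sup>2" using shift(1)[of v] by (intro power_mono) (auto simp: b_def)
    have n\<Phi>: "(norm (\<Phi> v))\<^sup>2 = (norm v)\<^sup>2 + 2 * (v \<bullet> b v) + (norm (b v))\<^sup>2"
    proof -
      have "\<Phi> v = v + b v" by (simp add: b_def)
      then show ?thesis
        by (simp add: power2_norm_eq_inner inner_add_left inner_add_right inner_commute)
    qed
    have "gauss v * exp (lr v) \<le> gauss v * (exp (- ((frob (B v))\<^sup>2 - real DIM('a)) / 2) * exp (((norm v)\<^sup>2 - (norm (\<Phi> v))\<^sup>2) / 2))"
      unfolding exp_add[symmetric]
    proof (intro mult_left_mono, simp_all only: exp_le_cancel_iff gauss_nonneg)
      have "lr v \<le> - trace_lin G - (frob G)\<^sup>2 / 2 - v \<bullet> b v - (norm (b v))\<^sup>2 / 2"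
        unfolding lr_def \<kappa>_def using tr fG2 nb by (simp add: algebra_simps)
      also have "\<dots> = - ((frob (B v))\<^sup>2 - real DIM('a)) / 2 + ((norm v)\<^sup>2 - (norm (\<Phi> v))\<^sup>2) / 2"
        unfolding fB n\<Phi> by (simp add: field_simps)
      finally show "lr v \<le> - ((frob (B v))\<^sup>2 - real DIM('a)) / 2 + ((norm v)\<^sup>2 - (norm (\<Phi> v))\<^sup>2) / 2" .
    qed
    also have "\<dots> \<le> gauss v * (jac (\<Phi>' v) * exp (((norm v)\<^sup>2 - (norm (\<Phi> v))\<^sup>2) / 2))"
      using jac_ge_exp[OF lin\<Phi> B(1)[of v]] B by (intro mult_left_mono mult_right_mono) auto
    also have "\<dots> = \<rho> v"
    proof -
      have "exp (- (norm v)\<^sup>2 / 2) * exp (((norm v)\<^sup>2 - (norm (\<Phi> v))\<^sup>2) / 2) = exp (- (norm (\<Phi> v))\<^sup>2 / 2)"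
        unfolding exp_add[symmetric] by (rule arg_cong[where f = exp]) (simp add: field_simps)
      then show ?thesis by (simp add: gauss_def \<rho>_def)
    qed
    finally show ?thesis .
  qed
  define a where "a = (LINT v|lborel. sqrt (gauss v) * sqrt (\<rho> v))"
  have sq_int: "integrable lborel (\<lambda>v. sqrt (gauss v) * sqrt (\<rho> v))"
  proof (rule Bochner_Integration.integrable_bound)
    show "integrable lborel (\<lambda>v. gauss v + \<rho> v)" using \<rho> integrable_gauss by auto
    have "sqrt (gauss v) * sqrt (\<rho> v) \<le> gauss v + \<rho> v" for v
    proof -
      have "2 * sqrt (gauss v) * sqrt (\<rho> v) \<le> (sqrt (gauss v))\<^sup>2 + (sqrt (\<rho> v))\<^sup>2"
        by (rule sum_squares_bound)
      then have "2 * (sqrt (gauss v) * sqrt (\<rho> v)) \<le> gauss v + \<rho> v" using \<rho>0[of v] by simp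
      moreover have "0 \<le> sqrt (gauss v) * sqrt (\<rho> v)" using \<rho>0[of v] by simp
      ultimately show ?thesis by linarith
    qed
    then show "AE v in lborel. norm (sqrt (gauss v) * sqrt (\<rho> v)) \<le> norm (gauss v + \<rho> v)"
      using \<rho>0 by (intro AE_I2) (simp add: abs_mult)
  qed measurable
  \<comment> \<open>The Hellinger affinity. The root of the density ratio is at least
    \<open>exp (lr v / 2) \<ge> 1 + lr v / 2\<close>, and integration leaves only \<kappa>.\<close>
  have a: "1 - \<kappa> / 2 \<le> a"
  proof -
    have eq: "gauss v * (1 + lr v / 2) = (1 - \<kappa> / 2) * gauss v + 1/2 * (gauss v * trace_lin (\<lambda>u. \<Phi>' v u - u))
        - 1/2 * (gauss v * (v \<bullet> b v))" for v
      by (simp add: lr_def field_simps)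
    have "(LINT v|lborel. gauss v * (1 + lr v / 2)) = 1 - \<kappa> / 2"
      unfolding eq using div integrable_gauss[where 'a='a] by (simp add: integral_gauss)
    moreover have "(LINT v|lborel. gauss v * (1 + lr v / 2)) \<le> a"
      unfolding a_def
    proof (rule integral_mono)
      show "integrable lborel (\<lambda>v. gauss v * (1 + lr v / 2))"
        unfolding eq using div integrable_gauss[where 'a='a] by auto
      fix v
      have "gauss v * (1 + lr v / 2) \<le> gauss v * exp (lr v / 2)"
        by (intro mult_left_mono exp_ge_add_one_self) auto
      also have "\<dots> = sqrt (gauss v) * sqrt (gauss v * exp (lr v))"
      proof -
        have "sqrt (exp (lr v)) = exp (lr v / 2)"
          by (rule real_sqrt_unique) (simp_all flip: exp_of_nat_mult exp_double)
        then show ?thesis by (simp add: real_sqrt_mult mult.assoc[symmetric])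
      qed
      also have "\<dots> \<le> sqrt (gauss v) * sqrt (\<rho> v)"
        by (intro mult_left_mono real_sqrt_le_mono ratio) auto
      finally show "gauss v * (1 + lr v / 2) \<le> sqrt (gauss v) * sqrt (\<rho> v)" .
    qed (rule sq_int)
    ultimately show ?thesis by simp
  qed
  \<comment> \<open>This minimizes \<open>s * (\<kappa> / 2) + 2 / s\<close>; the minimum is
    \<open>2 * sqrt \<kappa>\<close>.\<close>
  define s where "s = 2 / sqrt \<kappa>"
  have s: "s > 0" using \<kappa> by (simp add: s_def)
  have L1: "\<bar>gauss v - \<rho> v\<bar> \<le> (s + 1/s) / 2 * (gauss v + \<rho> v) + (1/s - s) * (sqrt (gauss v) * sqrt (\<rho> v))" for v
  proof -
    have "gauss v = (sqrt (gauss v))\<^sup>2" "\<rho> v = (sqrt (\<rho> v))\<^sup>2" using \<rho>0[of v] by simp_all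
    then show ?thesis
      using abs_diff_squares_le[OF s, of "sqrt (gauss v)" "sqrt (\<rho> v)"] \<rho>0[of v] by simp
  qed
  have "(LINT v|lborel. \<bar>gauss v - \<rho> v\<bar>)
      \<le> (LINT v|lborel. (s + 1/s) / 2 * (gauss v + \<rho> v) + (1/s - s) * (sqrt (gauss v) * sqrt (\<rho> v)))"
    using \<rho> integrable_gauss sq_int L1
    by (intro integral_mono Bochner_Integration.integrable_add integrable_mult_right integrable_abs
        Bochner_Integration.integrable_diff) auto
  also have "\<dots> = (s + 1/s) + (1/s - s) * a"
    using \<rho> integrable_gauss[where 'a='a] sq_int by (simp add: integral_gauss a_def)
  also have "\<dots> = s * (1 - a) + (1 + a) / s" by (simp add: algebra_simps add_divide_distrib)
  also have "\<dots> \<le> s * (\<kappa> / 2) + 2 / s"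
  proof -
    have "a \<le> (LINT v|lborel. 1/2 * (gauss v + \<rho> v))"
      unfolding a_def
    proof (rule integral_mono[OF sq_int])
      show "integrable lborel (\<lambda>v. 1/2 * (gauss v + \<rho> v))" using \<rho> integrable_gauss by auto
      fix v show "sqrt (gauss v) * sqrt (\<rho> v) \<le> 1/2 * (gauss v + \<rho> v)"
        using sum_squares_bound[of "sqrt (gauss v)" "sqrt (\<rho> v)"] \<rho>0[of v] by simp
    qed
    also have "\<dots> = 1" using \<rho> integrable_gauss[where 'a='a] by (simp add: integral_gauss)
    finally have "a \<le> 1" .
    then show ?thesis using a s by (intro add_mono mult_left_mono divide_right_mono) auto
  qed
  also have "\<dots> = 2 * sqrt \<kappa>"
  proof -
    have "\<kappa> = sqrt \<kappa> * sqrt \<kappa>" using \<kappa> by simp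
    then show ?thesis using \<kappa> by (simp add: s_def field_simps)
  qed
  finally have TV: "(LINT v|lborel. \<bar>gauss v - \<rho> v\<bar>) \<le> 2 * sqrt \<kappa>" .
  \<comment> \<open>Both densities have mass 1, so \<open>k\<close> may be centred at
    \<open>1/2\<close>; this saves a factor 2 over the use of \<open>k \<le> 1\<close>.\<close>
  have "(LINT v|lborel. gauss v * k (\<Phi> v)) - (LINT v|lborel. gauss v * k v)
      = (LINT v|lborel. (gauss v - \<rho> v) * k (\<Phi> v)) - 1/2 * (LINT v|lborel. gauss v - \<rho> v)"
    using gk \<rho>k \<rho> integrable_gauss[where 'a='a] by (simp add: left_diff_distrib integral_gauss)
  also have "\<dots> = (LINT v|lborel. (gauss v - \<rho> v) * (k (\<Phi> v) - 1/2))"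
    using gk \<rho>k \<rho> integrable_gauss[where 'a='a] by (simp add: algebra_simps)
  finally have "\<bar>(LINT v|lborel. gauss v * k (\<Phi> v)) - (LINT v|lborel. gauss v * k v)\<bar>
      \<le> (LINT v|lborel. \<bar>(gauss v - \<rho> v) * (k (\<Phi> v) - 1/2)\<bar>)"
    using integral_abs_bound[of lborel "\<lambda>v. (gauss v - \<rho> v) * (k (\<Phi> v) - 1/2)"] by simp
  also have "\<dots> \<le> (LINT v|lborel. 1/2 * \<bar>gauss v - \<rho> v\<bar>)"
  proof (rule integral_mono)
    show "integrable lborel (\<lambda>v. \<bar>(gauss v - \<rho> v) * (k (\<Phi> v) - 1/2)\<bar>)"
    proof (rule integrable_abs)
      have "integrable lborel (\<lambda>v. gauss v * k (\<Phi> v) - \<rho> v * k (\<Phi> v) - 1/2 * (gauss v - \<rho> v))"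
        using gk \<rho>k \<rho> integrable_gauss[where 'a='a] by auto
      then show "integrable lborel (\<lambda>v. (gauss v - \<rho> v) * (k (\<Phi> v) - 1/2))"
        by (simp add: algebra_simps)
    qed
    show "integrable lborel (\<lambda>v. 1/2 * \<bar>gauss v - \<rho> v\<bar>)"
      using \<rho> integrable_gauss
      by (intro integrable_mult_right integrable_abs Bochner_Integration.integrable_diff)
    fix v
    have "\<bar>k (\<Phi> v) - 1/2\<bar> \<le> 1/2" using k01[of "\<Phi> v"] by (auto simp: abs_if)
    from mult_left_mono[OF this abs_ge_zero[of "gauss v - \<rho> v"]]
    show "\<bar>(gauss v - \<rho> v) * (k (\<Phi> v) - 1/2)\<bar> \<le> 1/2 * \<bar>gauss v - \<rho> v\<bar>"
      by (simp add: abs_mult)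
  qed
  also have "\<dots> \<le> sqrt \<kappa>" using TV by simp
  finally show ?thesis by (simp add: \<kappa>_def)
qed

subsection \<open>One-step regularization\<close>

locale verlet_mean_field = mean_field dV dW HV HW \<epsilon> L Lt LH LHt
  for dV dW :: "real ^ 'k \<Rightarrow> real ^ 'k" and HV HW :: "real ^ 'k \<Rightarrow> real ^ 'k \<Rightarrow> real ^ 'k"
    and \<epsilon> L Lt LH LHt :: real +
  fixes h T :: real and N :: nat
  assumes h: "0 < h" and T: "0 < T" and T_eq: "T = real N * h" and LamT: "\<Lambda> * T\<^sup>2 \<le> 1/6"
begin

abbreviation q :: "real ^ 'k ^ 'n \<Rightarrow> real ^ 'k ^ 'n \<Rightarrow> nat \<Rightarrow> real ^ 'k ^ 'n" where
  "q x v j \<equiv> vpos F h x v j"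

definition Q :: "real ^ 'k ^ 'n \<Rightarrow> real ^ 'k ^ 'n \<Rightarrow> nat \<Rightarrow> real ^ 'k ^ 'n \<Rightarrow> real ^ 'k ^ 'n" where
  "Q x v j = frechet_derivative (\<lambda>v. q x v j) (at v)"

lemma time_le: "j \<le> N \<Longrightarrow> real j * h \<le> T"
  using h by (simp add: T_eq)

lemma time_power2_le: "j \<le> N \<Longrightarrow> (real j * h)\<^sup>2 \<le> T\<^sup>2"
  using time_le h by (intro power_mono) auto

text \<open>The velocity enters the closed form through free flight and through earlier positions,
  so strong induction applies and yields the linearized recursion for \<open>Q\<close>.\<close>

lemma q_has_derivative: "((\<lambda>v. q x v j) has_derivative Q x v j) (at v)"
  and Q_closed: "Q x v j u = (real j * h) *\<^sub>R u - (\<Sum>i<j. wt h j i *\<^sub>R HF (q x v i) (Q x v i u))"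
proof -
  have "((\<lambda>v. q x v j) has_derivative Q x v j) (at v) \<and>
      Q x v j = (\<lambda>u. (real j * h) *\<^sub>R u - (\<Sum>i<j. wt h j i *\<^sub>R HF (q x v i) (Q x v i u)))"
  proof (induction j rule: less_induct)
    case (less j)
    have "((\<lambda>v. x + (real j * h) *\<^sub>R v - (\<Sum>i<j. wt h j i *\<^sub>R F (q x v i))) has_derivative
        (\<lambda>u. 0 + (real j * h) *\<^sub>R u - (\<Sum>i<j. wt h j i *\<^sub>R HF (q x v i) (Q x v i u)))) (at v)"
    proof (intro has_derivative_diff has_derivative_add has_derivative_sum has_derivative_const
        has_derivative_scaleR_right has_derivative_ident)
      fix i assume "i \<in> {..<j}"
      then have "i < j" by simp
      then have "((\<lambda>v. q x v i) has_derivative Q x v i) (at v)" by (rule less.IH[THEN conjunct1])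
      then show "((\<lambda>v. F (q x v i)) has_derivative (\<lambda>u. HF (q x v i) (Q x v i u))) (at v)"
        by (rule has_derivative_compose[OF _ F_has_derivative])
    qed
    then have d: "((\<lambda>v. q x v j) has_derivative
        (\<lambda>u. (real j * h) *\<^sub>R u - (\<Sum>i<j. wt h j i *\<^sub>R HF (q x v i) (Q x v i u)))) (at v)"
      by (simp flip: vpos_closed)
    then have "Q x v j = (\<lambda>u. (real j * h) *\<^sub>R u - (\<Sum>i<j. wt h j i *\<^sub>R HF (q x v i) (Q x v i u)))"
      unfolding Q_def by (rule frechet_derivative_at[symmetric])
    with d show ?case by simp
  qed
  then show "((\<lambda>v. q x v j) has_derivative Q x v j) (at v)"
    "Q x v j u = (real j * h) *\<^sub>R u - (\<Sum>i<j. wt h j i *\<^sub>R HF (q x v i) (Q x v i u))"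
    by (blast, metis)
qed

lemma linear_Q: "linear (Q x v j)"
  using q_has_derivative has_derivative_linear by blast

lemma norm_Q_le:
  assumes "j \<le> N"
  shows "norm (Q x v j u) \<le> 12/11 * (T * norm u)"
proof (rule volterra_bound[where a = "\<lambda>j. norm (Q x v j u)" and \<Lambda> = \<Lambda> and h = h and N = N])
  fix j assume j: "j \<le> N"
  have "norm (Q x v j u) \<le> norm ((real j * h) *\<^sub>R u) + norm (\<Sum>i<j. wt h j i *\<^sub>R HF (q x v i) (Q x v i u))"
    unfolding Q_closed[of x v j u] by (rule norm_triangle_ineq4)
  also have "\<dots> \<le> T * norm u + \<Lambda> * (\<Sum>i<j. wt h j i * norm (Q x v i u))"
    using time_le[OF j] h by (intro add_mono seminorm_wt_sum_le'[OF seminorm_norm] HF_le) (auto intro: mult_right_mono)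
  finally show "norm (Q x v j u) \<le> T * norm u + \<Lambda> * (\<Sum>i<j. wt h j i * norm (Q x v i u))" .
qed (use assms LamT Lam_nonneg T h in \<open>auto simp: T_eq\<close>)

text \<open>The kernel mass \<open>T\<^sup>2 / 2\<close>, the growth factor \<open>12/11\<close> and
  \<open>\<Lambda> * T\<^sup>2 \<le> 1/6\<close> combine to \<open>1/11\<close>, the share of free
  flight that the forces can change over the full duration.\<close>

lemma Lam_half: "0 \<le> D \<Longrightarrow> T\<^sup>2 / 2 * (\<Lambda> * (12/11 * D)) \<le> D / 11"
  using mult_right_mono[OF LamT, of "6/11 * D"] by (simp add: algebra_simps)

lemma norm_Q_minus_le: "norm (Q x v N u - T *\<^sub>R u) \<le> T / 11 * norm u"
proof -
  have "Q x v N u - T *\<^sub>R u = - (\<Sum>i<N. wt h N i *\<^sub>R HF (q x v i) (Q x v i u))"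
    by (subst Q_closed) (simp add: T_eq)
  also have "norm \<dots> \<le> (real N * h)\<^sup>2 / 2 * (\<Lambda> * (12/11 * (T * norm u)))"
    unfolding norm_minus_cancel
  proof (rule seminorm_wt_sum_le[OF seminorm_norm])
    fix i assume "i < N"
    then have "\<Lambda> * norm (Q x v i u) \<le> \<Lambda> * (12/11 * (T * norm u))"
      using Lam_nonneg by (intro mult_left_mono norm_Q_le) auto
    then show "norm (HF (q x v i) (Q x v i u)) \<le> \<Lambda> * (12/11 * (T * norm u))"
      using HF_le order_trans by blast
  qed
  also have "\<dots> \<le> (T * norm u) / 11"
    using Lam_half[of "T * norm u"] T by (simp add: T_eq)
  finally show ?thesis by simp
qed

lemma norm_Q_ge: "10/11 * T * norm u \<le> norm (Q x v N u)"
  using norm_Q_minus_le[of x v u] norm_triangle_ineq2[of "T *\<^sub>R u" "T *\<^sub>R u - Q x v N u"] T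
  by (simp add: norm_minus_commute)

lemma bij_Q: "bij (Q x v N)"
proof -
  have "inj (Q x v N)"
  proof (rule injI)
    fix u w assume "Q x v N u = Q x v N w"
    then have "Q x v N (u - w) = 0" by (simp add: linear_diff[OF linear_Q])
    then show "u = w" using norm_Q_ge[of "u - w" x v] T by (simp add: mult_le_0_iff)
  qed
  then show ?thesis
    using linear_injective_imp_surjective[OF linear_Q] by (simp add: bij_def)
qed

definition Qi :: "real ^ 'k ^ 'n \<Rightarrow> real ^ 'k ^ 'n \<Rightarrow> real ^ 'k ^ 'n \<Rightarrow> real ^ 'k ^ 'n" where
  "Qi x v = inv (Q x v N)"

lemma Q_Qi [simp]: "Q x v N (Qi x v u) = u" and Qi_Q [simp]: "Qi x v (Q x v N u) = u"
  using bij_Q[of x v] by (simp_all add: Qi_def bij_is_surj surj_f_inv_f bij_is_inj inv_f_f)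

lemma linear_Qi: "linear (Qi x v)"
proof -
  obtain g where g: "linear g" "\<And>u. g (Q x v N u) = u"
    using linear_injective_isomorphism[OF linear_Q bij_is_inj[OF bij_Q], of x v] by blast
  have "Qi x v u = g u" for u using g(2)[of "Qi x v u"] by simp
  then have "Qi x v = g" by blast
  with g show ?thesis by simp
qed

lemma norm_Qi_le: "norm (Qi x v u) \<le> 11/10 / T * norm u"
  using norm_Q_ge[of "Qi x v u" x v] T by (simp add: field_simps)

lemma q_diff_same_start: "norm (q x v N - q x w N - T *\<^sub>R (v - w)) \<le> T / 11 * norm (v - w)"
proof -
  have "norm (q x v N - q x w N - ((x - x) + (real N * h) *\<^sub>R (v - w)))
      \<le> (real N * h)\<^sup>2 / 2 * (\<Lambda> * (12/11 * (T * norm (v - w))))"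
  proof (rule vpos_diff_bounds(2)[OF seminorm_norm F_lip Lam_nonneg])
    fix j assume "j \<le> N"
    then show "norm ((x - x) + (real j * h) *\<^sub>R (v - w)) \<le> T * norm (v - w)"
      using time_le h by (auto intro: mult_right_mono)
  qed (use LamT h in \<open>auto simp: T_eq\<close>)
  also have "\<dots> \<le> (T * norm (v - w)) / 11"
    using Lam_half[of "T * norm (v - w)"] T by (simp add: T_eq)
  finally show ?thesis by (simp add: T_eq)
qed

lemma q_expansive: "10/11 * T * norm (v - w) \<le> norm (q x v N - q x w N)"
  using q_diff_same_start[of x v w] norm_triangle_ineq2[of "T *\<^sub>R (v - w)" "T *\<^sub>R (v - w) - (q x v N - q x w N)"] T
  by (simp add: norm_minus_commute)

text \<open>Up to an error with Lipschitz constant \<open>T / 11\<close> the map is multiplication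
  by \<open>T\<close>. So it is injective, and solving for \<open>v\<close> is a fixed point problem
  with contraction factor \<open>1/11\<close>.\<close>

lemma bij_q: "bij (\<lambda>v. q x v N)"
proof (rule bijI)
  show "inj (\<lambda>v. q x v N)"
  proof (rule injI)
    fix v w assume "q x v N = q x w N"
    then show "v = w" using q_expansive[of v w x] T by (simp add: mult_le_0_iff)
  qed
  have "\<exists>v. q x v N = u" for u
  proof -
    have "\<exists>!v. v + (1/T) *\<^sub>R (u - q x v N) = v"
    proof (rule banach_fix_type[where c = "1/11"])
      show "\<forall>v w. dist (v + (1/T) *\<^sub>R (u - q x v N)) (w + (1/T) *\<^sub>R (u - q x w N)) \<le> 1/11 * dist v w"
      proof (intro allI)
        fix v w
        have eq: "(v + (1/T) *\<^sub>R (u - q x v N)) - (w + (1/T) *\<^sub>R (u - q x w N))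
            = - ((1/T) *\<^sub>R (q x v N - q x w N - T *\<^sub>R (v - w)))"
          using T by (simp add: algebra_simps)
        show "dist (v + (1/T) *\<^sub>R (u - q x v N)) (w + (1/T) *\<^sub>R (u - q x w N)) \<le> 1/11 * dist v w"
          unfolding dist_norm eq norm_minus_cancel norm_scaleR
          using mult_left_mono[OF q_diff_same_start[of x v w], of "1/T"] T by simp
      qed
    qed auto
    then obtain v where "v + (1/T) *\<^sub>R (u - q x v N) = v" by blast
    then show ?thesis using T by auto
  qed
  then show "surj (\<lambda>v. q x v N)" by (metis surjI)
qed

section \<open>The velocity transport between two starting points\<close>

context
  fixes x y :: "real ^ 'k ^ 'n"
begin

definition \<Phi> :: "real ^ 'k ^ 'n \<Rightarrow> real ^ 'k ^ 'n" where
  "\<Phi> v = inv (\<lambda>v. q y v N) (q x v N)"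

lemma q_Phi: "q y (\<Phi> v) N = q x v N"
  unfolding \<Phi>_def using surj_f_inv_f[OF bij_is_surj[OF bij_q[of y]], of "q x v N"] by simp

lemma bij_Phi: "bij \<Phi>"
proof -
  have "\<Phi> = inv (\<lambda>v. q y v N) \<circ> (\<lambda>v. q x v N)" by (auto simp: \<Phi>_def)
  moreover have "bij (inv (\<lambda>v. q y v N) \<circ> (\<lambda>v. q x v N))"
    by (rule bij_comp[OF bij_q bij_imp_bij_inv[OF bij_q]])
  ultimately show ?thesis by simp
qed

text \<open>By \<open>q_expansive\<close> the inverse of the map starting at \<open>y\<close> is
  Lipschitz, hence continuous, as the inverse function rule demands.\<close>

lemma Phi_has_derivative: "(\<Phi> has_derivative (\<lambda>u. Qi y (\<Phi> v) (Q x v N u))) (at v)"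
proof -
  let ?g = "inv (\<lambda>v. q y v N)"
  have gq: "q y (?g z) N = z" for z
    using surj_f_inv_f[OF bij_is_surj[OF bij_q[of y]], of z] by simp
  have lip: "norm (?g z - ?g z') \<le> 11/10 / T * norm (z - z')" for z z'
    using q_expansive[of "?g z" "?g z'" y] T by (simp add: gq field_simps)
  have cont: "continuous (at z) ?g" for z
    unfolding continuous_at_eps_delta
  proof (intro allI impI)
    fix e :: real assume "e > 0"
    show "\<exists>d>0. \<forall>z'. dist z' z < d \<longrightarrow> dist (?g z') (?g z) < e"
    proof (intro exI[of _ "e * (10/11) * T"] conjI allI impI)
      show "0 < e * (10/11) * T" using \<open>e > 0\<close> T by simp
      fix z' assume "dist z' z < e * (10/11) * T"
      then have "11/10 / T * norm (z' - z) < e" using T by (simp add: dist_norm field_simps)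
      then show "dist (?g z') (?g z) < e" unfolding dist_norm using lip[of z' z] by linarith
    qed
  qed
  have "(?g has_derivative Qi y (?g (q x v N))) (at (q x v N))"
  proof (rule has_derivative_inverse_basic[where f = "\<lambda>v. q y v N" and T = UNIV])
    show "((\<lambda>v. q y v N) has_derivative Q y (?g (q x v N)) N) (at (?g (q x v N)))"
      by (rule q_has_derivative)
    show "bounded_linear (Qi y (?g (q x v N)))"
      using linear_Qi by (simp add: linear_conv_bounded_linear)
    show "Qi y (?g (q x v N)) \<circ> Q y (?g (q x v N)) N = id" by auto
  qed (use cont gq in auto)
  from has_derivative_compose[OF q_has_derivative this]
  show ?thesis by (simp add: \<Phi>_def[abs_def])
qed

text \<open>The final positions agree, so \<open>T *\<^sub>R (v - \<Phi> v)\<close> cancels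
  \<open>x - y\<close> up to one eleventh of the free-flight bound; solving
  \<open>t \<le> (z + t) / 11 + z\<close> gives \<open>6/5\<close>. Then
  \<open>12/5 = 12/11 * (1 + 6/5)\<close>.\<close>

lemma Phi_shift: "norm1 (v - \<Phi> v) \<le> 6/5 / T * norm1 (x - y)"
  and q_Phi_dist: "j \<le> N \<Longrightarrow> norm1 (q x v j - q y (\<Phi> v) j) \<le> 12/5 * norm1 (x - y)"
proof -
  note p = seminorm_norm1
  let ?d = "v - \<Phi> v" and ?z = "x - y"
  let ?D = "norm1 ?z + T * norm1 ?d"
  have D: "norm1 (?z + (real j * h) *\<^sub>R ?d) \<le> ?D" if "j \<le> N" for j
  proof -
    have "norm1 ((real j * h) *\<^sub>R ?d) \<le> T * norm1 ?d"
      unfolding seminorm_scale[OF p] using time_le[OF that] h by (intro mult_right_mono) auto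
    then show ?thesis using seminorm_add[OF p, of ?z "(real j * h) *\<^sub>R ?d"] by linarith
  qed
  note bounds = vpos_diff_bounds[OF p F_norm1_lip Lam_nonneg _ _ D]
  have LT: "\<Lambda> * (real N * h)\<^sup>2 \<le> 1/6" using LamT by (simp add: T_eq)
  have "norm1 (q x v N - q y (\<Phi> v) N - (?z + (real N * h) *\<^sub>R ?d)) \<le> (real N * h)\<^sup>2 / 2 * (\<Lambda> * (12/11 * ?D))"
    using bounds(2)[OF LT] h by simp
  also have "\<dots> \<le> ?D / 11" using Lam_half[of ?D] T by (simp add: T_eq)
  finally have "norm1 (?z + T *\<^sub>R ?d) \<le> ?D / 11"
    using seminorm_minus[OF p, of "?z + T *\<^sub>R ?d"] by (simp add: q_Phi T_eq)
  moreover have "T * norm1 ?d \<le> norm1 (?z + T *\<^sub>R ?d) + norm1 ?z"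
    using seminorm_add[OF p, of "?z + T *\<^sub>R ?d" "- ?z"] seminorm_minus[OF p, of ?z] seminorm_scale[OF p, of T ?d] T
    by simp
  moreover have "t \<le> 6/5 * z" if "a \<le> (z + t) / 11" "t \<le> a + z" for a z t :: real
    using that by (simp add: field_simps)
  ultimately have Td: "T * norm1 ?d \<le> 6/5 * norm1 ?z" by blast
  then show "norm1 ?d \<le> 6/5 / T * norm1 ?z" using T by (simp add: field_simps)
  show "norm1 (q x v j - q y (\<Phi> v) j) \<le> 12/5 * norm1 ?z" if "j \<le> N"
  proof -
    have "norm1 (q x v j - q y (\<Phi> v) j) \<le> 12/11 * ?D"
      using bounds(1)[OF LT] h that by simp
    with Td show ?thesis by (simp add: algebra_simps)
  qed
qed

text \<open>The Volterra bound for the Frobenius norm of a difference of derivatives. The change of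
  the Hessian between the two trajectories, \<open>?A\<close>, is the source, and \<open>?B\<close>
  is the feedback of earlier differences. The constants multiply to
  \<open>12/11 * 12/11 * 6/5 < 3/2\<close>.\<close>

lemma frob_Q_diff_le:
  "frob (\<lambda>u. Q y (\<Phi> v) N u - Q x v N u) \<le> 3/2 * T ^ 3 * (sqrt (real CARD('k)) * (LH + 8 * \<epsilon> * LHt) * norm1 (x - y))"
proof -
  define \<kappa> where "\<kappa> = sqrt (real CARD('k)) * (LH + 8 * \<epsilon> * LHt)"
  define n where "n = norm1 (x - y)"
  have \<kappa>: "0 \<le> \<kappa>" using eps Lnn by (simp add: \<kappa>_def)
  have n: "0 \<le> n" by (simp add: n_def)
  let ?w = "\<Phi> v"
  let ?a = "\<lambda>j. frob (\<lambda>u. Q y ?w j u - Q x v j u)"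
  let ?E = "12/11 * T * (\<kappa> * (12/5 * n))"
  let ?D = "T\<^sup>2 / 2 * ?E"
  have E: "0 \<le> ?E" using T \<kappa> n by simp
  have step: "?a j \<le> ?D + \<Lambda> * (\<Sum>i<j. wt h j i * ?a i)" if j: "j \<le> N" for j
  proof -
    let ?A = "\<lambda>i u. HF (q y ?w i) (Q x v i u) - HF (q x v i) (Q x v i u)"
    let ?B = "\<lambda>i u. HF (q y ?w i) (Q y ?w i u - Q x v i u)"
    have eq: "(\<lambda>u. Q y ?w j u - Q x v j u) = (\<lambda>u. - (\<Sum>i<j. wt h j i *\<^sub>R (?A i u + ?B i u)))"
    proof
      fix u
      have "Q y ?w j u - Q x v j u = - ((\<Sum>i<j. wt h j i *\<^sub>R HF (q y ?w i) (Q y ?w i u)) - (\<Sum>i<j. wt h j i *\<^sub>R HF (q x v i) (Q x v i u)))"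
        by (subst (1 2) Q_closed) simp
      also have "(\<Sum>i<j. wt h j i *\<^sub>R HF (q y ?w i) (Q y ?w i u)) - (\<Sum>i<j. wt h j i *\<^sub>R HF (q x v i) (Q x v i u))
          = (\<Sum>i<j. wt h j i *\<^sub>R (?A i u + ?B i u))"
        unfolding sum_subtractf[symmetric]
        by (intro sum.cong refl) (simp add: linear_diff[OF linear_HF] scaleR_diff_right)
      finally show "Q y ?w j u - Q x v j u = - (\<Sum>i<j. wt h j i *\<^sub>R (?A i u + ?B i u))" .
    qed
    have "?a j \<le> (\<Sum>i<j. frob (\<lambda>u. wt h j i *\<^sub>R (?A i u + ?B i u)))"
      unfolding eq frob_minus by (rule frob_sum_le)
    also have "\<dots> \<le> (\<Sum>i<j. wt h j i * (?E + \<Lambda> * ?a i))"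
    proof (rule sum_mono)
      fix i assume "i \<in> {..<j}"
      then have i: "i < j" "i \<le> N" using j by auto
      have "frob (?A i) \<le> (12/11 * T) * frob (\<lambda>u. HF (q y ?w i) u - HF (q x v i) u)"
        using norm_Q_le[OF i(2)] T linear_compose_sub[OF linear_HF linear_HF]
        by (intro frob_comp_right_le[where A = "\<lambda>u. HF (q y ?w i) u - HF (q x v i) u"] linear_Q) (auto simp: mult.assoc)
      also have "\<dots> \<le> (12/11 * T) * (\<kappa> * norm1 (q y ?w i - q x v i))"
        using T frob_HF_diff_le[of "q y ?w i" "q x v i"] by (intro mult_left_mono) (auto simp: \<kappa>_def)
      also have "norm1 (q y ?w i - q x v i) = norm1 (q x v i - q y ?w i)"
        using seminorm_minus[OF seminorm_norm1, of "q x v i - q y ?w i"] by simp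
      also have "(12/11 * T) * (\<kappa> * norm1 (q x v i - q y ?w i)) \<le> ?E"
        using T \<kappa> q_Phi_dist[OF i(2)] by (intro mult_left_mono) (auto simp: n_def)
      finally have A: "frob (?A i) \<le> ?E" .
      have "frob (?B i) \<le> \<Lambda> * ?a i"
        using HF_le Lam_nonneg by (rule frob_comp_left_le)
      with A have "frob (\<lambda>u. ?A i u + ?B i u) \<le> ?E + \<Lambda> * ?a i"
        using frob_add_le[of "?A i" "?B i"] by linarith
      then show "frob (\<lambda>u. wt h j i *\<^sub>R (?A i u + ?B i u)) \<le> wt h j i * (?E + \<Lambda> * ?a i)"
        unfolding frob_scale using wt_nonneg[OF i(1)] by (simp add: mult_left_mono)
    qed
    also have "\<dots> = (\<Sum>i<j. wt h j i) * ?E + \<Lambda> * (\<Sum>i<j. wt h j i * ?a i)"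
      by (simp only: distrib_left sum.distrib sum_distrib_right sum_distrib_left mult.left_commute[of _ \<Lambda>])
    also have "(\<Sum>i<j. wt h j i) * ?E \<le> ?D"
      unfolding sum_wt using time_power2_le[OF j] E by (intro mult_right_mono) auto
    finally show ?thesis by simp
  qed
  have D: "0 \<le> ?D" by (rule mult_nonneg_nonneg[OF _ E]) simp
  have "?a N \<le> 12/11 * ?D"
    using volterra_bound[OF step Lam_nonneg] LamT D h by (simp add: T_eq)
  also have "\<dots> = (12/11 * 12/11 * 6/5) * (T ^ 3 * (\<kappa> * n))"
    by (simp add: power2_eq_square power3_eq_cube)
  also have "\<dots> \<le> 3/2 * (T ^ 3 * (\<kappa> * n))"
    using T \<kappa> n by (intro mult_right_mono) auto
  finally show ?thesis by (simp add: \<kappa>_def n_def)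
qed

end

theorem uhmc_one_step_total_variation:
  fixes x y :: "real ^ 'k ^ 'n" and g :: "real ^ 'k ^ 'n \<Rightarrow> real"
  assumes [measurable]: "g \<in> borel_measurable borel" and g01: "\<And>v. 0 \<le> g v" "\<And>v. g v \<le> 1"
  shows "\<bar>(LINT v|lborel. gauss v * g (q x v N)) - (LINT v|lborel. gauss v * g (q y v N))\<bar>
    \<le> sqrt (1 / T\<^sup>2 + 34 * real CARD('k) * (LH + 8 * \<epsilon> * LHt)\<^sup>2 * T ^ 4) * norm1 (x - y)"
proof (cases "x = y")
  case True
  then show ?thesis by simp
next
  case False
  define n where "n = norm1 (x - y)"
  have "norm (x - y) > 0" using False by simp
  then have n: "0 < n" unfolding n_def using norm_le_norm1[of "x - y"] by linarith
  define \<kappa> where "\<kappa> = sqrt (real CARD('k)) * (LH + 8 * \<epsilon> * LHt)"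
  have \<kappa>: "0 \<le> \<kappa>" using eps Lnn by (simp add: \<kappa>_def)
  let ?\<Phi> = "\<Phi> x y"
  \<comment> \<open>The inverse of the derivative of \<open>?\<Phi>\<close> at \<open>v\<close>. It
    differs from the identity by \<open>Qi x v\<close> applied to a difference of two maps
    \<open>Q\<close>, whence \<open>33/20 = 11/10 * 3/2\<close> in \<open>?\<theta>\<close>.\<close>
  let ?B = "\<lambda>v u. Qi x v (Q y (?\<Phi> v) N u)"
  let ?\<beta> = "6/5 / T * n" and ?\<theta> = "33/20 * T\<^sup>2 * (\<kappa> * n)"
  have [measurable]: "(\<lambda>v. q y v N) \<in> borel_measurable borel"
    using q_has_derivative by (rule borel_measurable_if_has_derivative)
  have "\<bar>(LINT v|lborel. gauss v * g (q y (?\<Phi> v) N)) - (LINT v|lborel. gauss v * g (q y v N))\<bar>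
      \<le> sqrt (?\<beta>\<^sup>2 / 2 + (1/2 + 6/5) * ?\<theta>\<^sup>2)"
  proof (rule gauss_transport_total_variation[OF Phi_has_derivative bij_Phi, where B = ?B])
    show "linear (?B v)" for v
      using linear_compose[OF linear_Q linear_Qi] by (simp add: o_def)
    show "norm (?\<Phi> v - v) \<le> ?\<beta>" for v
      using norm_le_norm1[of "v - ?\<Phi> v"] Phi_shift[of v x y] by (simp add: norm_minus_commute n_def)
    show "0 < ?\<beta>" using n T by simp
    show "norm (Qi y (?\<Phi> v) (Q x v N u)) \<le> 6/5 * norm u" for v u
    proof -
      have "norm (Qi y (?\<Phi> v) (Q x v N u)) \<le> 11/10 / T * norm (Q x v N u)" by (rule norm_Qi_le)
      also have "\<dots> \<le> 11/10 / T * (12/11 * (T * norm u))"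
        using T by (intro mult_left_mono norm_Q_le) auto
      also have "\<dots> = 6/5 * norm u" using T by simp
      finally show ?thesis .
    qed
    show "frob (\<lambda>u. ?B v u - u) \<le> ?\<theta>" for v
    proof -
      have "(\<lambda>u. ?B v u - u) = (\<lambda>u. Qi x v (Q y (?\<Phi> v) N u - Q x v N u))"
        by (simp add: linear_diff[OF linear_Qi])
      then have "frob (\<lambda>u. ?B v u - u) \<le> 11/10 / T * frob (\<lambda>u. Q y (?\<Phi> v) N u - Q x v N u)"
        using frob_comp_left_le[OF norm_Qi_le] T by simp
      also have "\<dots> \<le> 11/10 / T * (3/2 * T ^ 3 * (\<kappa> * n))"
        using frob_Q_diff_le[of y x v] T by (intro mult_left_mono) (auto simp: \<kappa>_def n_def)
      also have "\<dots> = ?\<theta>" using T by (simp add: power2_eq_square power3_eq_cube)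
      finally show ?thesis .
    qed
  qed (use g01 in \<open>auto\<close>)
  also have "\<dots> \<le> sqrt ((1 / T\<^sup>2 + 34 * \<kappa>\<^sup>2 * T ^ 4) * n\<^sup>2)"
  proof (rule real_sqrt_le_mono)
    \<comment> \<open>The computed constants are \<open>18/25\<close> and
      \<open>17/10 * (33/20)\<^sup>2\<close>, about 4.63; they stay below the 1 and the 34 of the
      statement.\<close>
    have 1: "?\<beta>\<^sup>2 / 2 = 18/25 * (n\<^sup>2 / T\<^sup>2)" by (simp add: power_mult_distrib power_divide)
    have "18/25 * (n\<^sup>2 / T\<^sup>2) \<le> 1 * (n\<^sup>2 / T\<^sup>2)" by (intro mult_right_mono) auto
    moreover have 2: "(1/2 + 6/5) * ?\<theta>\<^sup>2 = 17/10 * (33/20)\<^sup>2 * (\<kappa>\<^sup>2 * T ^ 4 * n\<^sup>2)"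
      by (simp add: power_mult_distrib power2_eq_square power4_eq_xxxx)
    have "17/10 * (33/20)\<^sup>2 * (\<kappa>\<^sup>2 * T ^ 4 * n\<^sup>2) \<le> 34 * (\<kappa>\<^sup>2 * T ^ 4 * n\<^sup>2)"
      by (intro mult_right_mono) (auto simp: power2_eq_square)
    ultimately have "?\<beta>\<^sup>2 / 2 + (1/2 + 6/5) * ?\<theta>\<^sup>2 \<le> 1 * (n\<^sup>2 / T\<^sup>2) + 34 * (\<kappa>\<^sup>2 * T ^ 4 * n\<^sup>2)"
      unfolding 1 2 by (rule add_mono)
    also have "\<dots> = (1 / T\<^sup>2 + 34 * \<kappa>\<^sup>2 * T ^ 4) * n\<^sup>2" by (simp add: algebra_simps)
    finally show "?\<beta>\<^sup>2 / 2 + (1/2 + 6/5) * ?\<theta>\<^sup>2 \<le> (1 / T\<^sup>2 + 34 * \<kappa>\<^sup>2 * T ^ 4) * n\<^sup>2" .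
  qed
  also have "\<dots> = sqrt (1 / T\<^sup>2 + 34 * \<kappa>\<^sup>2 * T ^ 4) * n"
    using n by (simp add: real_sqrt_mult)
  also have "\<kappa>\<^sup>2 = real CARD('k) * (LH + 8 * \<epsilon> * LHt)\<^sup>2"
    by (simp add: \<kappa>_def power_mult_distrib)
  finally show ?thesis by (simp add: q_Phi n_def mult.assoc)
qed

end

subsection \<open>Reflection coupling of Gaussians\<close>

lemma integrable_mult_bounded_dominated:
  fixes k p :: "'a::euclidean_space \<Rightarrow> real"
  assumes [measurable]: "k \<in> borel_measurable borel" "p \<in> borel_measurable borel"
    and kB: "\<And>v. \<bar>k v\<bar> \<le> B" and p: "\<And>v. 0 \<le> p v" "\<And>v. p v \<le> gauss v"
  shows "integrable lborel (\<lambda>v. p v * k v)"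
proof (rule Bochner_Integration.integrable_bound[of _ "\<lambda>v. B * gauss v"])
  show "AE v in lborel. norm (p v * k v) \<le> norm (B * gauss v)"
  proof (rule AE_I2)
    fix v :: 'a
    have "p v * \<bar>k v\<bar> \<le> gauss v * B" using p[of v] kB[of v] by (intro mult_mono) auto
    then show "norm (p v * k v) \<le> norm (B * gauss v)"
      using p[of v] order_trans[OF abs_ge_zero kB] by (simp add: abs_mult mult.commute)
  qed
qed (use integrable_gauss in auto)

lemma integrable_gauss_bounded:
  fixes k :: "'a::euclidean_space \<Rightarrow> real"
  assumes "k \<in> borel_measurable borel" "\<And>v. \<bar>k v\<bar> \<le> B"
  shows "integrable lborel (\<lambda>v. gauss v * k v)"
  using assms by (intro integrable_mult_bounded_dominated) auto

context
  fixes e :: "'a::euclidean_space" and \<omega> :: real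
  assumes e: "norm e = 1" and \<omega>: "0 \<le> \<omega>"
begin

definition refl_along :: "'a \<Rightarrow> 'a" where
  "refl_along v = v - (2 * (v \<bullet> e)) *\<^sub>R e"

text \<open>The common part of the Gaussian density and its translate. On this part the second
  velocity is \<open>v + \<omega> *\<^sub>R e\<close>.\<close>

definition overlap :: "'a \<Rightarrow> real" where
  "overlap v = min (gauss v) (gauss (v + \<omega> *\<^sub>R e))"

lemma inner_e_e: "e \<bullet> e = 1"
  using e by (simp add: norm_eq_1)

lemma refl_along_refl_along: "refl_along (refl_along v) = v"
  by (simp add: refl_along_def inner_diff_left inner_e_e algebra_simps)

lemma linear_refl_along: "linear refl_along"
  unfolding refl_along_def[abs_def] by (rule linearI) (simp_all add: inner_add_left algebra_simps)

lemma norm_refl_along: "norm (refl_along v) = norm v"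
  unfolding norm_eq_sqrt_inner by (simp add: refl_along_def inner_diff_left inner_diff_right inner_e_e inner_commute algebra_simps)

lemma bij_refl_along: "bij refl_along"
  by (rule o_bij[of refl_along]) (auto simp: fun_eq_iff refl_along_refl_along)

lemma measurable_refl_along [measurable]: "refl_along \<in> borel_measurable borel"
  unfolding refl_along_def[abs_def] by measurable

lemma measurable_overlap [measurable]: "overlap \<in> borel_measurable borel"
  unfolding overlap_def[abs_def] by measurable

lemma overlap_bounds: "0 \<le> overlap v" "overlap v \<le> gauss v" "overlap v \<le> gauss (v + \<omega> *\<^sub>R e)"
  by (auto simp: overlap_def)

lemma overlap_integrable: "integrable lborel overlap"
  by (rule Bochner_Integration.integrable_bound[OF integrable_gauss]) (use overlap_bounds in auto)

lemma gauss_shift: "gauss (v + t *\<^sub>R e) = gauss v * exp (- (t * (v \<bullet> e)) - t\<^sup>2 / 2)"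
proof -
  have "(norm (v + t *\<^sub>R e))\<^sup>2 = (norm v)\<^sup>2 + 2 * (t * (v \<bullet> e)) + t\<^sup>2"
    unfolding power2_norm_eq_inner
    by (simp add: inner_add_left inner_add_right inner_e_e inner_commute power2_eq_square)
  then have "exp (- (norm (v + t *\<^sub>R e))\<^sup>2 / 2) = exp (- (norm v)\<^sup>2 / 2) * exp (- (t * (v \<bullet> e)) - t\<^sup>2 / 2)"
    by (simp add: field_simps flip: exp_add)
  then show ?thesis by (simp add: gauss_def)
qed

text \<open>\<open>refl_along v - \<omega> *\<^sub>R e\<close> is the mirror image of
  \<open>v + \<omega> *\<^sub>R e\<close>, so reflection exchanges the two arguments of the
  minimum.\<close>

lemma overlap_refl_along: "gauss (refl_along v) - overlap (refl_along v - \<omega> *\<^sub>R e) = gauss v - overlap v"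
proof -
  have "refl_along v - \<omega> *\<^sub>R e = refl_along (v + \<omega> *\<^sub>R e)"
    by (simp add: refl_along_def inner_add_left inner_e_e algebra_simps flip: scaleR_2)
  then have "gauss (refl_along v - \<omega> *\<^sub>R e) = gauss (v + \<omega> *\<^sub>R e)"
    using norm_refl_along gauss_norm_cong by metis
  moreover have "gauss (refl_along v) = gauss v" using norm_refl_along gauss_norm_cong by metis
  ultimately show ?thesis by (simp add: overlap_def min.commute)
qed

text \<open>This is the second marginal of the reflection coupling, expressed by integrals. Shifting
  the overlap leaves the density \<open>gauss u - overlap (u - \<omega> *\<^sub>R e)\<close>, and
  reflection carries it to \<open>gauss - overlap\<close>.\<close>

lemma gauss_reflection_decomposition:
  assumes k[measurable]: "k \<in> borel_measurable borel" and kB: "\<And>v. \<bar>k v\<bar> \<le> B"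
  shows "(LINT v|lborel. gauss v * k v)
    = (LINT v|lborel. overlap v * k (v + \<omega> *\<^sub>R e)) + (LINT v|lborel. (gauss v - overlap v) * k (refl_along v))"
proof -
  let ?w = "\<omega> *\<^sub>R e"
  define H where "H u = (gauss u - overlap (u - ?w)) * k u" for u
  have gk: "integrable lborel (\<lambda>v. gauss v * k v)" by (rule integrable_gauss_bounded[OF k kB])
  have mk: "integrable lborel (\<lambda>v. overlap v * k (v + ?w))"
    using kB overlap_bounds by (intro integrable_mult_bounded_dominated) auto
  have Hv: "H v = gauss v * k v - (\<lambda>v. overlap v * k (v + ?w)) (v + (- ?w))" for v
    by (simp add: H_def left_diff_distrib)
  have intH: "integrable lborel H"
    unfolding Hv[abs_def] using gk lborel_integral_shift(1)[OF mk, of "- ?w"] by (intro Bochner_Integration.integrable_diff)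
  have "(LINT v|lborel. gauss v * k v) = (LINT v|lborel. overlap v * k (v + ?w)) + integral\<^sup>L lborel H"
    unfolding Hv[abs_def]
    using gk lborel_integral_shift[OF mk, of "- ?w"] by simp
  also have "integral\<^sup>L lborel H = (LINT v|lborel. H (refl_along v))"
    using lborel_integral_isometry(2)[OF linear_refl_along bij_refl_along norm_refl_along intH] by simp
  also have "\<dots> = (LINT v|lborel. (gauss v - overlap v) * k (refl_along v))"
    unfolding H_def overlap_refl_along ..
  finally show ?thesis .
qed

text \<open>Shifted back by half of \<open>\<omega> *\<^sub>R e\<close>, the minimum is symmetric
  and at least \<open>gauss v * exp (- \<omega> / 2 * \<bar>v \<bullet> e\<bar> - \<omega>\<^sup>2 /
  8)\<close>. The exponential is linearized, and the first absolute moment is at most 1.\<close>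

lemma overlap_defect: "1 - integral\<^sup>L lborel overlap \<le> \<omega> / 2 + \<omega>\<^sup>2 / 8"
proof -
  let ?w = "(\<omega> / 2) *\<^sub>R e"
  have m: "overlap (v + - ?w) \<ge> gauss v - \<omega>\<^sup>2 / 8 * gauss v - \<omega> / 2 * (gauss v * \<bar>v \<bullet> e\<bar>)" for v
  proof -
    let ?t = "- (\<omega> / 2 * \<bar>v \<bullet> e\<bar>) - (\<omega> / 2)\<^sup>2 / 2"
    have s: "v + - ?w + \<omega> *\<^sub>R e = v + (\<omega> / 2) *\<^sub>R e"
      by (simp add: algebra_simps flip: scaleR_add_left)
    have w: "- ?w = (- (\<omega> / 2)) *\<^sub>R e" by simp
    have ab: "\<omega> / 2 * (v \<bullet> e) \<le> \<omega> / 2 * \<bar>v \<bullet> e\<bar>" "\<omega> / 2 * - (v \<bullet> e) \<le> \<omega> / 2 * \<bar>v \<bullet> e\<bar>"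
      using \<omega> by (intro mult_left_mono; simp)+
    have 1: "gauss v * exp ?t \<le> gauss (v + (\<omega> / 2) *\<^sub>R e)"
      unfolding gauss_shift using ab by (intro mult_left_mono) auto
    have 2: "gauss v * exp ?t \<le> gauss (v + (- (\<omega> / 2)) *\<^sub>R e)"
      unfolding gauss_shift using ab by (intro mult_left_mono) auto
    have "gauss v * (1 + ?t) \<le> gauss v * exp ?t"
      by (intro mult_left_mono exp_ge_add_one_self) auto
    then have "gauss v * (1 + ?t) \<le> overlap (v + - ?w)"
      unfolding overlap_def s using 1 2 by simp
    moreover have "gauss v * (1 + ?t) = gauss v - \<omega>\<^sup>2 / 8 * gauss v - \<omega> / 2 * (gauss v * \<bar>v \<bullet> e\<bar>)"
      by (simp add: power2_eq_square field_simps)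
    ultimately show ?thesis by simp
  qed
  note i = integrable_gauss[where 'a='a] gauss_first_abs_moment(1)[OF e]
  have "1 - \<omega>\<^sup>2 / 8 - \<omega> / 2 \<le> 1 - \<omega>\<^sup>2 / 8 - \<omega> / 2 * (LINT v|lborel. gauss v * \<bar>v \<bullet> e\<bar>)"
    using gauss_first_abs_moment(2)[OF e] \<omega> by (simp add: mult_left_le)
  also have "\<dots> = (LINT v|lborel. gauss v - \<omega>\<^sup>2 / 8 * gauss v - \<omega> / 2 * (gauss v * \<bar>v \<bullet> e\<bar>))"
  proof -
    have "(LINT v|lborel. gauss v - a * gauss v - b * (gauss v * \<bar>v \<bullet> e\<bar>))
        = 1 - a - b * (LINT v|lborel. gauss v * \<bar>v \<bullet> e\<bar>)" for a b
      using i by (simp add: integral_gauss)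
    then show ?thesis by metis
  qed
  also have "\<dots> \<le> (LINT v|lborel. overlap (v + - ?w))"
    using i m lborel_integral_shift(1)[OF overlap_integrable]
    by (intro integral_mono Bochner_Integration.integrable_diff integrable_mult_right)
  also have "\<dots> = integral\<^sup>L lborel overlap" by (rule lborel_integral_shift(2)[OF overlap_integrable])
  finally show ?thesis by simp
qed

text \<open>A reflection changes the velocity by \<open>2 * \<bar>v \<bullet> e\<bar>\<close>, which
  is unbounded, so a small failure probability alone is not enough. The failure density is at most
  \<open>gauss v * (\<omega> * \<bar>v \<bullet> e\<bar> + \<omega>\<^sup>2 / 2)\<close>; one more
  factor \<open>\<bar>v \<bullet> e\<bar>\<close> leaves moments of order one and two.\<close>

lemma overlap_defect_moment:
  "integrable lborel (\<lambda>v. (gauss v - overlap v) * \<bar>v \<bullet> e\<bar>)"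
  "(LINT v|lborel. (gauss v - overlap v) * \<bar>v \<bullet> e\<bar>) \<le> \<omega> * (1 + \<omega> / 2)"
proof -
  note i = gauss_second_moment(1)[of e] gauss_first_abs_moment(1)[OF e]
  have le: "(gauss v - overlap v) * \<bar>v \<bullet> e\<bar> \<le> \<omega> * (gauss v * (v \<bullet> e)\<^sup>2) + \<omega>\<^sup>2 / 2 * (gauss v * \<bar>v \<bullet> e\<bar>)" for v
  proof -
    let ?t = "- (\<omega> * (v \<bullet> e)) - \<omega>\<^sup>2 / 2"
    have "gauss v - gauss (v + \<omega> *\<^sub>R e) \<le> gauss v * (- ?t)"
      unfolding gauss_shift using mult_left_mono[OF exp_ge_add_one_self[of ?t] gauss_nonneg[of v]]
      by (simp add: algebra_simps)
    also have "- ?t \<le> \<omega> * \<bar>v \<bullet> e\<bar> + \<omega>\<^sup>2 / 2"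
      using \<omega> by (simp add: mult_left_mono)
    finally have "gauss v - gauss (v + \<omega> *\<^sub>R e) \<le> gauss v * (\<omega> * \<bar>v \<bullet> e\<bar> + \<omega>\<^sup>2 / 2)"
      by (simp add: mult_left_mono)
    moreover have "0 \<le> gauss v * (\<omega> * \<bar>v \<bullet> e\<bar> + \<omega>\<^sup>2 / 2)" using \<omega> by simp
    ultimately have "gauss v - overlap v \<le> gauss v * (\<omega> * \<bar>v \<bullet> e\<bar> + \<omega>\<^sup>2 / 2)"
      unfolding overlap_def by linarith
    then have "(gauss v - overlap v) * \<bar>v \<bullet> e\<bar> \<le> gauss v * (\<omega> * \<bar>v \<bullet> e\<bar> + \<omega>\<^sup>2 / 2) * \<bar>v \<bullet> e\<bar>"
      by (rule mult_right_mono) simp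
    also have "\<dots> = \<omega> * (gauss v * (\<bar>v \<bullet> e\<bar> * \<bar>v \<bullet> e\<bar>)) + \<omega>\<^sup>2 / 2 * (gauss v * \<bar>v \<bullet> e\<bar>)"
      by (simp add: algebra_simps)
    also have "\<bar>v \<bullet> e\<bar> * \<bar>v \<bullet> e\<bar> = (v \<bullet> e)\<^sup>2" by (simp add: power2_eq_square)
    finally show ?thesis .
  qed
  show int: "integrable lborel (\<lambda>v. (gauss v - overlap v) * \<bar>v \<bullet> e\<bar>)"
  proof (rule Bochner_Integration.integrable_bound[OF i(2)])
    show "AE v in lborel. norm ((gauss v - overlap v) * \<bar>v \<bullet> e\<bar>) \<le> norm (gauss v * \<bar>v \<bullet> e\<bar>)"
      using overlap_bounds by (intro AE_I2) (simp add: abs_mult mult_right_mono)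
  qed measurable
  have "(LINT v|lborel. (gauss v - overlap v) * \<bar>v \<bullet> e\<bar>)
      \<le> (LINT v|lborel. \<omega> * (gauss v * (v \<bullet> e)\<^sup>2) + \<omega>\<^sup>2 / 2 * (gauss v * \<bar>v \<bullet> e\<bar>))"
    using i int le by (intro integral_mono Bochner_Integration.integrable_add integrable_mult_right)
  also have "\<dots> = \<omega> + \<omega>\<^sup>2 / 2 * (LINT v|lborel. gauss v * \<bar>v \<bullet> e\<bar>)"
    using i by (simp add: gauss_second_moment e)
  also have "\<dots> \<le> \<omega> + \<omega>\<^sup>2 / 2"
    using gauss_first_abs_moment(2)[OF e] by (simp add: mult_left_le)
  finally show "(LINT v|lborel. (gauss v - overlap v) * \<bar>v \<bullet> e\<bar>) \<le> \<omega> * (1 + \<omega> / 2)"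
    by (simp add: power2_eq_square algebra_simps)
qed

text \<open>\<open>k1\<close> and \<open>k2\<close> stand for one test function seen from two
  starting points: \<open>A\<close> bounds the difference when the shift succeeds,
  \<open>A' + D * \<bar>v \<bullet> e\<bar>\<close> when the velocity is reflected.\<close>

lemma gauss_coupling_bound:
  assumes k1[measurable]: "k1 \<in> borel_measurable borel" and k2[measurable]: "k2 \<in> borel_measurable borel"
    and B1: "\<And>v. \<bar>k1 v\<bar> \<le> B" and B2: "\<And>v. \<bar>k2 v\<bar> \<le> B"
    and shift: "\<And>v. k1 v - k2 (v + \<omega> *\<^sub>R e) \<le> A"
    and refl: "\<And>v. k1 v - k2 (refl_along v) \<le> A' + D * \<bar>v \<bullet> e\<bar>"
    and "A \<le> A'" "0 \<le> D"
  shows "(LINT v|lborel. gauss v * k1 v) - (LINT v|lborel. gauss v * k2 v)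
    \<le> A + (\<omega> / 2 + \<omega>\<^sup>2 / 8) * (A' - A) + D * (\<omega> * (1 + \<omega> / 2))"
proof -
  let ?w = "\<omega> *\<^sub>R e"
  have i: "integrable lborel (\<lambda>v. overlap v * k1 v)" "integrable lborel (\<lambda>v. overlap v * k2 (v + ?w))"
    "integrable lborel (\<lambda>v. (gauss v - overlap v) * k1 v)" "integrable lborel (\<lambda>v. (gauss v - overlap v) * k2 (refl_along v))"
    using overlap_bounds B1 B2 by (intro integrable_mult_bounded_dominated[where B = B]; simp)+
  note j = overlap_integrable integrable_gauss[where 'a='a] overlap_defect_moment(1)
  have k1eq: "(LINT v|lborel. gauss v * k1 v) = (LINT v|lborel. overlap v * k1 v) + (LINT v|lborel. (gauss v - overlap v) * k1 v)"
    using i by (subst Bochner_Integration.integral_add[symmetric]) (simp_all add: algebra_simps)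
  have "(LINT v|lborel. gauss v * k1 v) - (LINT v|lborel. gauss v * k2 v)
      = (LINT v|lborel. overlap v * (k1 v - k2 (v + ?w))) + (LINT v|lborel. (gauss v - overlap v) * (k1 v - k2 (refl_along v)))"
    unfolding k1eq gauss_reflection_decomposition[OF k2 B2] right_diff_distrib[of "overlap _"] right_diff_distrib[of "gauss _ - overlap _"]
    using i by simp
  also have "\<dots> \<le> (LINT v|lborel. A * overlap v) + (LINT v|lborel. A' * (gauss v - overlap v) + D * ((gauss v - overlap v) * \<bar>v \<bullet> e\<bar>))"
  proof (intro add_mono integral_mono)
    show "integrable lborel (\<lambda>v. overlap v * (k1 v - k2 (v + ?w)))" "integrable lborel (\<lambda>v. (gauss v - overlap v) * (k1 v - k2 (refl_along v)))"
      unfolding right_diff_distrib[of "overlap _"] right_diff_distrib[of "gauss _ - overlap _"] using i by auto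
    show "integrable lborel (\<lambda>v. A * overlap v)"
      "integrable lborel (\<lambda>v. A' * (gauss v - overlap v) + D * ((gauss v - overlap v) * \<bar>v \<bullet> e\<bar>))"
      using j by auto
    show "overlap v * (k1 v - k2 (v + ?w)) \<le> A * overlap v" for v
      using mult_left_mono[OF shift[of v] overlap_bounds(1)[of v]] by (simp add: mult.commute)
    show "(gauss v - overlap v) * (k1 v - k2 (refl_along v)) \<le> A' * (gauss v - overlap v) + D * ((gauss v - overlap v) * \<bar>v \<bullet> e\<bar>)" for v
      using mult_left_mono[OF refl[of v], of "gauss v - overlap v"] overlap_bounds(2)[of v] by (simp add: algebra_simps)
  qed
  also have "\<dots> = A + (1 - integral\<^sup>L lborel overlap) * (A' - A) + D * (LINT v|lborel. (gauss v - overlap v) * \<bar>v \<bullet> e\<bar>)"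
  proof -
    have "(LINT v|lborel. A * overlap v) + (LINT v|lborel. A' * (gauss v - overlap v) + D * ((gauss v - overlap v) * \<bar>v \<bullet> e\<bar>))
        = A * integral\<^sup>L lborel overlap + (A' * (1 - integral\<^sup>L lborel overlap) + D * (LINT v|lborel. (gauss v - overlap v) * \<bar>v \<bullet> e\<bar>))"
      using j by (simp add: integral_gauss)
    then show ?thesis by (simp add: algebra_simps)
  qed
  also have "\<dots> \<le> A + (\<omega> / 2 + \<omega>\<^sup>2 / 8) * (A' - A) + D * (\<omega> * (1 + \<omega> / 2))"
    using overlap_defect overlap_defect_moment(2) assms by (intro add_mono mult_right_mono mult_left_mono) auto
  finally show ?thesis .
qed

end

subsection \<open>Contraction in the concave distance\<close>

text \<open>\<open>Rt\<close> separates near from far and will be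
  \<open>8 * R * sqrt ((L + K) / K)\<close>. The bounds \<open>LT\<close> are what the three members
  of the minimum in the theorem give; the second controls errors quadratic in the force, the third
  keeps the force weak against the velocity shift.\<close>

locale hmc_contraction = verlet_mean_field dV dW HV HW \<epsilon> L Lt LH LHt h T N
  for dV dW :: "real ^ 'k \<Rightarrow> real ^ 'k" and HV HW :: "real ^ 'k \<Rightarrow> real ^ 'k \<Rightarrow> real ^ 'k"
    and \<epsilon> L Lt LH LHt h T :: real and N :: nat +
  fixes K R Rt :: real
  assumes K: "0 < K" "K \<le> L" and Rt: "0 \<le> Rt" "8 * R \<le> Rt"
    and conv: "\<And>a b. R \<le> norm (a - b) \<Longrightarrow> K * (norm (a - b))\<^sup>2 \<le> (a - b) \<bullet> (dV a - dV b)"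
    and LT: "L * T\<^sup>2 \<le> 3/20" "L\<^sup>2 * T\<^sup>2 \<le> 9/50 * K" "L * T * Rt \<le> 3/80"
    and small: "4 * \<epsilon> * Lt \<le> K * exp (- (5/4) * (Rt / T)) / 10 ^ 6"
begin

text \<open>For that \<open>Rt\<close>, \<open>5/4 * Rt\<close> is
  \<open>10 * R * sqrt ((L + K) / K)\<close>, as in the exponent of \<open>c\<close>. It exceeds
  \<open>Rt\<close> by a quarter, and the surplus pays for the linear part of \<open>f\<close> in
  \<open>lam_r_le\<close>.\<close>

definition amp :: real where "amp = exp (- (5/4) * (Rt / T))"
definition lam :: real where "lam = exp (- 5/2) * amp"
definition E :: real where "E = 4 * \<epsilon> * Lt"
definition rate :: real where "rate = K * T\<^sup>2 / 156 * amp"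
definition f :: "real \<Rightarrow> real" where "f r = T * (1 - exp (- r / T)) + lam * r"
definition rho :: "real ^ 'k ^ 'n \<Rightarrow> real ^ 'k ^ 'n \<Rightarrow> real" where
  "rho x y = (\<Sum>i\<in>UNIV. f (norm (x $ i - y $ i)))"

lemma amp_bounds: "0 < amp" "amp \<le> 1"
  using Rt T by (auto simp: amp_def)

text \<open>Read off from the fifth power of \<open>exp (1/2)\<close>; these bounds place
  \<open>lam\<close> between \<open>amp / 17\<close> and \<open>9/100 * amp\<close>.\<close>

lemma exp_five_halves: "100/9 \<le> exp (5/2 :: real)" "exp (5/2 :: real) \<le> 17"
proof -
  have e: "exp (5/2 :: real) = exp (1/2) ^ 5" by (simp flip: exp_of_nat_mult)
  have "(13/8 :: real) \<le> exp (1/2)"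
    using exp_lower_Taylor_quadratic[of "1/2::real"] by (simp add: power2_eq_square)
  then have "(13/8 :: real) ^ 5 \<le> exp (1/2) ^ 5" by (intro power_mono) auto
  then show "100/9 \<le> exp (5/2 :: real)" unfolding e by (simp add: eval_nat_numeral)
  have "exp (1/2 :: real) \<le> 7/4"
    using exp_bound[of "1/2::real"] by (simp add: power2_eq_square)
  then have "exp (1/2 :: real) ^ 5 \<le> (7/4) ^ 5" by (intro power_mono) auto
  then show "exp (5/2 :: real) \<le> 17" unfolding e by (simp add: eval_nat_numeral)
qed

lemma lam_bounds: "0 < lam" "lam \<le> 9/100 * amp" "amp / 17 \<le> lam" "lam \<le> 1/10"
proof -
  have e: "exp (- 5/2 :: real) = 1 / exp (5/2)" by (simp add: exp_minus field_simps)
  have 1: "exp (- 5/2 :: real) \<le> 9/100" "1/17 \<le> exp (- 5/2 :: real)"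
    unfolding e using exp_five_halves by (auto simp: field_simps)
  show "0 < lam" using amp_bounds by (simp add: lam_def)
  show 2: "lam \<le> 9/100 * amp" unfolding lam_def using 1 amp_bounds by (intro mult_right_mono) auto
  have "1/17 * amp \<le> lam" unfolding lam_def using 1 amp_bounds by (intro mult_right_mono) auto
  then show "amp / 17 \<le> lam" by simp
  show "lam \<le> 1/10" using 2 amp_bounds by linarith
qed

lemma L_pos: "0 < L" using K by linarith

lemma E_bounds: "0 \<le> E" "E \<le> K * amp / 10 ^ 6" "E \<le> K / 10 ^ 6" "\<Lambda> = L + E" "\<Lambda> \<le> 101/100 * L"
proof -
  show "0 \<le> E" using eps Lnn by (simp add: E_def)
  show 1: "E \<le> K * amp / 10 ^ 6" using small by (simp add: E_def amp_def)
  have "K * amp \<le> K * 1" using K amp_bounds by (intro mult_left_mono) auto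
  then show 2: "E \<le> K / 10 ^ 6" using 1 by simp
  show 3: "\<Lambda> = L + E" by (simp add: \<Lambda>_def E_def)
  show "\<Lambda> \<le> 101/100 * L" using 2 3 K by simp
qed

lemma rate_bounds: "0 < rate" "rate \<le> 1"
proof -
  show "0 < rate" using K T amp_bounds by (simp add: rate_def)
  have "K * T\<^sup>2 \<le> L * T\<^sup>2" using K by (intro mult_right_mono) auto
  then have "K * T\<^sup>2 \<le> 1" using LT by linarith
  then have "K * T\<^sup>2 / 156 * amp \<le> 1 * 1" using K amp_bounds by (intro mult_mono) auto
  then show "rate \<le> 1" by (simp add: rate_def)
qed

lemma f_le: "0 \<le> r \<Longrightarrow> f r \<le> (1 + lam) * r"
  using exp_ge_add_one_self[of "- r / T"] mult_left_mono[of "1 - exp (- r / T)" "r / T" T] T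
  by (simp add: f_def algebra_simps)

lemma f_ge: "0 \<le> r \<Longrightarrow> lam * r \<le> f r"
  using T by (simp add: f_def)

lemma f_0 [simp]: "f 0 = 0"
  by (simp add: f_def)

lemma f_mono: "r \<le> s \<Longrightarrow> f r \<le> f s"
  unfolding f_def using T lam_bounds by (intro add_mono mult_left_mono) (auto simp: divide_right_mono)

text \<open>The decrease of the concave part is discarded, being exponentially small at the large
  distances where this is used.\<close>

lemma f_diff_ge: "s \<le> r \<Longrightarrow> f s \<le> f r - lam * (r - s)"
proof -
  assume "s \<le> r"
  then have "T * (1 - exp (- s / T)) \<le> T * (1 - exp (- r / T))"
    using T by (intro mult_left_mono) (auto simp: divide_right_mono)
  then show ?thesis by (simp add: f_def algebra_simps)
qed

text \<open>Concavity puts \<open>f\<close> below its tangent; this measures the gain of a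
  successful shift.\<close>

lemma f_tangent: "f s \<le> f r + (exp (- r / T) + lam) * (s - r)"
proof -
  have "exp (- r / T) * (1 + - (s - r) / T) \<le> exp (- r / T) * exp (- (s - r) / T)"
    by (intro mult_left_mono exp_ge_add_one_self) auto
  also have "\<dots> = exp (- s / T)" using T by (simp add: field_simps flip: exp_add)
  finally have "T * (exp (- r / T) * (1 + - (s - r) / T)) \<le> T * exp (- s / T)"
    using T by (intro mult_left_mono) auto
  moreover have "T * (exp (- r / T) * (1 + - (s - r) / T)) = T * exp (- r / T) - exp (- r / T) * (s - r)"
    using T by (simp add: field_simps)
  ultimately show ?thesis by (simp add: f_def algebra_simps)
qed

text \<open>Beyond \<open>r\<close> the concave part has only the height
  \<open>T * exp (- r / T)\<close> left, however far a reflection drives the particles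
  apart.\<close>

lemma f_jump: "f s \<le> f r + T * exp (- r / T) + lam * (s - r)"
  using T by (simp add: f_def algebra_simps)

lemma rho_le_split:
  fixes x y :: "real ^ 'k ^ 'n"
  shows "rho x y \<le> f (norm ((x - y) $ i)) + 2 * (\<Sum>l\<in>UNIV - {i}. norm ((x - y) $ l))"
proof -
  have "rho x y = f (norm ((x - y) $ i)) + (\<Sum>l\<in>UNIV - {i}. f (norm ((x - y) $ l)))"
    by (simp add: rho_def sum.remove[of UNIV i])
  also have "(\<Sum>l\<in>UNIV - {i}. f (norm ((x - y) $ l))) \<le> (\<Sum>l\<in>UNIV - {i}. 2 * norm ((x - y) $ l))"
  proof (rule sum_mono)
    fix l
    have "f (norm ((x - y) $ l)) \<le> (1 + lam) * norm ((x - y) $ l)" by (rule f_le) simp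
    also have "\<dots> \<le> 2 * norm ((x - y) $ l)" using lam_bounds by (intro mult_right_mono) auto
    finally show "f (norm ((x - y) $ l)) \<le> 2 * norm ((x - y) $ l)" .
  qed
  finally show ?thesis by (simp add: sum_distrib_left)
qed

lemma seminorm_off: "seminorm (\<lambda>u :: real ^ 'k ^ 'n. \<Sum>l\<in>A. norm (u $ l))"
  by (auto simp: seminorm_def norm_triangle_ineq sum_distrib_left simp flip: sum.distrib intro!: sum_mono)

text \<open>Starting points and velocities differ in particle \<open>i\<close> only, and
  \<open>S\<close> bounds the separation in free flight. Equal, shifted and reflected velocities are
  the instances, each with its own \<delta> and \<open>S\<close>.\<close>

context
  fixes x y v u :: "real ^ 'k ^ 'n" and i :: 'n and \<zeta> \<delta> :: "real ^ 'k" and S :: real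
  assumes z: "x - y = axis i \<zeta>" and d: "v - u = axis i \<delta>"
    and S: "\<And>t. 0 \<le> t \<Longrightarrow> t \<le> T \<Longrightarrow> norm (\<zeta> + t *\<^sub>R \<delta>) \<le> S"
begin

lemma S_nonneg: "0 \<le> S"
  using S[of 0] T norm_ge_zero order_trans by (metis order_refl less_imp_le)

lemma lin_part: "(x - y) + t *\<^sub>R (v - u) = axis i (\<zeta> + t *\<^sub>R \<delta>)"
  by (simp add: z d axis_def vec_eq_iff)

lemma Lam_time_le: "\<Lambda> * (real N * h)\<^sup>2 \<le> 1/6"
  using LamT by (simp add: T_eq)

lemma traj_norm1:
  assumes "j \<le> N"
  shows "norm1 (q x v j - q y u j) \<le> 12/11 * S"
    and "norm1 (q x v j - q y u j - axis i (\<zeta> + (real j * h) *\<^sub>R \<delta>)) \<le> 6/11 * (T\<^sup>2 * \<Lambda> * S)"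
proof -
  have D: "norm1 ((x - y) + (real j * h) *\<^sub>R (v - u)) \<le> S" if "j \<le> N" for j
    unfolding lin_part using S[of "real j * h"] time_le[OF that] h by simp
  note b = vpos_diff_bounds[OF seminorm_norm1 F_norm1_lip Lam_nonneg Lam_time_le _ D assms]
  show "norm1 (q x v j - q y u j) \<le> 12/11 * S" using b(1) h by simp
  have "norm1 (q x v j - q y u j - axis i (\<zeta> + (real j * h) *\<^sub>R \<delta>)) \<le> (real j * h)\<^sup>2 / 2 * (\<Lambda> * (12/11 * S))"
    using b(2) h by (simp add: lin_part)
  also have "\<dots> \<le> T\<^sup>2 / 2 * (\<Lambda> * (12/11 * S))"
    using time_power2_le[OF assms] Lam_nonneg S_nonneg by (intro mult_right_mono) auto
  finally show "norm1 (q x v j - q y u j - axis i (\<zeta> + (real j * h) *\<^sub>R \<delta>)) \<le> 6/11 * (T\<^sup>2 * \<Lambda> * S)"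
    by (simp add: ac_simps)
qed

text \<open>In free flight the other particles do not separate, so the source in their Volterra
  inequality is the interaction alone; the constants multiply to \<open>72/121 < 1\<close>.\<close>

lemma traj_off: "(\<Sum>l\<in>UNIV - {i}. norm ((q x v N - q y u N) $ l)) \<le> T\<^sup>2 * E * S"
proof -
  let ?p = "\<lambda>w :: real ^ 'k ^ 'n. \<Sum>l\<in>UNIV - {i}. norm (w $ l)"
  let ?z = "\<lambda>j. q x v j - q y u j"
  let ?D = "T\<^sup>2 / 2 * (E * (12/11 * S))"
  have ES: "0 \<le> E * (12/11 * S)" using E_bounds S_nonneg by simp
  have step: "?p (?z j) \<le> ?D + L * (\<Sum>m<j. wt h j m * ?p (?z m))" if j: "j \<le> N" for j
  proof -
    have "?p (?z j) = ?p (?z j - ((x - y) + (real j * h) *\<^sub>R (v - u)))"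
      unfolding lin_part by (intro sum.cong) (auto simp: axis_def)
    also have "\<dots> \<le> (\<Sum>m<j. ?p (wt h j m *\<^sub>R (F (q x v m) - F (q y u m))))"
      unfolding vpos_diff_closed seminorm_minus[OF seminorm_off] by (rule seminorm_sum_le[OF seminorm_off])
    also have "\<dots> \<le> (\<Sum>m<j. wt h j m * (L * ?p (?z m) + E * (12/11 * S)))"
    proof (rule sum_mono)
      fix m assume "m \<in> {..<j}"
      then have m: "m < j" "m \<le> N" using j by auto
      have "?p (F (q x v m) - F (q y u m)) \<le> L * ?p (?z m) + E * norm1 (?z m)"
        unfolding E_def by (rule F_norm1_off_le)
      also have "E * norm1 (?z m) \<le> E * (12/11 * S)" using traj_norm1(1)[OF m(2)] E_bounds by (intro mult_left_mono)
      finally show "?p (wt h j m *\<^sub>R (F (q x v m) - F (q y u m))) \<le> wt h j m * (L * ?p (?z m) + E * (12/11 * S))"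
        unfolding seminorm_scale[OF seminorm_off] using wt_nonneg[OF m(1)] by (simp add: mult_left_mono)
    qed
    also have "\<dots> = (\<Sum>m<j. wt h j m) * (E * (12/11 * S)) + L * (\<Sum>m<j. wt h j m * ?p (?z m))"
    proof -
      have "(\<Sum>m<j. wt h j m * (L * a m + b)) = (\<Sum>m<j. wt h j m) * b + L * (\<Sum>m<j. wt h j m * a m)" for a b
        by (simp add: algebra_simps sum.distrib sum_distrib_left)
      then show ?thesis .
    qed
    also have "(\<Sum>m<j. wt h j m) * (E * (12/11 * S)) \<le> ?D"
      unfolding sum_wt using time_power2_le[OF j] ES by (intro mult_right_mono) auto
    finally show ?thesis by simp
  qed
  have LN: "L * (real N * h)\<^sup>2 \<le> 1/6" using LT by (simp add: T_eq)
  have "?p (?z N) \<le> 12/11 * ?D"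
  proof (rule volterra_bound[OF step _ LN])
    show "0 \<le> ?D" by (rule mult_nonneg_nonneg[OF _ ES]) simp
  qed (use L_pos h in auto)
  also have "\<dots> = (72/121) * (T\<^sup>2 * E * S)" by simp
  also have "\<dots> \<le> 1 * (T\<^sup>2 * E * S)"
    using E_bounds S_nonneg by (intro mult_right_mono) auto
  finally show ?thesis by simp
qed

lemma rho_end_le: "rho (q x v N) (q y u N) \<le> f (norm ((q x v N - q y u N) $ i)) + 2 * (T\<^sup>2 * E * S)"
  using rho_le_split[of "q x v N" "q y u N" i] traj_off by linarith

lemma comp_end: "norm ((q x v N - q y u N) $ i - (\<zeta> + T *\<^sub>R \<delta>)) \<le> 6/11 * (T\<^sup>2 * \<Lambda> * S)"
  using norm_nth_le_norm1[of "q x v N - q y u N - axis i (\<zeta> + (real N * h) *\<^sub>R \<delta>)" i] traj_norm1(2)[of N]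
  by (simp add: T_eq axis_def)

end

section \<open>Distant particles: equal velocities\<close>

lemma synchronous_distance:
  fixes x y v :: "real ^ 'k ^ 'n"
  assumes z: "x - y = axis i \<zeta>" and r: "Rt \<le> norm \<zeta>"
  shows "norm ((q x v N - q y v N) $ i) \<le> norm \<zeta> * (1 - 3/10 * (K * T\<^sup>2))"
proof -
  define r where "r = norm \<zeta>"
  have r0: "0 \<le> r" by (simp add: r_def)
  have d: "v - v = axis i 0" by (simp add: axis_def vec_eq_iff)
  have S: "norm (\<zeta> + t *\<^sub>R 0) \<le> r" for t by (simp add: r_def)
  note traj = traj_norm1[OF z d S]
  define zj where "zj j = (q x v j - q y v j) $ i" for j
  define gj where "gj j = (F (q x v j) - F (q y v j)) $ i" for j
  \<comment> \<open>The final separation is \<open>\<zeta> - P\<close>; its square needs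
    \<open>\<zeta> \<bullet> P\<close> from below and \<open>norm P\<close> from above.\<close>
  define P where "P = (\<Sum>j<N. wt h N j *\<^sub>R gj j)"
  have end_eq: "(q x v N - q y v N) $ i = \<zeta> - P"
  proof -
    have "(q x v N - q y v N - ((x - y) + (real N * h) *\<^sub>R (v - v))) $ i = - P"
      unfolding vpos_diff_closed P_def gj_def by (simp add: sum_component)
    then show ?thesis by (simp add: z axis_def algebra_simps)
  qed
  have close: "norm (zj j - \<zeta>) \<le> 6/11 * (T\<^sup>2 * \<Lambda> * r)" if "j \<le> N" for j
    using norm_nth_le_norm1[of "q x v j - q y v j - axis i (\<zeta> + (real j * h) *\<^sub>R 0)" i] traj(2)[OF that]
    by (simp add: zj_def axis_def)
  have close': "6/11 * (T\<^sup>2 * \<Lambda> * r) \<le> r / 11"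
    using mult_right_mono[OF LamT r0] by (simp add: algebra_simps)
  have gj_le: "norm (gj j) \<le> \<Lambda> * (12/11 * r)" if "j < N" for j
  proof -
    have "norm (gj j) \<le> norm1 (F (q x v j) - F (q y v j))" unfolding gj_def by (rule norm_nth_le_norm1)
    also have "\<dots> \<le> \<Lambda> * norm1 (q x v j - q y v j)" by (rule F_norm1_lip)
    also have "\<dots> \<le> \<Lambda> * (12/11 * r)" using traj(1)[of j] that Lam_nonneg by (intro mult_left_mono) auto
    finally show ?thesis .
  qed
  have P_le: "norm P \<le> 6/11 * (T\<^sup>2 * \<Lambda> * r)"
    using seminorm_wt_sum_le[OF seminorm_norm, of N gj "\<Lambda> * (12/11 * r)" h] gj_le
    by (simp add: P_def T_eq ac_simps)
  have LL: "\<Lambda> * L * T\<^sup>2 \<le> 101/100 * (9/50 * K)"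
  proof -
    have "\<Lambda> * (L * T\<^sup>2) \<le> 101/100 * L * (L * T\<^sup>2)" using E_bounds(5) L_pos by (intro mult_right_mono) auto
    also have "\<dots> = 101/100 * (L\<^sup>2 * T\<^sup>2)" by (simp add: power2_eq_square)
    also have "\<dots> \<le> 101/100 * (9/50 * K)" using LT(2) by (intro mult_left_mono) auto
    finally show ?thesis by simp
  qed
  \<comment> \<open>Convexity applies to the current separation \<open>zj j\<close>, which is at
    least \<open>10/11 * r\<close> and so beyond \<open>R\<close>; it yields \<open>100/121\<close>.
    Replacing \<open>zj j\<close> by \<zeta> costs \<open>11/100\<close> and the interaction
    \<open>1/100\<close>, which leaves \<open>7/10\<close>.\<close>
  have gj_ge: "7/10 * K * r\<^sup>2 \<le> \<zeta> \<bullet> gj j" if j: "j < N" for j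
  proof -
    let ?dV = "dV (q x v j $ i) - dV (q y v j $ i)"
    have zj: "zj j = q x v j $ i - q y v j $ i" by (simp add: zj_def)
    have jN: "j \<le> N" using j by simp
    have lo: "10/11 * r \<le> norm (zj j)"
    proof -
      have "norm (\<zeta> - zj j) \<le> r / 11"
        unfolding norm_minus_commute[of \<zeta>] by (rule order_trans[OF close[OF jN] close'])
      then show ?thesis using norm_triangle_ineq2[of \<zeta> "\<zeta> - zj j"] by (simp add: r_def)
    qed
    have hi: "norm (zj j) \<le> 12/11 * r"
      using norm_nth_le_norm1[of "q x v j - q y v j" i] traj(1)[OF jN] by (simp add: zj_def)
    have "R \<le> norm (zj j)" using lo r Rt r0 unfolding r_def by linarith
    then have 1: "K * (norm (zj j))\<^sup>2 \<le> zj j \<bullet> ?dV" unfolding zj by (rule conv)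
    have "K * ((10/11 * r)\<^sup>2) \<le> K * (norm (zj j))\<^sup>2" using K lo r0 by (intro mult_left_mono power_mono) auto
    with 1 have A: "100/121 * (K * r\<^sup>2) \<le> zj j \<bullet> ?dV" by (simp add: power_mult_distrib power2_eq_square)
    have "\<bar>(\<zeta> - zj j) \<bullet> ?dV\<bar> \<le> norm (\<zeta> - zj j) * norm ?dV" by (rule Cauchy_Schwarz_ineq2)
    also have "\<dots> \<le> (6/11 * (T\<^sup>2 * \<Lambda> * r)) * (L * (12/11 * r))"
    proof (rule mult_mono)
      show "norm (\<zeta> - zj j) \<le> 6/11 * (T\<^sup>2 * \<Lambda> * r)" using close[OF jN] by (simp add: norm_minus_commute)
      have "norm ?dV \<le> L * norm (zj j)" unfolding zj by (rule dV_lip)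
      also have "\<dots> \<le> L * (12/11 * r)" using hi L_pos by (intro mult_left_mono) auto
      finally show "norm ?dV \<le> L * (12/11 * r)" .
    qed (use Lam_nonneg r0 in auto)
    also have "\<dots> = 72/121 * (\<Lambda> * L * T\<^sup>2) * r\<^sup>2" by (simp add: power2_eq_square)
    also have "\<dots> \<le> 72/121 * (101/100 * (9/50 * K)) * r\<^sup>2"
      using LL by (intro mult_right_mono mult_left_mono) auto
    finally have B: "- (11/100 * (K * r\<^sup>2)) \<le> (\<zeta> - zj j) \<bullet> ?dV"
    proof -
      assume a: "\<bar>(\<zeta> - zj j) \<bullet> ?dV\<bar> \<le> 72/121 * (101/100 * (9/50 * K)) * r\<^sup>2"
      have "72/121 * (101/100 * (9/50 * K)) * r\<^sup>2 = 65448/605000 * (K * r\<^sup>2)" by simp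
      also have "\<dots> \<le> 11/100 * (K * r\<^sup>2)" using K by (intro mult_right_mono) auto
      finally show ?thesis using a by linarith
    qed
    have "\<bar>\<zeta> \<bullet> (gj j - ?dV)\<bar> \<le> r * norm (gj j - ?dV)" unfolding r_def by (rule Cauchy_Schwarz_ineq2)
    also have "\<dots> \<le> r * (E * (12/11 * r))"
    proof (rule mult_left_mono[OF _ r0])
      have "norm (gj j - ?dV) \<le> E * norm1 (q x v j - q y v j)"
        unfolding gj_def E_def by (rule interaction_diff_le_norm1)
      also have "\<dots> \<le> E * (12/11 * r)" using traj(1)[OF jN] E_bounds by (intro mult_left_mono) auto
      finally show "norm (gj j - ?dV) \<le> E * (12/11 * r)" .
    qed
    also have "\<dots> = 12/11 * E * r\<^sup>2" by (simp add: power2_eq_square)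
    also have "\<dots> \<le> 1/100 * K * r\<^sup>2" using E_bounds(3) K by (intro mult_right_mono) auto
    finally have C: "- (1/100 * (K * r\<^sup>2)) \<le> \<zeta> \<bullet> (gj j - ?dV)" by (simp add: abs_le_iff)
    have "\<zeta> \<bullet> gj j = zj j \<bullet> ?dV + (\<zeta> - zj j) \<bullet> ?dV + \<zeta> \<bullet> (gj j - ?dV)"
      by (simp add: inner_diff_left inner_diff_right)
    moreover have "0 \<le> K * r\<^sup>2" using K by simp
    ultimately show ?thesis using A B C by (simp add: mult.assoc)
  qed
  have inner_P: "T\<^sup>2 / 2 * (7/10 * K * r\<^sup>2) \<le> \<zeta> \<bullet> P"
  proof -
    have "T\<^sup>2 / 2 * (7/10 * K * r\<^sup>2) = (\<Sum>j<N. wt h N j * (7/10 * K * r\<^sup>2))"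
      unfolding sum_distrib_right[symmetric] sum_wt T_eq ..
    also have "\<dots> \<le> (\<Sum>j<N. wt h N j * (\<zeta> \<bullet> gj j))"
      using gj_ge by (intro sum_mono mult_left_mono wt_nonneg) auto
    also have "\<dots> = \<zeta> \<bullet> P" by (simp add: P_def inner_sum_right)
    finally show ?thesis .
  qed
  have "(norm P)\<^sup>2 \<le> (6/11 * (T\<^sup>2 * \<Lambda> * r))\<^sup>2" using P_le by (intro power_mono) auto
  also have "\<dots> = 36/121 * (\<Lambda>\<^sup>2 * T\<^sup>2) * (T\<^sup>2 * r\<^sup>2)" by (simp add: power_mult_distrib power2_eq_square)
  also have "\<dots> \<le> 36/121 * ((101/100)\<^sup>2 * (9/50 * K)) * (T\<^sup>2 * r\<^sup>2)"
  proof -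
    have "\<Lambda>\<^sup>2 \<le> (101/100 * L)\<^sup>2" using E_bounds(5) Lam_nonneg by (intro power_mono) auto
    then have "\<Lambda>\<^sup>2 * T\<^sup>2 \<le> (101/100 * L)\<^sup>2 * T\<^sup>2" by (intro mult_right_mono) auto
    also have "\<dots> = (101/100)\<^sup>2 * (L\<^sup>2 * T\<^sup>2)" by (simp only: power_mult_distrib mult.assoc)
    also have "\<dots> \<le> (101/100)\<^sup>2 * (9/50 * K)" using LT(2) by (intro mult_left_mono) auto
    finally show ?thesis by (intro mult_right_mono mult_left_mono) auto
  qed
  also have "\<dots> = 36/121 * ((101/100)\<^sup>2 * (9/50)) * (K * T\<^sup>2 * r\<^sup>2)" by simp
  also have "\<dots> \<le> 1/10 * (K * T\<^sup>2 * r\<^sup>2)"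
    using K by (intro mult_right_mono) (auto simp: power2_eq_square)
  finally have P2: "(norm P)\<^sup>2 \<le> 1/10 * (K * T\<^sup>2 * r\<^sup>2)" .
  \<comment> \<open>The inner product gives \<open>7/10\<close> and the square takes back
    \<open>1/10\<close>; the remaining \<open>6/10\<close> is twice the \<open>3/10\<close> of the
    statement.\<close>
  have "(norm (\<zeta> - P))\<^sup>2 = r\<^sup>2 - 2 * (\<zeta> \<bullet> P) + (norm P)\<^sup>2"
    unfolding r_def power2_norm_eq_inner by (simp add: inner_diff_left inner_diff_right inner_commute)
  also have "\<dots> \<le> r\<^sup>2 - 6/10 * (K * T\<^sup>2 * r\<^sup>2)" using inner_P P2 by (simp add: algebra_simps)
  also have "\<dots> \<le> (r * (1 - 3/10 * (K * T\<^sup>2)))\<^sup>2"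
  proof -
    have "(r * (1 - 3/10 * (K * T\<^sup>2)))\<^sup>2 = r\<^sup>2 - 6/10 * (K * T\<^sup>2 * r\<^sup>2) + (3/10 * (K * T\<^sup>2) * r)\<^sup>2"
      by (simp add: power2_eq_square algebra_simps)
    then show ?thesis by (metis le_add_same_cancel1 zero_le_power2)
  qed
  finally have sq: "(norm (\<zeta> - P))\<^sup>2 \<le> (r * (1 - 3/10 * (K * T\<^sup>2)))\<^sup>2" .
  have "K * T\<^sup>2 \<le> L * T\<^sup>2" using K by (intro mult_right_mono) auto
  then have "0 \<le> 1 - 3/10 * (K * T\<^sup>2)" using LT(1) by linarith
  then have "0 \<le> r * (1 - 3/10 * (K * T\<^sup>2))" using r0 by (rule mult_nonneg_nonneg[rotated])
  with sq have "norm (\<zeta> - P) \<le> r * (1 - 3/10 * (K * T\<^sup>2))" by (rule power2_le_imp_le)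
  then show ?thesis unfolding end_eq r_def .
qed

lemma rate_f_le: "0 \<le> r \<Longrightarrow> rate * f r \<le> 11/1560 * (K * T\<^sup>2 * amp * r)"
proof -
  assume r: "0 \<le> r"
  have "rate * f r \<le> rate * (11/10 * r)"
  proof (intro mult_left_mono)
    have "(1 + lam) * r \<le> 11/10 * r" using lam_bounds r by (intro mult_right_mono) auto
    then show "f r \<le> 11/10 * r" using f_le[OF r] by linarith
  qed (use rate_bounds in auto)
  then show ?thesis by (simp add: rate_def)
qed

text \<open>The slope \<open>lam \<ge> amp / 17\<close> turns the shorter distance into a gain of
  \<open>3/170 * ?X\<close>, against \<open>11/1560 * ?X\<close> demanded by the rate and
  \<open>2 / 10 ^ 6 * ?X\<close> lost to the interaction.\<close>

lemma synchronous_contraction: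
  fixes x y v :: "real ^ 'k ^ 'n"
  assumes z: "x - y = axis i \<zeta>" and r: "Rt \<le> norm \<zeta>"
  shows "rho (q x v N) (q y v N) \<le> (1 - rate) * f (norm \<zeta>)"
proof -
  define r where "r = norm \<zeta>"
  have r0: "0 \<le> r" by (simp add: r_def)
  have d: "v - v = axis i 0" by (simp add: axis_def vec_eq_iff)
  have S: "norm (\<zeta> + t *\<^sub>R 0) \<le> r" for t by (simp add: r_def)
  let ?X = "K * T\<^sup>2 * amp * r"
  have X: "0 \<le> ?X" using K amp_bounds r0 by simp
  have "rho (q x v N) (q y v N) \<le> f (norm ((q x v N - q y v N) $ i)) + 2 * (T\<^sup>2 * E * r)"
    by (rule rho_end_le[OF z d S])
  also have "f (norm ((q x v N - q y v N) $ i)) \<le> f (r * (1 - 3/10 * (K * T\<^sup>2)))"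
    using synchronous_distance[OF z r] by (intro f_mono) (simp add: r_def)
  also have "\<dots> \<le> f r - lam * (r - r * (1 - 3/10 * (K * T\<^sup>2)))"
  proof (rule f_diff_ge)
    have "0 \<le> r * (3/10 * (K * T\<^sup>2))" using K r0 by simp
    then show "r * (1 - 3/10 * (K * T\<^sup>2)) \<le> r" by (simp add: algebra_simps)
  qed
  also have "\<dots> = f r - lam * (3/10 * (K * T\<^sup>2 * r))" by (simp add: algebra_simps)
  also have "\<dots> \<le> f r - amp / 17 * (3/10 * (K * T\<^sup>2 * r))"
    using lam_bounds K r0 by (intro diff_left_mono mult_right_mono) auto
  finally have 1: "rho (q x v N) (q y v N) \<le> f r - 3/170 * ?X + 2 * (T\<^sup>2 * E * r)"
    by (simp add: algebra_simps)
  have "T\<^sup>2 * E * r \<le> T\<^sup>2 * (K * amp / 10 ^ 6) * r" using E_bounds r0 by (intro mult_right_mono mult_left_mono) auto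
  then have 2: "T\<^sup>2 * E * r \<le> 1 / 10 ^ 6 * ?X" by (simp add: algebra_simps)
  have "rate * f r \<le> 11/1560 * ?X" by (rule rate_f_le[OF r0])
  then have "rho (q x v N) (q y v N) \<le> f r - rate * f r" using 1 2 X by (simp add: field_simps)
  then show ?thesis by (simp add: r_def algebra_simps)
qed

section \<open>Close particles: shifted and reflected velocities\<close>

definition \<gamma> :: real where "\<gamma> = 1 / max T (4 * Rt)"

text \<open>The velocities will differ by \<open>\<gamma> *\<^sub>R \<zeta>\<close>.
  \<open>\<gamma> * T \<le> 1\<close> prevents overshooting and
  \<open>\<gamma> * r \<le> 1/4\<close> keeps the Gaussians overlapping; \<gamma> is the largest
  value with both properties up to distance \<open>Rt\<close>. The third bound keeps the effect of
  the forces below the gain \<open>\<gamma> * T\<close>.\<close>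

lemma gam_bounds: "0 < \<gamma>" "\<gamma> * T \<le> 1" "L * T\<^sup>2 \<le> 3/20 * (\<gamma> * T)" "r \<le> Rt \<Longrightarrow> \<gamma> * r \<le> 1/4"
proof -
  have m: "0 < max T (4 * Rt)" "T \<le> max T (4 * Rt)" "4 * Rt \<le> max T (4 * Rt)" using T by auto
  show "0 < \<gamma>" "\<gamma> * T \<le> 1" using m by (auto simp: \<gamma>_def field_simps)
  show "\<gamma> * r \<le> 1/4" if "r \<le> Rt" using m that by (simp add: \<gamma>_def field_simps)
  have "L * T * max T (4 * Rt) \<le> 3/20"
    using LT(1,3) by (auto simp: max_def power2_eq_square)
  then have "T * (L * T * max T (4 * Rt)) \<le> T * (3/20)" using T by (intro mult_left_mono) auto
  then show "L * T\<^sup>2 \<le> 3/20 * (\<gamma> * T)" using m(1) by (simp add: \<gamma>_def field_simps power2_eq_square)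
qed

text \<open>\<open>amp\<close> is at most \<open>exp (- r / T) * exp (- (r / (4 * T)))\<close>, and
  \<open>r * exp (- (r / (4 * T))) \<le> 4 * T\<close>; with \<open>lam \<le> 9/100 * amp\<close>
  this gives \<open>36/100\<close>.\<close>

lemma lam_r_le:
  assumes "0 \<le> r" "r \<le> Rt"
  shows "amp \<le> exp (- r / T)" "lam * r \<le> 36/100 * (T * exp (- r / T))"
proof -
  have rT: "r / T \<le> Rt / T" "0 \<le> r / T" using assms T by (auto simp: divide_right_mono)
  have a: "amp \<le> exp (- r / T) * exp (- (r / (4 * T)))"
    unfolding amp_def exp_add[symmetric] using rT by (simp add: field_simps)
  also have "\<dots> \<le> exp (- r / T) * 1" using assms T by (intro mult_left_mono) auto
  finally show "amp \<le> exp (- r / T)" by simp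
  have "r / (4 * T) \<le> exp (r / (4 * T))" using exp_ge_add_one_self[of "r / (4 * T)"] by linarith
  then have "r * exp (- (r / (4 * T))) \<le> 4 * T"
    using T by (simp add: exp_minus field_simps)
  then have "exp (- r / T) * (r * exp (- (r / (4 * T)))) \<le> exp (- r / T) * (4 * T)" by (intro mult_left_mono) auto
  moreover have "amp * r \<le> (exp (- r / T) * exp (- (r / (4 * T)))) * r" using a assms by (intro mult_right_mono)
  moreover have "(exp (- r / T) * exp (- (r / (4 * T)))) * r = exp (- r / T) * (r * exp (- (r / (4 * T))))" by simp
  ultimately have "amp * r \<le> exp (- r / T) * (4 * T)" by linarith
  then have "amp * r \<le> 4 * (T * exp (- r / T))" by (simp add: ac_simps)
  moreover have "lam * r \<le> (9/100 * amp) * r" using lam_bounds assms by (intro mult_right_mono)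
  ultimately show "lam * r \<le> 36/100 * (T * exp (- r / T))" by linarith
qed

text \<open>Free flight shrinks the separation to \<open>(1 - \<gamma> * T) * r\<close>, the forces
  take back at most \<open>9/100\<close> of that gain, and the tangent of \<open>f\<close> converts
  the rest.\<close>

lemma shift_distance:
  fixes x y v u :: "real ^ 'k ^ 'n"
  assumes z: "x - y = axis i \<zeta>" and d: "v - u = axis i (- (\<gamma> *\<^sub>R \<zeta>))"
  shows "rho (q x v N) (q y u N) \<le> f (norm \<zeta>)
    - 91/100 * (\<gamma> * T * norm \<zeta>) * (exp (- norm \<zeta> / T) + lam) + 2 * (T\<^sup>2 * E * norm \<zeta>)"
proof -
  define r where "r = norm \<zeta>"
  have r0: "0 \<le> r" by (simp add: r_def)
  have eq: "\<zeta> + t *\<^sub>R - (\<gamma> *\<^sub>R \<zeta>) = (1 - \<gamma> * t) *\<^sub>R \<zeta>" for t by (simp add: algebra_simps)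
  have gt: "0 \<le> 1 - \<gamma> * t" "1 - \<gamma> * t \<le> 1" if "0 \<le> t" "t \<le> T" for t
  proof -
    have "\<gamma> * t \<le> \<gamma> * T" "0 \<le> \<gamma> * t" using gam_bounds(1) that by auto
    then show "0 \<le> 1 - \<gamma> * t" "1 - \<gamma> * t \<le> 1" using gam_bounds(2) by linarith+
  qed
  have S: "norm (\<zeta> + t *\<^sub>R - (\<gamma> *\<^sub>R \<zeta>)) \<le> r" if "0 \<le> t" "t \<le> T" for t
    unfolding eq r_def using gt[OF that] by (simp add: mult_left_le_one_le)
  let ?Z = "norm ((q x v N - q y u N) $ i)"
  have "?Z \<le> norm (\<zeta> + T *\<^sub>R - (\<gamma> *\<^sub>R \<zeta>)) + 6/11 * (T\<^sup>2 * \<Lambda> * r)"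
    using comp_end[OF z d S] norm_triangle_sub[of "(q x v N - q y u N) $ i" "\<zeta> + T *\<^sub>R - (\<gamma> *\<^sub>R \<zeta>)"] by linarith
  also have "norm (\<zeta> + T *\<^sub>R - (\<gamma> *\<^sub>R \<zeta>)) = (1 - \<gamma> * T) * r"
    unfolding eq r_def using gt[of T] T by simp
  also have "6/11 * (T\<^sup>2 * \<Lambda> * r) \<le> 9/100 * (\<gamma> * T * r)"
  proof -
    have "T\<^sup>2 * \<Lambda> \<le> T\<^sup>2 * (101/100 * L)" using E_bounds by (intro mult_left_mono) auto
    also have "\<dots> \<le> 101/100 * (3/20 * (\<gamma> * T))" using gam_bounds(3) by (simp add: algebra_simps)
    finally have "(T\<^sup>2 * \<Lambda>) * r \<le> (101/100 * (3/20 * (\<gamma> * T))) * r" using r0 by (rule mult_right_mono)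
    moreover have "0 \<le> \<gamma> * T * r" using gam_bounds T r0 by simp
    ultimately show ?thesis by (simp add: algebra_simps)
  qed
  finally have "?Z - r \<le> - (91/100 * (\<gamma> * T * r))" by (simp add: algebra_simps)
  then have "(exp (- r / T) + lam) * (?Z - r) \<le> (exp (- r / T) + lam) * - (91/100 * (\<gamma> * T * r))"
    using lam_bounds by (intro mult_left_mono) (auto intro: add_nonneg_nonneg)
  then have "f ?Z \<le> f r - 91/100 * (\<gamma> * T * r) * (exp (- r / T) + lam)"
    using f_tangent[of ?Z r] by (simp add: algebra_simps)
  then show ?thesis using rho_end_le[OF z d S] by (simp add: r_def)
qed

text \<open>Here the separation may grow. The concave part costs at most
  \<open>T * exp (- r / T)\<close>, and the growth factor \<open>12/11\<close> adds
  \<open>lam * r / 11\<close>; \<open>1033/1000\<close> covers \<open>1 + 36/1100\<close>.\<close>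

lemma reflection_distance:
  fixes x y v u :: "real ^ 'k ^ 'n"
  assumes z: "x - y = axis i \<zeta>" and d: "v - u = axis i \<delta>" and \<delta>: "norm \<delta> \<le> 2 * \<bar>s\<bar>" and r: "norm \<zeta> \<le> Rt"
  shows "rho (q x v N) (q y u N) \<le> f (norm \<zeta>) + 1033/1000 * (T * exp (- norm \<zeta> / T)) + 2 * (T\<^sup>2 * E * norm \<zeta>)
    + (24/11 * lam * T + 4 * (T\<^sup>2 * E * T)) * \<bar>s\<bar>"
proof -
  define r where "r = norm \<zeta>"
  have r0: "0 \<le> r" by (simp add: r_def)
  have S: "norm (\<zeta> + t *\<^sub>R \<delta>) \<le> r + 2 * T * \<bar>s\<bar>" if "0 \<le> t" "t \<le> T" for t
  proof -
    have "norm (t *\<^sub>R \<delta>) \<le> T * (2 * \<bar>s\<bar>)"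
      using that \<delta> T by (auto intro!: mult_mono)
    then show ?thesis using norm_triangle_ineq[of \<zeta> "t *\<^sub>R \<delta>"] by (simp add: r_def)
  qed
  let ?Z = "norm ((q x v N - q y u N) $ i)"
  have "?Z \<le> 12/11 * (r + 2 * T * \<bar>s\<bar>)"
    using norm_nth_le_norm1[of "q x v N - q y u N" i] traj_norm1(1)[OF z d S, of N] by linarith
  then have "lam * (?Z - r) \<le> lam * (r / 11 + 24/11 * T * \<bar>s\<bar>)"
    using lam_bounds by (intro mult_left_mono) (auto simp: algebra_simps)
  moreover have "lam * r \<le> 36/100 * (T * exp (- r / T))"
    using lam_r_le(2)[OF r0] r by (simp add: r_def)
  moreover have "0 \<le> T * exp (- r / T)" using T by simp
  ultimately have "f ?Z \<le> f r + 1033/1000 * (T * exp (- r / T)) + 24/11 * lam * T * \<bar>s\<bar>"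
    using f_jump[of ?Z r] by (simp add: algebra_simps)
  then show ?thesis
    using rho_end_le[OF z d S] by (simp add: r_def algebra_simps)
qed

lemma measurable_q [measurable]: "(\<lambda>v. q x v N) \<in> borel_measurable borel"
  using q_has_derivative by (rule borel_measurable_if_has_derivative)

definition P :: "(real ^ 'k ^ 'n \<Rightarrow> real) \<Rightarrow> real ^ 'k ^ 'n \<Rightarrow> real" where
  "P g x = (LINT v|lborel. gauss v * g (q x v N))"

text \<open>
  Below \<open>t\<close> stands for \<open>\<gamma> * T * r\<close>, \<open>X\<close> for \<open>exp (- r / T)\<close>, \<open>p\<close> for the probability that the
  shift fails, \<open>e\<close> for the interaction error and \<open>y\<close> for \<open>K * T\<^sup>2 * amp * r\<close>.
\<close>

lemma reflection_arithmetic: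
  fixes t X l y \<omega> Tx c f0 e p D :: real
  assumes "0 \<le> t" "0 \<le> X" "0 \<le> l" "l \<le> 9/100 * X" and "p \<le> 17/32 * \<omega>" "p \<le> 17/128" "\<omega> * Tx = t" "0 \<le> Tx"
    and "20/3 * y \<le> t * X" "e \<le> 1 / 10 ^ 6 * y" "0 \<le> y" "c \<le> 11/1560 * y" "0 \<le> \<omega>"
    and D: "D \<le> 9/8 * (24/11 * (t * l)) + 9/2 * e"
  shows "(f0 - 91/100 * t * (X + l) + 2 * e)
     + p * ((f0 + 1033/1000 * (Tx * X) + 2 * e) - (f0 - 91/100 * t * (X + l) + 2 * e)) + D \<le> f0 - c"
proof -
  have tX: "0 \<le> t * X" "0 \<le> t * l" using assms by auto
  have tl: "t * l \<le> 9/100 * (t * X)" using mult_left_mono[of l "9/100 * X" t] assms by simp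
  have "p * (Tx * X) \<le> 17/32 * \<omega> * (Tx * X)" using assms by (intro mult_right_mono) auto
  also have "\<dots> = 17/32 * (\<omega> * Tx * X)" by simp
  finally have 1: "p * (Tx * X) \<le> 17/32 * (t * X)" using assms by simp
  have 2: "p * (t * X + t * l) \<le> 17/128 * (t * X + t * l)" using assms tX by (intro mult_right_mono) auto
  have "p * ((f0 + 1033/1000 * (Tx * X) + 2 * e) - (f0 - 91/100 * t * (X + l) + 2 * e))
      = 1033/1000 * (p * (Tx * X)) + 91/100 * (p * (t * X + t * l))" by (simp add: algebra_simps)
  also have "\<dots> \<le> 1033/1000 * (17/32 * (t * X)) + 91/100 * (17/128 * (t * X + t * l))"
    using 1 2 by linarith
  finally have 3: "p * ((f0 + 1033/1000 * (Tx * X) + 2 * e) - (f0 - 91/100 * t * (X + l) + 2 * e))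
      \<le> 1033/1000 * (17/32 * (t * X)) + 91/100 * (17/128 * (t * X + t * l))" .
  have e': "e \<le> 1/1000000 * y" using assms(10) by simp
  \<comment> \<open>For \<open>a = t * X\<close> and \<open>b = t * l\<close>: the gain
    \<open>91/100 * a\<close> loses about \<open>67/100 * a\<close> to failed shifts and, as
    \<open>b \<le> 9/100 * a\<close>, at most about \<open>15/100 * a\<close> through the terms in
    \<open>b\<close>. What remains, \<open>9/100 * a\<close>, is worth \<open>6/10 * y\<close>, far
    above \<open>c\<close> and the multiples of \<open>e\<close>.\<close>
  have lin: "(f0 - 91/100 * (a + b) + 2 * e) + G + D \<le> f0 - c"
    if "0 \<le> a" "b \<le> 9/100 * a" "20/3 * y \<le> a" "D \<le> 9/8 * (24/11 * b) + 9/2 * e"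
      "G \<le> 1033/1000 * (17/32 * a) + 91/100 * (17/128 * (a + b))" for a b G
  proof -
    have "D \<le> 27/11 * b + 9/2 * e" using that(4) by (simp add: field_simps)
    moreover have "G \<le> 17561/32000 * a + 1547/12800 * a + 1547/12800 * b" using that(5) by (simp add: field_simps)
    ultimately have "f0 - 91/100 * a - 91/100 * b + 2 * e + G + D \<le> f0 - c"
      using that e' assms(11,12) by linarith
    then show ?thesis by (simp add: field_simps)
  qed
  have eq: "91/100 * t * (X + l) = 91/100 * (t * X + t * l)" by (simp add: algebra_simps)
  show ?thesis using lin[OF tX(1) tl assms(9) D 3] unfolding eq .
qed

lemma reflection_contraction:
  fixes x y :: "real ^ 'k ^ 'n" and g :: "real ^ 'k ^ 'n \<Rightarrow> real"
  assumes z: "x - y = axis i \<zeta>" and r: "0 < norm \<zeta>" "norm \<zeta> \<le> Rt"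
    and [measurable]: "g \<in> borel_measurable borel" and B: "\<And>a. \<bar>g a\<bar> \<le> B" and lip: "\<And>a b. \<bar>g a - g b\<bar> \<le> rho a b"
  shows "P g x - P g y \<le> (1 - rate) * f (norm \<zeta>)"
proof -
  define r where "r = norm \<zeta>"
  \<comment> \<open>The unit vector of the separation, supported on particle \<open>i\<close>; all
    other particles get equal velocities. With \<open>\<omega> = \<gamma> * r\<close> the shift
    sends the particle of \<open>y\<close> towards that of \<open>x\<close>.\<close>
  define e :: "real ^ 'k ^ 'n" where "e = axis i ((1/r) *\<^sub>R \<zeta>)"
  define \<omega> where "\<omega> = \<gamma> * r"
  define X where "X = exp (- r / T)"
  have r0: "0 < r" "r \<le> Rt" using r by (auto simp: r_def)
  have e1: "norm e = 1" using r0 by (simp add: e_def r_def)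
  have \<omega>: "0 \<le> \<omega>" "\<omega> \<le> 1/4" using gam_bounds r0 by (auto simp: \<omega>_def)
  have axis_scale: "c *\<^sub>R axis i (a :: real ^ 'k) = axis i (c *\<^sub>R a)" for c and a :: "real ^ 'k"
    by (simp add: axis_def vec_eq_iff)
  have axis_minus: "- axis i (a :: real ^ 'k) = axis i (- a)" for a :: "real ^ 'k"
    by (simp add: axis_def vec_eq_iff)
  let ?A = "f r - 91/100 * (\<gamma> * T * r) * (X + lam) + 2 * (T\<^sup>2 * E * r)"
  let ?A' = "f r + 1033/1000 * (T * X) + 2 * (T\<^sup>2 * E * r)"
  let ?D = "24/11 * lam * T + 4 * (T\<^sup>2 * E * T)"
  have t0: "0 \<le> \<gamma> * T * r" using gam_bounds T r0 by simp
  have "P g x - P g y \<le> ?A + (\<omega> / 2 + \<omega>\<^sup>2 / 8) * (?A' - ?A) + ?D * (\<omega> * (1 + \<omega> / 2))"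
    unfolding P_def
  proof (rule gauss_coupling_bound[OF e1 \<omega>(1)])
    fix v
    have d: "v - (v + \<omega> *\<^sub>R e) = axis i (- (\<gamma> *\<^sub>R \<zeta>))"
      using r0 by (simp add: e_def axis_scale axis_minus \<omega>_def)
    show "g (q x v N) - g (q y (v + \<omega> *\<^sub>R e) N) \<le> ?A"
      using shift_distance[OF z d] lip[of "q x v N" "q y (v + \<omega> *\<^sub>R e) N"] by (simp add: r_def X_def abs_le_iff)
    have d: "v - refl_along e v = axis i ((2 * (v \<bullet> e) / r) *\<^sub>R \<zeta>)"
    proof -
      have "v - refl_along e v = (2 * (v \<bullet> e)) *\<^sub>R e" by (simp add: refl_along_def[OF e1 \<omega>(1)])
      also have "\<dots> = axis i ((2 * (v \<bullet> e) / r) *\<^sub>R \<zeta>)" by (subst (2) e_def) (simp add: axis_scale)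
      finally show ?thesis .
    qed
    have n: "norm ((2 * (v \<bullet> e) / r) *\<^sub>R \<zeta>) \<le> 2 * \<bar>v \<bullet> e\<bar>" using r0 by (simp add: r_def abs_mult)
    show "g (q x v N) - g (q y (refl_along e v) N) \<le> ?A' + ?D * \<bar>v \<bullet> e\<bar>"
      using reflection_distance[OF z d n r(2)] lip[of "q x v N" "q y (refl_along e v) N"] by (simp add: r_def X_def abs_le_iff)
  next
    have "0 \<le> 91/100 * (\<gamma> * T * r) * (X + lam)" "0 \<le> 1033/1000 * (T * X)"
      using t0 lam_bounds T by (auto simp: X_def intro!: mult_nonneg_nonneg add_nonneg_nonneg)
    then show "?A \<le> ?A'" by linarith
    show "0 \<le> ?D" using lam_bounds T E_bounds by simp
  qed (use B in \<open>auto\<close>)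
  also have "\<dots> \<le> f r - rate * f r"
  proof (rule reflection_arithmetic[where y = "K * T\<^sup>2 * amp * r" and \<omega> = \<omega>])
    \<comment> \<open>\<open>\<omega> \<le> 1/4\<close> absorbs the quadratic term:
      \<open>1/2 + 1/32 = 17/32\<close>.\<close>
    have "\<omega>\<^sup>2 \<le> \<omega> * (1/4)" using \<omega> unfolding power2_eq_square by (intro mult_left_mono)
    then show p: "\<omega> / 2 + \<omega>\<^sup>2 / 8 \<le> 17/32 * \<omega>" by simp
    then show "\<omega> / 2 + \<omega>\<^sup>2 / 8 \<le> 17/128" using \<omega> by linarith
    have ax: "amp \<le> X" using lam_r_le(1)[of r] r0 by (simp add: X_def)
    then show "lam \<le> 9/100 * X" using lam_bounds by linarith
    have "20/3 * (K * T\<^sup>2) \<le> \<gamma> * T"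
      using gam_bounds(3) mult_right_mono[OF K(2), of "T\<^sup>2"] by simp
    then have "(20/3 * (K * T\<^sup>2)) * (r * amp) \<le> (\<gamma> * T) * (r * X)"
    proof (rule mult_mono)
      show "r * amp \<le> r * X" using r0 ax by (intro mult_left_mono) auto
    qed (use r0 amp_bounds gam_bounds T in auto)
    then show "20/3 * (K * T\<^sup>2 * amp * r) \<le> \<gamma> * T * r * X" by (simp add: algebra_simps)
    have "T\<^sup>2 * E * r \<le> T\<^sup>2 * (K * amp / 10 ^ 6) * r" using E_bounds r0 by (intro mult_right_mono mult_left_mono) auto
    then show "T\<^sup>2 * E * r \<le> 1 / 10 ^ 6 * (K * T\<^sup>2 * amp * r)" by (simp add: algebra_simps)
    show "rate * f r \<le> 11/1560 * (K * T\<^sup>2 * amp * r)" using rate_f_le r0 by simp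
    have "?D * (\<omega> * (1 + \<omega> / 2)) \<le> ?D * (\<omega> * (9/8))"
      using \<omega> lam_bounds T E_bounds by (intro mult_left_mono) auto
    also have "\<dots> = 9/8 * (24/11 * (\<gamma> * T * r * lam)) + 9/2 * ((\<gamma> * T) * (T\<^sup>2 * E * r))"
      by (simp add: \<omega>_def algebra_simps)
    also have "(\<gamma> * T) * (T\<^sup>2 * E * r) \<le> 1 * (T\<^sup>2 * E * r)"
      using gam_bounds E_bounds r0 by (intro mult_right_mono) auto
    finally show "?D * (\<omega> * (1 + \<omega> / 2)) \<le> 9/8 * (24/11 * (\<gamma> * T * r * lam)) + 9/2 * (T\<^sup>2 * E * r)" by simp
  qed (use t0 lam_bounds T K amp_bounds r0 \<omega> in \<open>auto simp: X_def \<omega>_def\<close>)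
  finally show ?thesis by (simp add: r_def algebra_simps)
qed

lemma one_particle_contraction:
  fixes x y :: "real ^ 'k ^ 'n" and g :: "real ^ 'k ^ 'n \<Rightarrow> real"
  assumes z: "x - y = axis i \<zeta>"
    and g[measurable]: "g \<in> borel_measurable borel" and B: "\<And>a. \<bar>g a\<bar> \<le> B" and lip: "\<And>a b. \<bar>g a - g b\<bar> \<le> rho a b"
  shows "P g x - P g y \<le> (1 - rate) * f (norm \<zeta>)"
proof -
  consider "norm \<zeta> = 0" | "0 < norm \<zeta>" "norm \<zeta> \<le> Rt" | "Rt \<le> norm \<zeta>" using norm_ge_zero[of \<zeta>] by linarith
  then show ?thesis
  proof cases
    case 1
    then have "x - y = 0" using z by (simp add: axis_def vec_eq_iff)
    then show ?thesis using 1 by simp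
  next
    case 2
    then show ?thesis by (rule reflection_contraction[OF z _ _ g B lip])
  next
    case 3
    have int: "integrable lborel (\<lambda>v. gauss v * g (q x v N))" for x
      by (rule integrable_gauss_bounded[OF _ B]) measurable
    have "P g x - P g y = (LINT v|lborel. gauss v * g (q x v N) - gauss v * g (q y v N))"
      unfolding P_def using int by simp
    also have "\<dots> \<le> (LINT v|lborel. ((1 - rate) * f (norm \<zeta>)) * gauss (v :: real ^ 'k ^ 'n))"
    proof (rule integral_mono)
      show "integrable lborel (\<lambda>v. gauss v * g (q x v N) - gauss v * g (q y v N))"
        using int by (intro Bochner_Integration.integrable_diff)
      show "integrable lborel (\<lambda>v :: real ^ 'k ^ 'n. ((1 - rate) * f (norm \<zeta>)) * gauss v)"
        by (intro integrable_mult_right integrable_gauss)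
      fix v
      have "g (q x v N) - g (q y v N) \<le> (1 - rate) * f (norm \<zeta>)"
        using lip[of "q x v N" "q y v N"] synchronous_contraction[OF z 3, of v] by linarith
      from mult_left_mono[OF this gauss_nonneg[of v]]
      show "gauss v * g (q x v N) - gauss v * g (q y v N) \<le> ((1 - rate) * f (norm \<zeta>)) * gauss v"
        by (simp add: algebra_simps)
    qed
    also have "\<dots> = (1 - rate) * f (norm \<zeta>)" by (simp add: integral_gauss)
    finally show ?thesis .
  qed
qed

text \<open>Path coupling: the particles are moved one after the other.\<close>

lemma P_contraction_unit:
  fixes x y :: "real ^ 'k ^ 'n" and g :: "real ^ 'k ^ 'n \<Rightarrow> real"
  assumes g: "g \<in> borel_measurable borel" and B: "\<And>a. \<bar>g a\<bar> \<le> B" and lip: "\<And>a b. \<bar>g a - g b\<bar> \<le> rho a b"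
  shows "\<bar>P g x - P g y\<bar> \<le> (1 - rate) * rho x y"
proof -
  define w where "w A = (\<chi> l. if l \<in> A then y $ l else x $ l)" for A
  have "\<bar>P g x - P g (w A)\<bar> \<le> (1 - rate) * (\<Sum>l\<in>A. f (norm (x $ l - y $ l)))" for A :: "'n set"
  proof (induction A rule: infinite_finite_induct)
    case (insert i A)
    have z: "w A - w (insert i A) = axis i (x $ i - y $ i)"
      using insert by (auto simp: w_def vec_eq_iff axis_def)
    \<comment> \<open>The estimate for one particle is one-sided; both signs of the displacement
      together bound the absolute value.\<close>
    then have z': "w (insert i A) - w A = axis i (- (x $ i - y $ i))"
      by (auto simp: vec_eq_iff axis_def algebra_simps)
    have "\<bar>P g (w A) - P g (w (insert i A))\<bar> \<le> (1 - rate) * f (norm (x $ i - y $ i))"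
      using one_particle_contraction[OF z g B lip] one_particle_contraction[OF z' g B lip]
      unfolding norm_minus_cancel by (intro abs_leI) linarith+
    then show ?case using insert by (simp add: algebra_simps)
  qed (simp_all add: w_def)
  from this[of UNIV] show ?thesis by (simp add: rho_def w_def)
qed

lemma P_contraction:
  fixes x y :: "real ^ 'k ^ 'n" and g :: "real ^ 'k ^ 'n \<Rightarrow> real"
  assumes [measurable]: "g \<in> borel_measurable borel" and B: "\<And>a. \<bar>g a\<bar> \<le> B"
    and lip: "\<And>a b. \<bar>g a - g b\<bar> \<le> C * rho a b" and C: "0 < C"
  shows "\<bar>P g x - P g y\<bar> \<le> C * (1 - rate) * rho x y"
proof -
  let ?g = "\<lambda>a. g a / C"
  have "\<bar>P ?g x - P ?g y\<bar> \<le> (1 - rate) * rho x y"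
  proof (rule P_contraction_unit)
    show "\<bar>?g a\<bar> \<le> B / C" for a using B[of a] C by (simp add: abs_divide divide_right_mono)
    show "\<bar>?g a - ?g b\<bar> \<le> rho a b" for a b
      using lip[of a b] C by (simp add: abs_divide divide_le_eq mult.commute flip: diff_divide_distrib)
  qed measurable
  moreover have "P ?g x = P g x / C" for x unfolding P_def by simp
  ultimately have "\<bar>P g x - P g y\<bar> / C \<le> (1 - rate) * rho x y"
    using C by (simp add: abs_divide flip: diff_divide_distrib)
  then show ?thesis using C by (simp add: pos_divide_le_eq ac_simps)
qed

end

subsection \<open>Iterated kernels\<close>

locale borel_kernel =
  fixes \<kappa> :: "'a::topological_space \<Rightarrow> 'a measure"
  assumes meas: "\<kappa> \<in> measurable borel (subprob_algebra borel)" and prob: "\<And>x. prob_space (\<kappa> x)"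
begin

lemma kernel_pow_measurable: "kernel_pow \<kappa> m \<in> measurable borel (subprob_algebra borel)"
proof (induction m)
  case 0
  then show ?case by (simp add: return_measurable)
next
  case (Suc m)
  then show ?case by (simp add: measurable_bind2[OF Suc meas])
qed

lemma prob_kernel_pow: "prob_space (kernel_pow \<kappa> m x)"
proof (induction m)
  case 0
  then show ?case by (simp add: prob_space_return)
next
  case (Suc m)
  then interpret prob_space "kernel_pow \<kappa> m x" .
  have "sets (kernel_pow \<kappa> m x) = sets borel"
    using kernel_pow_measurable[of m] by (simp add: sets_kernel)
  then have "\<kappa> \<in> measurable (kernel_pow \<kappa> m x) (subprob_algebra borel)"
    using meas by (simp cong: measurable_cong_sets)
  then show ?case using prob by (simp add: prob_space_bind)
qed

lemma sets_kernel_pow [simp]: "sets (kernel_pow \<kappa> m x) = sets borel"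
  using kernel_pow_measurable[of m] by (simp add: sets_kernel)

lemma integral_bind_kernel:
  fixes g :: "'a \<Rightarrow> real"
  assumes k: "k \<in> measurable borel (subprob_algebra borel)"
    and M: "prob_space M" "sets M = sets borel" and g: "g \<in> borel_measurable borel" and B: "\<And>x. \<bar>g x\<bar> \<le> B"
  shows "integral\<^sup>L (bind M k) g = (LINT x|M. integral\<^sup>L (k x) g)"
proof (rule integral_bind[where K = borel and B = B and B' = 1])
  show kM: "k \<in> measurable M (subprob_algebra borel)" using k M(2) by (simp cong: measurable_cong_sets)
  show "finite_measure M" using M(1) by (simp add: prob_space.finite_measure)
  show "AE x in M. emeasure (k x) (space (k x)) \<le> ennreal 1"
  proof (rule AE_I2)
    fix x assume "x \<in> space M"
    then have "subprob_space (k x)" using kM by (rule subprob_space_kernel[rotated])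
    then show "emeasure (k x) (space (k x)) \<le> ennreal 1" by (simp add: subprob_space.emeasure_space_le_1)
  qed
qed (use g B in auto)

lemma measurable_integral_kernel:
  fixes g :: "'a \<Rightarrow> real"
  assumes k: "k \<in> measurable borel (subprob_algebra borel)" and g: "g \<in> borel_measurable borel"
  shows "(\<lambda>x. integral\<^sup>L (k x) g) \<in> borel_measurable borel"
  using measurable_compose[OF k integral_measurable_subprob_algebra[OF g]] by simp

lemma abs_integral_le:
  fixes g :: "'a \<Rightarrow> real"
  assumes "prob_space M" "sets M = sets borel" and [measurable]: "g \<in> borel_measurable borel" and B: "\<And>x. \<bar>g x\<bar> \<le> B"
  shows "\<bar>integral\<^sup>L M g\<bar> \<le> B"
proof -
  interpret prob_space M by fact
  have [measurable]: "g \<in> borel_measurable M" using assms by (simp cong: measurable_cong_sets)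
  have i: "integrable M g" by (rule integrable_const_bound[of _ B]) (use B in auto)
  have "\<bar>integral\<^sup>L M g\<bar> \<le> (LINT x|M. \<bar>g x\<bar>)" by (rule integral_abs_bound)
  also have "\<dots> \<le> (LINT x|M. B)" using i B by (intro integral_mono) auto
  finally show ?thesis by (simp add: prob_space)
qed

lemma sets_kernel_eq: "sets (\<kappa> x) = sets borel"
  using meas by (simp add: sets_kernel)

text \<open>\<open>kernel_pow\<close> appends the new step at the end, so the kernel acts on the
  test function first. This lets the last step regularize \<open>g\<close> and leaves contraction to
  the earlier ones.\<close>

lemma integral_kernel_pow_Suc:
  fixes g :: "'a \<Rightarrow> real"
  assumes "g \<in> borel_measurable borel" "\<And>x. \<bar>g x\<bar> \<le> B"
  shows "integral\<^sup>L (kernel_pow \<kappa> (Suc m) x) g = integral\<^sup>L (kernel_pow \<kappa> m x) (\<lambda>y. integral\<^sup>L (\<kappa> y) g)"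
  using integral_bind_kernel[OF meas prob_kernel_pow _ assms] by simp

text \<open>The induction runs over all bounded measurable \<open>g\<close>, since each step
  replaces \<open>g\<close> by its image under the kernel.\<close>

lemma integral_invariant:
  fixes g :: "'a \<Rightarrow> real"
  assumes inv: "invariant_prob \<kappa> \<mu>" and "g \<in> borel_measurable borel" "\<And>x. \<bar>g x\<bar> \<le> B"
  shows "(LINT x|\<mu>. integral\<^sup>L (kernel_pow \<kappa> m x) g) = integral\<^sup>L \<mu> g"
  using assms(2,3)
proof (induction m arbitrary: g)
  case 0
  then show ?case by (simp add: integral_return)
next
  case (Suc m)
  let ?g = "\<lambda>y. integral\<^sup>L (\<kappa> y) g"
  have g: "?g \<in> borel_measurable borel" "\<And>y. \<bar>?g y\<bar> \<le> B"
    using measurable_integral_kernel[OF meas] abs_integral_le[OF prob sets_kernel_eq] Suc.prems by auto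
  have "(LINT x|\<mu>. integral\<^sup>L (kernel_pow \<kappa> (Suc m) x) g) = (LINT x|\<mu>. integral\<^sup>L (kernel_pow \<kappa> m x) ?g)"
    by (simp only: integral_kernel_pow_Suc[OF Suc.prems])
  also have "\<dots> = integral\<^sup>L \<mu> ?g" by (rule Suc.IH[OF g])
  also have "\<dots> = integral\<^sup>L (bind \<mu> \<kappa>) g"
    using inv Suc.prems by (subst integral_bind_kernel[OF meas]) (auto simp: invariant_prob_def borel_prob_def)
  also have "\<dots> = integral\<^sup>L \<mu> g" using inv by (simp add: invariant_prob_def)
  finally show ?case .
qed

end

section \<open>The uHMC kernel and its iterates on test functions\<close>

context hmc_contraction
begin

text \<open>Joint measurability in start and velocity is what makes \<open>kern\<close> a measurable
  kernel.\<close>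

lemma measurable_q_pair [measurable]:
  "(\<lambda>p :: (real ^ 'k ^ 'n) \<times> (real ^ 'k ^ 'n). q (fst p) (snd p) j) \<in> borel_measurable (borel \<Otimes>\<^sub>M borel)"
proof (induction j rule: less_induct)
  case (less j)
  have [measurable]: "(F :: real ^ 'k ^ 'n \<Rightarrow> real ^ 'k ^ 'n) \<in> borel_measurable borel"
    using F_has_derivative by (rule borel_measurable_if_has_derivative)
  have "(\<lambda>p :: (real ^ 'k ^ 'n) \<times> (real ^ 'k ^ 'n). F (q (fst p) (snd p) i)) \<in> borel_measurable (borel \<Otimes>\<^sub>M borel)"
    if "i < j" for i
    using less[OF that] by measurable
  then show ?case
    by (subst vpos_closed)
      (intro borel_measurable_diff borel_measurable_add borel_measurable_scaleR borel_measurable_sum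
        borel_measurable_const measurable_fst'' measurable_snd'' measurable_ident, auto)
qed

definition kern :: "real ^ 'k ^ 'n \<Rightarrow> (real ^ 'k ^ 'n) measure" where
  "kern x = distr std_gaussian borel (\<lambda>v. q x v N)"

lemma borel_kernel_kern: "borel_kernel (kern :: real ^ 'k ^ 'n \<Rightarrow> (real ^ 'k ^ 'n) measure)"
proof (rule borel_kernel.intro)
  have "case_prod (\<lambda>x v. q x v N) \<in> measurable (borel \<Otimes>\<^sub>M std_gaussian) (borel :: (real ^ 'k ^ 'n) measure)"
  proof -
    have "sets (borel \<Otimes>\<^sub>M std_gaussian) = sets ((borel :: (real ^ 'k ^ 'n) measure) \<Otimes>\<^sub>M (borel :: (real ^ 'k ^ 'n) measure))"
      by (intro sets_pair_measure_cong) auto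
    then show ?thesis
      using measurable_q_pair[of N] by (simp add: split_beta' cong: measurable_cong_sets)
  qed
  moreover have "(\<lambda>x. std_gaussian) \<in> measurable borel (subprob_algebra (std_gaussian :: (real ^ 'k ^ 'n) measure))"
    using prob_space_imp_subprob_space[OF prob_space_std_gaussian]
    by (intro measurable_const) (simp add: space_subprob_algebra)
  ultimately show "(kern :: real ^ 'k ^ 'n \<Rightarrow> (real ^ 'k ^ 'n) measure) \<in> measurable borel (subprob_algebra borel)"
    unfolding kern_def[abs_def] by (rule measurable_distr2)
  show "prob_space (kern x)" for x :: "real ^ 'k ^ 'n"
    unfolding kern_def by (rule prob_space.prob_space_distr[OF prob_space_std_gaussian]) simp
qed

lemma integral_kern:
  assumes [measurable]: "g \<in> borel_measurable borel"
  shows "integral\<^sup>L (kern x) g = P g x"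
  unfolding kern_def P_def by (simp add: integral_distr integral_std_gaussian)

text \<open>Each application of \<open>kern\<close> multiplies the Lipschitz constant of the test
  function for \<open>rho\<close> by \<open>1 - rate \<le> exp (- rate)\<close>, so the induction
  varies \<open>g\<close> and \<open>C\<close>.\<close>

lemma kernel_pow_contraction:
  fixes x y :: "real ^ 'k ^ 'n"
  assumes "g \<in> borel_measurable borel" "\<And>a. \<bar>g a\<bar> \<le> B" "\<And>a b. \<bar>g a - g b\<bar> \<le> C * rho a b" "0 < C"
  shows "\<bar>integral\<^sup>L (kernel_pow kern m x) g - integral\<^sup>L (kernel_pow kern m y) g\<bar> \<le> C * exp (- rate * real m) * rho x y"
  using assms
proof (induction m arbitrary: g C)
  case 0
  then show ?case by (simp add: integral_return)
next
  case (Suc m)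
  interpret kern: borel_kernel "kern :: real ^ 'k ^ 'n \<Rightarrow> _" by (rule borel_kernel_kern)
  let ?g = "\<lambda>y. integral\<^sup>L (kern y) g"
  have g: "?g \<in> borel_measurable borel" "\<And>y. \<bar>?g y\<bar> \<le> B"
    using kern.measurable_integral_kernel[OF kern.meas] kern.abs_integral_le[OF kern.prob kern.sets_kernel_eq] Suc.prems by auto
  have rho_nn: "0 \<le> rho a b" for a b :: "real ^ 'k ^ 'n"
    unfolding rho_def using lam_bounds f_ge by (intro sum_nonneg) (meson mult_nonneg_nonneg norm_ge_zero order_trans less_imp_le)
  have lip: "\<bar>?g a - ?g b\<bar> \<le> (C * exp (- rate)) * rho a b" for a b
  proof -
    have "\<bar>?g a - ?g b\<bar> \<le> C * (1 - rate) * rho a b"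
      unfolding integral_kern[OF Suc.prems(1)] by (rule P_contraction[OF Suc.prems])
    also have "\<dots> \<le> C * exp (- rate) * rho a b"
      using exp_ge_add_one_self[of "- rate"] Suc.prems(4) rho_nn by (intro mult_right_mono mult_left_mono) auto
    finally show ?thesis .
  qed
  have "\<bar>integral\<^sup>L (kernel_pow kern m x) ?g - integral\<^sup>L (kernel_pow kern m y) ?g\<bar>
      \<le> (C * exp (- rate)) * exp (- rate * real m) * rho x y"
    using Suc.prems(4) by (intro Suc.IH[OF g lip]) simp
  also have "(C * exp (- rate)) * exp (- rate * real m) = C * exp (- rate * real (Suc m))"
    by (simp add: algebra_simps flip: exp_add)
  finally show ?case
    unfolding kern.integral_kernel_pow_Suc[OF Suc.prems(1,2)] .
qed

lemma norm1_le_rho: "norm1 (x - y) \<le> 1 / lam * rho x y"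
proof -
  have "lam * norm1 (x - y) = (\<Sum>i\<in>UNIV. lam * norm (x $ i - y $ i))" by (simp add: norm1_def sum_distrib_left)
  also have "\<dots> \<le> rho x y" unfolding rho_def by (intro sum_mono f_ge) auto
  finally show ?thesis using lam_bounds by (simp add: field_simps)
qed

lemma rho_le_norm1: "rho x y \<le> (1 + lam) * norm1 (x - y)"
  unfolding rho_def norm1_def sum_distrib_left by (intro sum_mono order_trans[OF f_le]) auto

definition CTV :: real where
  "CTV = sqrt (1 / T\<^sup>2 + 34 * real CARD('k) * (LH + 8 * \<epsilon> * LHt)\<^sup>2 * T ^ 4)"

lemma CTV_pos: "0 < CTV"
  unfolding CTV_def using T by (intro real_sqrt_gt_zero add_pos_nonneg) auto

text \<open>The last step makes \<open>g\<close> Lipschitz with constant \<open>CTV\<close> for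
  \<open>norm1\<close>, hence \<open>CTV / lam\<close> for \<open>rho\<close>. The other
  \<open>m\<close> steps contract, and returning by \<open>rho \<le> (1 + lam) * norm1\<close> costs
  at most \<open>3/2\<close>. As \<open>1 / lam\<close> will be \<open>M\<close>, these are the
  constants of the theorem.\<close>

lemma kernel_pow_Suc_lipschitz:
  fixes x y :: "real ^ 'k ^ 'n"
  assumes [measurable]: "g \<in> borel_measurable borel" and g: "\<And>a. 0 \<le> g a" "\<And>a. g a \<le> 1"
  shows "\<bar>integral\<^sup>L (kernel_pow kern (Suc m) x) g - integral\<^sup>L (kernel_pow kern (Suc m) y) g\<bar>
    \<le> 3/2 * CTV * (1 / lam) * exp (- rate * real m) * ell1 x y"
proof -
  interpret kern: borel_kernel "kern :: real ^ 'k ^ 'n \<Rightarrow> _" by (rule borel_kernel_kern)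
  let ?g = "\<lambda>y. integral\<^sup>L (kern y) g"
  have gB: "\<bar>g a\<bar> \<le> 1" for a using g[of a] by simp
  have g': "?g \<in> borel_measurable borel" "\<And>y. \<bar>?g y\<bar> \<le> 1"
    using kern.measurable_integral_kernel[OF kern.meas assms(1)]
      kern.abs_integral_le[OF kern.prob kern.sets_kernel_eq assms(1) gB] by auto
  have lip: "\<bar>?g a - ?g b\<bar> \<le> (CTV * (1 / lam)) * rho a b" for a b
  proof -
    have "\<bar>?g a - ?g b\<bar> \<le> CTV * norm1 (a - b)"
      unfolding integral_kern[OF assms(1)] P_def CTV_def using g by (rule uhmc_one_step_total_variation[OF assms(1)])
    also have "\<dots> \<le> CTV * (1 / lam * rho a b)" using CTV_pos by (intro mult_left_mono norm1_le_rho) auto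
    finally show ?thesis by simp
  qed
  have C: "0 < CTV * (1 / lam)" using CTV_pos lam_bounds by simp
  have "\<bar>integral\<^sup>L (kernel_pow kern (Suc m) x) g - integral\<^sup>L (kernel_pow kern (Suc m) y) g\<bar>
      \<le> CTV * (1 / lam) * exp (- rate * real m) * rho x y"
    unfolding kern.integral_kernel_pow_Suc[OF assms(1) gB] by (rule kernel_pow_contraction[OF g' lip C])
  also have "\<dots> \<le> CTV * (1 / lam) * exp (- rate * real m) * (3/2 * norm1 (x - y))"
  proof (intro mult_left_mono)
    have "(1 + lam) * norm1 (x - y) \<le> 3/2 * norm1 (x - y)" using lam_bounds by (intro mult_right_mono) auto
    then show "rho x y \<le> 3/2 * norm1 (x - y)" using rho_le_norm1[of x y] by linarith
  qed (use CTV_pos lam_bounds in simp)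
  finally show ?thesis by (simp add: ell1_eq_norm1)
qed

end

section \<open>Couplings, the Wasserstein distance and the final estimate\<close>

lemma borel_measurable_vec_nth_vec [measurable]: "(\<lambda>x :: real ^ 'k ^ 'n. x $ i) \<in> borel_measurable borel"
  by (intro borel_measurable_continuous_onI linear_continuous_on bounded_linear_vec_nth)

lemma integral_diff_le_coupling:
  fixes u :: "real ^ 'k ^ 'n \<Rightarrow> real"
  assumes \<gamma>: "\<gamma> \<in> couplings \<mu> \<nu>" and u[measurable]: "u \<in> borel_measurable borel" and B: "\<And>x. \<bar>u x\<bar> \<le> B"
    and lip: "\<And>x y. \<bar>u x - u y\<bar> \<le> C * ell1 x y" and C: "0 \<le> C"
  shows "ennreal \<bar>integral\<^sup>L \<mu> u - integral\<^sup>L \<nu> u\<bar> \<le> ennreal C * (\<integral>\<^sup>+p. ennreal (ell1 (fst p) (snd p)) \<partial>\<gamma>)"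
proof -
  have \<gamma>': "prob_space \<gamma>" and sets: "sets \<gamma> = sets (borel \<Otimes>\<^sub>M borel)"
    and m: "\<mu> = distr \<gamma> borel fst" "\<nu> = distr \<gamma> borel snd"
    using \<gamma> by (auto simp: couplings_def)
  interpret prob_space \<gamma> by fact
  have [measurable]: "fst \<in> measurable \<gamma> borel" "snd \<in> measurable \<gamma> borel"
    using sets by (simp_all cong: measurable_cong_sets)
  have i: "integrable \<gamma> (\<lambda>p. u (fst p))" "integrable \<gamma> (\<lambda>p. u (snd p))"
    by (rule integrable_const_bound[of _ B]; use B in auto)+
  have "integral\<^sup>L \<mu> u - integral\<^sup>L \<nu> u = (LINT p|\<gamma>. u (fst p) - u (snd p))"
    unfolding m using i by (simp add: integral_distr)
  then have "ennreal \<bar>integral\<^sup>L \<mu> u - integral\<^sup>L \<nu> u\<bar> \<le> (\<integral>\<^sup>+p. ennreal \<bar>u (fst p) - u (snd p)\<bar> \<partial>\<gamma>)"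
    using integral_norm_bound_ennreal[of \<gamma> "\<lambda>p. u (fst p) - u (snd p)"] i by simp
  also have "\<dots> \<le> (\<integral>\<^sup>+p. ennreal C * ennreal (ell1 (fst p) (snd p)) \<partial>\<gamma>)"
    using lip C by (intro nn_integral_mono) (simp add: ell1_eq_norm1 flip: ennreal_mult)
  also have "\<dots> = ennreal C * (\<integral>\<^sup>+p. ennreal (ell1 (fst p) (snd p)) \<partial>\<gamma>)"
  proof (rule nn_integral_cmult)
    show "(\<lambda>p. ennreal (ell1 (fst p) (snd p))) \<in> borel_measurable \<gamma>"
      unfolding ell1_def by measurable
  qed
  finally show ?thesis .
qed


text \<open>In the application \<nu> is the image of \<eta> under \<open>m + 1\<close> steps:
  couplings concern the initial laws, total variation the final ones. Dividing by \<open>C\<close>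
  reduces the claim to a lower bound for an infimum; couplings of infinite cost satisfy it
  trivially.\<close>

lemma TV_le_W1:
  fixes \<mu> \<nu> :: "(real ^ 'k ^ 'n) measure"
  assumes C: "0 < C"
    and le: "\<And>\<gamma> A. \<gamma> \<in> couplings \<mu> \<eta> \<Longrightarrow> A \<in> sets borel \<Longrightarrow>
      ennreal \<bar>measure \<mu> A - measure \<nu> A\<bar> \<le> ennreal C * (\<integral>\<^sup>+p. ennreal (ell1 (fst p) (snd p)) \<partial>\<gamma>)"
  shows "ennreal (TV \<mu> \<nu>) \<le> ennreal C * W1_ell1 \<mu> \<eta>"
proof (cases "TV \<mu> \<nu> \<le> 0")
  case True
  then show ?thesis by (simp add: ennreal_neg)
next
  case False
  define t where "t = TV \<mu> \<nu> / C"
  have t: "ennreal (TV \<mu> \<nu>) = ennreal C * ennreal t"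
    using C False by (simp add: t_def flip: ennreal_mult)
  have "ennreal t \<le> W1_ell1 \<mu> \<eta>"
    unfolding W1_ell1_def
  proof (rule INF_greatest)
    fix \<gamma> assume \<gamma>: "\<gamma> \<in> couplings \<mu> \<eta>"
    let ?I = "\<integral>\<^sup>+p. ennreal (ell1 (fst p) (snd p)) \<partial>\<gamma>"
    show "ennreal t \<le> ?I"
    proof (cases ?I)
      case (real i)
      have "TV \<mu> \<nu> \<le> C * i"
        unfolding TV_def
      proof (rule cSUP_least)
        fix A :: "(real ^ 'k ^ 'n) set" assume "A \<in> sets borel"
        from le[OF \<gamma> this] show "\<bar>measure \<mu> A - measure \<nu> A\<bar> \<le> C * i"
          using C real by (simp flip: ennreal_mult)
      qed auto
      then have "t \<le> i" using C by (simp add: t_def field_simps)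
      then show ?thesis using real by (simp add: ennreal_leI)
    qed simp
  qed
  then show ?thesis unfolding t by (intro mult_left_mono) auto
qed

theorem theorem9:
  fixes V W :: "real ^ 'k \<Rightarrow> real"
    and \<epsilon> L Lt LH LHt R K T h1 h M c :: real
    and \<pi>t :: "real ^ 'k ^ 'n \<Rightarrow> (real ^ 'k ^ 'n) measure"
    and \<mu>t \<nu> :: "(real ^ 'k ^ 'n) measure"
    and m :: nat
  assumes "\<epsilon> \<ge> 0"
    and "C3 V" and "C3 W"
    and "\<forall>\<^sub>F y in nhds 0. V 0 \<le> V y" and "V 0 = 0"
    and "bdd_above (range (\<lambda>x. norm (D2 V x)))" and "L = (SUP x. norm (D2 V x))"
    and "bdd_above (range (\<lambda>x. norm (D2 W x)))" and "Lt = (SUP x. norm (D2 W x))"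
    and "bdd_above (range (\<lambda>x. norm (D3 V x)))" and "LH = (SUP x. norm (D3 V x))"
    and "bdd_above (range (\<lambda>x. norm (D3 W x)))" and "LHt = (SUP x. norm (D3 W x))"
    and "R \<ge> 0" and "K > 0"
    and "\<And>a b. norm (a - b) \<ge> R \<Longrightarrow> (a - b) \<bullet> (grad V a - grad V b) \<ge> K * (norm (a - b))\<^sup>2"
    and "T > 0" and "h1 \<ge> 0"
    and "L * (T + h1)\<^sup>2 \<le> 3/5 *
           (if R = 0 then min (3 * K / (10 * L)) (1/4)
            else min (min (3 * K / (10 * L)) (1/4))
                   (3 * K / (256 * 5 * 2 ^ 6 * L * R\<^sup>2 * (L + K))))"
    and "h1 \<le> K * T / (525 * L + 235 * K)"
    and "\<epsilon> * Lt < min (K / 6)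
           (1/2 * (K / (36 * 149))\<^sup>2 * (T + 8 * R * sqrt ((L + K) / K))\<^sup>2
              * exp (- 40 * (R / T) * sqrt ((L + K) / K)))"
    and "0 < h" and "h \<le> h1" and "T / h \<in> \<nat>"
    and "(L + 4 * \<epsilon> * Lt) * (T\<^sup>2 + T * h) \<le> 1/6"
    and "\<pi>t = uhmc_kernel (mean_field_potential V W \<epsilon>) T h"
    and "invariant_prob \<pi>t \<mu>t"
    and "M = exp (5/2 * (1 + 4 * R / T * sqrt ((L + K) / K)))"
    and "c = K * T\<^sup>2 / 156 * exp (- 10 * (R / T) * sqrt ((L + K) / K))"
    and "borel_prob \<nu>"
  shows "ennreal (TV \<mu>t (bind \<nu> (kernel_pow \<pi>t (m + 1))))
     \<le> ennreal (3/2 * sqrt (1 / T\<^sup>2 + 34 * real CARD('k) * (LH + 8 * \<epsilon> * LHt)\<^sup>2 * T ^ 4) * M)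
         * W1_ell1 \<mu>t \<nu> * ennreal (exp (- c * real m))"
proof -
  interpret V: C3_bounded V L LH
    using assms(2,6,7,10,11) by unfold_locales
  interpret W: C3_bounded W Lt LHt
    using assms(3,8,9,12,13) by unfold_locales
  have R: "R \<ge> 0" and K: "K > 0" and T: "T > 0" and h1: "h1 \<ge> 0" and h: "0 < h" using assms by blast+
  have conv: "K * (norm (a - b))\<^sup>2 \<le> (a - b) \<bullet> (grad V a - grad V b)" if "R \<le> norm (a - b)" for a b
    using assms(16) that by blast
  \<comment> \<open>Convexity between 0 and a point of norm \<open>R + 1\<close> meets the Lipschitz
    bound of the gradient.\<close>
  have KL: "K \<le> L"
  proof -
    obtain a :: "real ^ 'k" where a: "norm a = R + 1" using vector_choose_size[of "R + 1"] R by auto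
    have "K * (norm a)\<^sup>2 \<le> a \<bullet> (grad V a - grad V 0)" using conv[of a 0] a by simp
    also have "\<dots> \<le> norm a * (L * norm a)"
      using norm_cauchy_schwarz[of a "grad V a - grad V 0"] V.grad_lipschitz[of a 0]
        mult_left_mono[of "norm (grad V a - grad V 0)" "L * norm a" "norm a"] by simp
    finally have "K * (norm a)\<^sup>2 \<le> L * (norm a)\<^sup>2" by (simp add: power2_eq_square ac_simps)
    then show ?thesis using a R by (simp add: mult_le_cancel_right)
  qed
  have L: "0 < L" using K KL by linarith
  define s where "s = sqrt ((L + K) / K)"
  have s2: "s\<^sup>2 = (L + K) / K" using K L by (simp add: s_def)
  have s1: "1 \<le> s" unfolding s_def using K L by simp
  define Rt where "Rt = 8 * R * s"
  have Rt: "0 \<le> Rt" "8 * R \<le> Rt" using R s1 mult_left_mono[of 1 s "8 * R"] by (auto simp: Rt_def)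
  have Tle: "L * T\<^sup>2 \<le> L * (T + h1)\<^sup>2" using L T h1 by (intro mult_left_mono power_mono) auto
  \<comment> \<open>For \<open>R = 0\<close> the third member has denominator 0 and stands for
    infinity, so it is left out.\<close>
  let ?min = "if R = 0 then min (3 * K / (10 * L)) (1/4)
            else min (min (3 * K / (10 * L)) (1/4)) (3 * K / (256 * 5 * 2 ^ 6 * L * R\<^sup>2 * (L + K)))"
  have m: "(if b then min y z else min (min y z) w) \<le> y" "(if b then min y z else min (min y z) w) \<le> z"
    "\<not> b \<Longrightarrow> (if b then min y z else min (min y z) w) \<le> w" for b and y z w :: real by auto
  have LT: "L * T\<^sup>2 \<le> 3/5 * ?min" using Tle assms(19) by linarith
  have LT1: "L * T\<^sup>2 \<le> 3/20"
  proof -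
    have "?min \<le> 1/4" by (rule m(2))
    then show ?thesis using LT by linarith
  qed
  have LT2: "L\<^sup>2 * T\<^sup>2 \<le> 9/50 * K"
  proof -
    have "?min \<le> 3 * K / (10 * L)" by (rule m(1))
    then have "L * T\<^sup>2 \<le> 3/5 * (3 * K / (10 * L))" using LT by linarith
    then have "L * (L * T\<^sup>2) \<le> L * (3/5 * (3 * K / (10 * L)))" using L by (intro mult_left_mono) auto
    then show ?thesis using L by (simp add: power2_eq_square)
  qed
  \<comment> \<open>\<open>Rt\<^sup>2 = 64 * R\<^sup>2 * (L + K) / K\<close> turns the third member
    of the minimum into a bound on the square:
    \<open>64 * 9/409600 = (3/80)\<^sup>2\<close>.\<close>
  have LT3: "L * T * Rt \<le> 3/80"
  proof (cases "R = 0")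
    case False
    then have R0: "0 < R" using R by simp
    have "?min \<le> 3 * K / (256 * 5 * 2 ^ 6 * L * R\<^sup>2 * (L + K))" using False by (rule m(3))
    then have "L * T\<^sup>2 \<le> 3/5 * (3 * K / (256 * 5 * 2 ^ 6 * L * R\<^sup>2 * (L + K)))" using LT by linarith
    moreover define Y where "Y = L * R\<^sup>2 * (L + K)"
    ultimately have "L * T\<^sup>2 \<le> 9 * K / (409600 * Y)" by (simp add: mult.assoc)
    moreover have Y: "0 < Y" using L K R0 by (simp add: Y_def)
    ultimately have "L * T\<^sup>2 * Y \<le> 9/409600 * K" by (simp add: field_simps)
    then have "L\<^sup>2 * T\<^sup>2 * R\<^sup>2 * ((L + K) / K) \<le> 9/409600"
      using K unfolding Y_def by (simp add: field_simps power2_eq_square)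
    then have "(L * T * Rt)\<^sup>2 \<le> (3/80)\<^sup>2"
      unfolding Rt_def power_mult_distrib s2 by (simp add: power2_eq_square ac_simps)
    then show ?thesis by (rule power2_le_imp_le) simp
  qed (simp add: Rt_def)
  \<comment> \<open>One factor \<open>K * T\<^sup>2\<close> is at most \<open>3/20\<close>, and
    \<open>(1 + r)\<^sup>2 \<le> exp (2 * r)\<close> leaves \<open>exp (- 3 * r)\<close> of the
    given decay, which is below \<open>exp (- (5/4) * r)\<close>.\<close>
  have small: "4 * \<epsilon> * Lt \<le> K * exp (- (5/4) * (Rt / T)) / 10 ^ 6"
  proof -
    define r where "r = Rt / T"
    have r0: "0 \<le> r" using Rt T by (simp add: r_def)
    have e1: "- 40 * (R / T) * s = - 5 * r" by (simp add: r_def Rt_def)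
    have e2: "T + 8 * R * s = T * (1 + r)" using T by (simp add: r_def Rt_def field_simps)
    have "\<epsilon> * Lt \<le> 1/2 * (K / (36 * 149))\<^sup>2 * (T * (1 + r))\<^sup>2 * exp (- 5 * r)"
      using assms(21) unfolding s_def[symmetric] e1 e2 by simp
    also have "\<dots> = 1/2 * (1 / (36 * 149))\<^sup>2 * (K * (K * T\<^sup>2) * ((1 + r)\<^sup>2 * exp (- 5 * r)))"
      by (simp add: power_mult_distrib power_divide power2_eq_square)
    also have "\<dots> \<le> 1/2 * (1 / (36 * 149))\<^sup>2 * (K * (3/20) * exp (- (5/4) * r))"
    proof (intro mult_left_mono mult_mono)
      show "K * T\<^sup>2 \<le> 3/20" using LT1 mult_right_mono[OF KL, of "T\<^sup>2"] by simp
      have "(1 + r)\<^sup>2 \<le> (exp r)\<^sup>2" using r0 exp_ge_add_one_self[of r] by (intro power_mono) auto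
      then have "(1 + r)\<^sup>2 * exp (- 5 * r) \<le> (exp r)\<^sup>2 * exp (- 5 * r)" by (intro mult_right_mono) auto
      also have "\<dots> = exp (- 3 * r)" by (simp add: power2_eq_square flip: exp_add)
      also have "\<dots> \<le> exp (- (5/4) * r)" using r0 by simp
      finally show "(1 + r)\<^sup>2 * exp (- 5 * r) \<le> exp (- (5/4) * r)" .
    qed (use K in auto)
    finally have "\<epsilon> * Lt \<le> 1/2 * (1 / (36 * 149))\<^sup>2 * (K * (3/20) * exp (- (5/4) * r))" .
    moreover have "1/2 * (1 / (36 * 149))\<^sup>2 * (K * (3/20) * exp (- (5/4) * r)) \<le> 1 / 4000000 * (K * exp (- (5/4) * r))"
    proof -
      have "1/2 * (1 / (36 * 149))\<^sup>2 * (K * (3/20) * exp (- (5/4) * r)) = (3/40 * (1 / (36 * 149))\<^sup>2) * (K * exp (- (5/4) * r))"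
        by simp
      also have "\<dots> \<le> 1 / 4000000 * (K * exp (- (5/4) * r))"
        using K by (intro mult_right_mono) (auto simp: power2_eq_square)
      finally show ?thesis .
    qed
    ultimately have "\<epsilon> * Lt \<le> 1 / 4000000 * (K * exp (- (5/4) * r))" by (rule order_trans)
    then show ?thesis by (simp add: r_def)
  qed
  obtain N :: nat where N: "T / h = real N" using assms(24) by (auto simp: Nats_def)
  then have TN: "T = real N * h" using h by (simp add: field_simps)
  have LamT: "(L + 4 * \<epsilon> * Lt) * T\<^sup>2 \<le> 1/6"
  proof -
    have "(L + 4 * \<epsilon> * Lt) * T\<^sup>2 \<le> (L + 4 * \<epsilon> * Lt) * (T\<^sup>2 + T * h)"
      using L assms(1) W.L_nonneg T h by (intro mult_left_mono) auto
    then show ?thesis using assms(25) by linarith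
  qed
  interpret mf: mean_field "grad V" "grad W" "hess V" "hess W" \<epsilon> L Lt LH LHt
    by unfold_locales
      (use assms(1) V.L_nonneg V.LH_nonneg W.L_nonneg W.LH_nonneg V.grad_has_derivative W.grad_has_derivative
        V.norm_hess_le W.norm_hess_le V.norm_hess_diff_le W.norm_hess_diff_le in auto)
  interpret H: hmc_contraction "grad V" "grad W" "hess V" "hess W" \<epsilon> L Lt LH LHt h T N K R Rt
    by unfold_locales
      (use h T TN LamT K KL Rt conv LT1 LT2 LT3 small in \<open>auto simp: mf.\<Lambda>_def\<close>)
  have grad: "grad (mean_field_potential V W \<epsilon>) = (mf_force (grad V) (grad W) \<epsilon> :: real ^ 'k ^ 'n \<Rightarrow> _)"
    by (intro ext grad_mean_field_potential V.has_derivative_inner_grad W.has_derivative_inner_grad)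
  \<comment> \<open>\<open>T\<close> is a grid time, where the solution of the differential
    equations is given by the recursion.\<close>
  have ker: "\<pi>t = H.kern"
  proof
    fix x :: "real ^ 'k ^ 'n"
    have "verlet_position (mean_field_potential V W \<epsilon>) h T x v = H.q x v N" for v
      using verlet_position_eq[OF h, of "mean_field_potential V W \<epsilon>" N x v] by (simp add: grad TN)
    then show "\<pi>t x = H.kern x" by (simp add: assms(26) uhmc_kernel_def H.kern_def)
  qed
  interpret kern: borel_kernel "H.kern :: real ^ 'k ^ 'n \<Rightarrow> _" by (rule H.borel_kernel_kern)
  \<comment> \<open>The exponents agree because \<open>5/4 * Rt = 10 * R * s\<close>.\<close>
  have M: "M = 1 / H.lam"
  proof -
    have "H.lam = exp (- (5/2) - 5/4 * (Rt / T))"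
      unfolding H.lam_def H.amp_def by (simp flip: exp_add)
    also have "- (5/2) - 5/4 * (Rt / T) = - (5/2 * (1 + 4 * R / T * s))"
      by (simp add: Rt_def field_simps)
    finally have "H.lam = 1 / M" unfolding assms(28) s_def by (simp add: exp_minus inverse_eq_divide)
    then show ?thesis by simp
  qed
  have c: "c = H.rate"
  proof -
    have "- 10 * (R / T) * s = - (5/4) * (Rt / T)" by (simp add: Rt_def)
    then show ?thesis unfolding assms(29) H.rate_def H.amp_def s_def by simp
  qed
  have \<mu>: "prob_space \<mu>t" "sets \<mu>t = sets borel" and \<nu>: "prob_space \<nu>" "sets \<nu> = sets borel"
    using assms(27,30) by (auto simp: invariant_prob_def borel_prob_def)
  let ?C = "3/2 * H.CTV * M * exp (- c * real m)"
  have M0: "0 < M" using M H.lam_bounds by simp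
  have C: "0 < ?C" using M0 H.CTV_pos by simp
  have "ennreal (TV \<mu>t (bind \<nu> (kernel_pow \<pi>t (m + 1)))) \<le> ennreal ?C * W1_ell1 \<mu>t \<nu>"
  proof (rule TV_le_W1[OF C])
    fix \<gamma> and A :: "(real ^ 'k ^ 'n) set"
    assume \<gamma>: "\<gamma> \<in> couplings \<mu>t \<nu>" and A: "A \<in> sets borel"
    define g :: "real ^ 'k ^ 'n \<Rightarrow> real" where "g = indicator A"
    have g: "g \<in> borel_measurable borel" "\<And>a. 0 \<le> g a" "\<And>a. g a \<le> 1" "\<And>a. \<bar>g a\<bar> \<le> 1"
      using A by (auto simp: g_def indicator_def)
    \<comment> \<open>The probability of \<open>A\<close> after \<open>m + 1\<close> steps. By
      invariance its integral against \<open>\<mu>t\<close> is the measure of \<open>A\<close>, so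
      both measures of \<open>A\<close> are integrals of one Lipschitz function.\<close>
    define u where "u x = integral\<^sup>L (kernel_pow H.kern (Suc m) x) g" for x
    note km = kern.kernel_pow_measurable[of "Suc m"]
    have u: "u \<in> borel_measurable borel" "\<And>x. \<bar>u x\<bar> \<le> 1"
      unfolding u_def
      by (rule kern.measurable_integral_kernel[OF km g(1)],
          rule kern.abs_integral_le[OF kern.prob_kernel_pow kern.sets_kernel_pow g(1,4)])
    have "measure \<mu>t A = integral\<^sup>L \<mu>t g" using A \<mu>(2) by (simp add: g_def)
    also have "\<dots> = integral\<^sup>L \<mu>t u"
      unfolding u_def using kern.integral_invariant[OF _ g(1,4), of \<mu>t "Suc m"] assms(27) ker by metis
    finally have mA: "measure \<mu>t A = integral\<^sup>L \<mu>t u" .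
    have "sets (bind \<nu> (kernel_pow H.kern (Suc m))) = sets borel"
      using prob_space.not_empty[OF \<nu>(1)] by (intro sets_bind kern.sets_kernel_pow)
    then have "measure (bind \<nu> (kernel_pow H.kern (Suc m))) A = integral\<^sup>L (bind \<nu> (kernel_pow H.kern (Suc m))) g"
      using A by (simp add: g_def)
    also have "\<dots> = integral\<^sup>L \<nu> u"
      unfolding u_def by (rule kern.integral_bind_kernel[OF km \<nu> g(1,4)])
    finally have nA: "measure (bind \<nu> (kernel_pow H.kern (Suc m))) A = integral\<^sup>L \<nu> u" .
    have "ennreal \<bar>integral\<^sup>L \<mu>t u - integral\<^sup>L \<nu> u\<bar> \<le> ennreal ?C * (\<integral>\<^sup>+p. ennreal (ell1 (fst p) (snd p)) \<partial>\<gamma>)"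
    proof (rule integral_diff_le_coupling[OF \<gamma> u])
      show "\<bar>u x - u y\<bar> \<le> ?C * ell1 x y" for x y
        using H.kernel_pow_Suc_lipschitz[OF g(1-3), of m x y] unfolding u_def M c by simp
    qed (use C in simp)
    then show "ennreal \<bar>measure \<mu>t A - measure (bind \<nu> (kernel_pow \<pi>t (m + 1))) A\<bar>
        \<le> ennreal ?C * (\<integral>\<^sup>+p. ennreal (ell1 (fst p) (snd p)) \<partial>\<gamma>)"
      unfolding ker mA using nA by simp
  qed
  also have "ennreal ?C = ennreal (3/2 * H.CTV * M) * ennreal (exp (- c * real m))"
    using M0 H.CTV_pos by (simp flip: ennreal_mult)
  finally show ?thesis by (simp add: H.CTV_def ac_simps)
qed

end
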